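(* Let $N\ge 2$, let $\Omega\subset\mathbb{R}^N$ be a nonempty open bounded set, let $L>0$, $p\in(N-1,+\infty)$, and let $f\in L^{q_0}(\Omega)$ with $f\neq0$, where $q_0$ is as defined below. Then the $p$-compliance functional $C_{f,\Omega}$ admits no minimizer over the class \[ \bigl\{\Sigma\subset\overline{\Omega}:\ \Sigma \text{ is closed},\ 0<\mathcal{H}^1(\Sigma)\le L\bigr\} \] (no connectedness assumption is imposed).
   Context: $\mathcal{H}^1$ denotes the one-dimensional Hausdorff measure. The exponent $q_0$ is defined by: $q_0=(p^* )'$ if $1<p<N$, where $p^*=Np/(N-p)$ and $1/p^*+1/(p^* )'=1$; $q_0>1$ (arbitrary) if $p=N$; $q_0=1$ if $p>N$. For $u\in W^{1,p}_0(\Omega)$ let $E_{f,\Omega}(u)=\frac1p\int_\Omega|\nabla u|^p\,dx-\int_\Omega fu\,dx$. For a closed proper subset $\Sigma$ of $\overline{\Omega}$, $u_{f,\Omega,\Sigma}$ denotes the unique minimizer of $E_{f,\Omega}$ over $W^{1,p}_0(\Omega\setminus\Sigma)$, where $W^{1,p}_0(U)$ is the closure of $C_0^\infty(U)$ in $W^{1,p}(U)$. The $p$-compliance is $C_{f,\Omega}(\Sigma)=-E_{f,\Omega}(u_{f,\Omega,\Sigma})=\frac{1}{p'}\int_\Omega|\nabla u_{f,\Omega,\Sigma}|^p\,dx$, with $1/p+1/p'=1$. *)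

theory Defs
  imports "HOL-Analysis.Analysis"
begin

definition hausdorff_pre1 :: "real \<Rightarrow> 'a::metric_space set \<Rightarrow> ennreal" where
  "hausdorff_pre1 \<delta> S =
     (INF C \<in> {C :: nat \<Rightarrow> 'a set. S \<subseteq> (\<Union>i. C i) \<and>
                 (\<forall>i. bounded (C i) \<and> diameter (C i) \<le> \<delta>)}.
        (\<Sum>i. ennreal (diameter (C i))))"

definition hausdorff1 :: "'a::metric_space set \<Rightarrow> ennreal" where
  "hausdorff1 S = (SUP \<delta> \<in> {0<..}. hausdorff_pre1 \<delta> S)"

text \<open>D k x vs is the k-th Frechet derivative of phi at x applied to the vectors vs.
  A function is C^infinity iff derivatives of every order exist everywhere.\<close>

definition smooth_fun :: "('a::euclidean_space \<Rightarrow> real) \<Rightarrow> bool" where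
  "smooth_fun \<phi> \<longleftrightarrow> (\<exists>D :: nat \<Rightarrow> 'a \<Rightarrow> 'a list \<Rightarrow> real.
      (\<forall>x. D 0 x [] = \<phi> x) \<and>
      (\<forall>k x vs. length vs = k \<longrightarrow>
          ((\<lambda>y. D k y vs) has_derivative (\<lambda>h. D (Suc k) x (h # vs))) (at x)))"

definition test_functions :: "'a::euclidean_space set \<Rightarrow> ('a \<Rightarrow> real) set" where
  "test_functions U = {\<phi>. smooth_fun \<phi> \<and> compact (closure {x. \<phi> x \<noteq> 0})
                             \<and> closure {x. \<phi> x \<noteq> 0} \<subseteq> U}"

text \<open>sobolev0 p U u g: u (extended by zero outside U) lies in W_0^{1,p}(U), the closure of
 C_c^infinity(U) in W^{1,p}, and g is its (weak) gradient: there are test functions phi_k with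
 gradients G_k such that phi_k -> u and G_k -> g in L^p.\<close>

definition sobolev0 :: "real \<Rightarrow> 'a::euclidean_space set \<Rightarrow> ('a \<Rightarrow> real) \<Rightarrow> ('a \<Rightarrow> 'a) \<Rightarrow> bool" where
  "sobolev0 p U u g \<longleftrightarrow>
     u \<in> borel_measurable lebesgue \<and> g \<in> borel_measurable lebesgue \<and>
     (\<exists>\<phi> G. (\<forall>k. \<phi> k \<in> test_functions U) \<and>
            (\<forall>k x. (\<phi> k has_derivative (\<lambda>h. G k x \<bullet> h)) (at x)) \<and>
            (\<lambda>k. \<integral>\<^sup>+ x. ennreal (\<bar>\<phi> k x - u x\<bar> powr p) \<partial>lebesgue) \<longlonglongrightarrow> 0 \<and>
            (\<lambda>k. \<integral>\<^sup>+ x. ennreal (norm (G k x - g x) powr p) \<partial>lebesgue) \<longlonglongrightarrow> 0)"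

definition energy :: "real \<Rightarrow> ('a::euclidean_space \<Rightarrow> real) \<Rightarrow> 'a set \<Rightarrow> ('a \<Rightarrow> real) \<Rightarrow> ('a \<Rightarrow> 'a) \<Rightarrow> real" where
  "energy p f \<Omega> u g = (1 / p) * (LINT x:\<Omega>|lebesgue. norm (g x) powr p)
                        - (LINT x:\<Omega>|lebesgue. f x * u x)"

definition compliance :: "real \<Rightarrow> ('a::euclidean_space \<Rightarrow> real) \<Rightarrow> 'a set \<Rightarrow> 'a set \<Rightarrow> real" where
  "compliance p f \<Omega> \<Sigma> =
     - (INF ug \<in> {(u, g). sobolev0 p (\<Omega> - \<Sigma>) u g}. energy p f \<Omega> (fst ug) (snd ug))"

definition in_Lq :: "real \<Rightarrow> 'a::euclidean_space set \<Rightarrow> ('a \<Rightarrow> real) \<Rightarrow> bool" where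
  "in_Lq q \<Omega> f \<longleftrightarrow> set_borel_measurable lebesgue \<Omega> f \<and>
                    set_integrable lebesgue \<Omega> (\<lambda>x. \<bar>f x\<bar> powr q)"

definition q0_hyp :: "nat \<Rightarrow> real \<Rightarrow> 'a::euclidean_space set \<Rightarrow> ('a \<Rightarrow> real) \<Rightarrow> bool" where
  "q0_hyp N p \<Omega> f \<longleftrightarrow>
     (if p < real N then
        (let ps = real N * p / (real N - p) in in_Lq (ps / (ps - 1)) \<Omega> f)
      else if p = real N then (\<exists>q>1. in_Lq q \<Omega> f)
      else in_Lq 1 \<Omega> f)"

end

theory Submission
  imports Defs
begin

text \<open>
  The infimum of the compliance over the class is 0, and it is not attained. Divide a box containing
  the domain into cells of side \<epsilon> and put into each cell a segment of length \<delta> proportional to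
  \<epsilon>^N, so that the total length stays below L. If u vanishes on these segments, then integrating
  its gradient along the rays from the points of a segment to the points of its cell bounds the
  integral of |u| over the cell by \<epsilon>^N times the integral of |grad u (z)| |z - s|^(1-N), averaged
  over s in the segment. Young's inequality with weights |z_1 - s_1|^\<alpha>, where
  N - p < \<alpha> < 1, turns this into
  C (\<epsilon>^(N (1-\<alpha>)) \<integral>|grad u|^p + o(1)), which tends to 0; this is where p > N - 1 enters.
  The unbounded part of f is absorbed by the Sobolev inequality (Gagliardo-Nirenberg if p \<le> N, the same
  potential estimate if p > N), so the compliance of these sets tends to 0.
  A minimizer would therefore have compliance 0. Then the energy is nonnegative on the test functions
  supported off the minimizing set, hence \<integral>f\<phi> = 0 for all of them and f = 0 almost everywhere
  off that set, which is a Lebesgue null set because its one-dimensional measure is finite.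
\<close>

section \<open>Potential estimate\<close>

text \<open>Segments are the right obstacles because a line has positive p-capacity exactly when p >
  N - 1, and the exponent \<alpha> is the quantitative form of this fact. Two singularities have to
  be balanced: the weight |z_i - \<sigma>|^(-\<alpha>) must be integrable along a segment, which
  asks \<alpha> < 1, and the conjugate power of what is left of the kernel must be integrable in N
  dimensions, which asks \<alpha> > N - p. The rest is scaling: about \<epsilon>^(-N) cells share a
  fixed length. No minimizing function is ever produced. \<open>compliance\<close> is minus an
  infimum of real numbers, so every estimate on u is turned into a lower bound for the energy, and
  boundedness below has to be known before the infimum says anything. Since \<open>sobolev0\<close>
  is a closure, all inequalities are proved for test functions and carried over at the end by
  Fatou's lemma. The linear term is never assumed integrable; its absolute value is bounded in
  [0, \<infinity>] by the gradient term.\<close>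

lemma has_integral_le_nn_integral:
  fixes g h :: "real \<Rightarrow> real"
  assumes g: "(g has_integral I) {a..b}" and h: "continuous_on UNIV h"
    and le: "\<And>t. \<bar>g t\<bar> \<le> h t"
  shows "ennreal \<bar>I\<bar> \<le> (\<integral>\<^sup>+t. ennreal (h t) * indicator {a..b} t \<partial>lborel)"
proof -
  have h0: "h t \<ge> 0" for t using le[of t] by simp
  have hi: "h integrable_on {a..b}"
    by (intro integrable_continuous_real continuous_on_subset[OF h]) auto
  have [measurable]: "h \<in> borel_measurable borel"
    by (rule borel_measurable_continuous_onI[OF h])
  have "\<bar>I\<bar> \<le> integral {a..b} h"
    using integral_norm_bound_integral[OF has_integral_integrable[OF g] hi] integral_unique[OF g] le by auto
  also have "ennreal (integral {a..b} h) = (\<integral>\<^sup>+t. ennreal (h t * indicator {a..b} t) \<partial>lborel)"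
  proof (rule nn_integral_has_integral_lborel[symmetric])
    have "((\<lambda>t. if t \<in> {a..b} then h t else 0) has_integral integral {a..b} h) UNIV"
      using integrable_integral[OF hi] by (simp only: has_integral_restrict_UNIV)
    then show "((\<lambda>t. h t * indicator {a..b} t) has_integral integral {a..b} h) UNIV"
      by (rule has_integral_eq_rhs[OF has_integral_eq, rotated]) (auto simp: indicator_def)
  qed (auto simp: h0)
  also have "\<dots> = (\<integral>\<^sup>+t. ennreal (h t) * indicator {a..b} t \<partial>lborel)"
    by (intro nn_integral_cong) (auto simp: indicator_def)
  finally show ?thesis by (simp add: ennreal_leI)
qed

lemma nn_integral_lborel_affine:
  fixes F :: "'a::euclidean_space \<Rightarrow> ennreal"
  assumes [measurable]: "F \<in> borel_measurable borel" and c: "c \<noteq> 0"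
  shows "(\<integral>\<^sup>+x. F x \<partial>lborel) = ennreal (\<bar>c\<bar> ^ DIM('a)) * (\<integral>\<^sup>+x. F (t + c *\<^sub>R x) \<partial>lborel)"
  by (subst lborel_affine[OF c, of t])
     (simp add: nn_integral_density nn_integral_distr nn_integral_cmult)

lemma nn_integral_power_tail:
  fixes a :: real
  assumes "a > 0" "n > 0"
  shows "(\<integral>\<^sup>+t. ennreal ((1/t) ^ Suc n) * indicator {a..} t \<partial>lborel) = ennreal ((1/a) ^ n / n)"
proof -
  have der: "((\<lambda>t. - ((1/t) ^ n / n)) has_real_derivative (1/t) ^ Suc n) (at t)" if "a \<le> t" for t
  proof -
    have t: "t > 0" using assms that by simp
    obtain k where k: "n = Suc k"
      using \<open>n > 0\<close> gr0_conv_Suc by blast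
    have "((\<lambda>t. 1 / t) has_real_derivative - ((1/t) * (1/t))) (at t)"
      using t by (auto intro!: derivative_eq_intros)
    from DERIV_cdivide[OF DERIV_minus[OF DERIV_power[OF this, of n]], of "real n"]
    show ?thesis by (simp add: k)
  qed
  have lim: "((\<lambda>t::real. - ((1/t) ^ n / n)) \<longlongrightarrow> - (0 ^ n / n)) at_top"
    by (intro tendsto_intros tendsto_power real_tendsto_divide_at_top filterlim_ident tendsto_const)
       (use \<open>n > 0\<close> in auto)
  have "(\<integral>\<^sup>+t. ennreal ((1/t) ^ Suc n) * indicator {a..} t \<partial>lborel) = - (0 ^ n / n) - (- ((1/a) ^ n / n))"
    by (intro nn_integral_FTC_atLeast der lim) (use assms in auto)
  then show ?thesis using \<open>n > 0\<close> by (simp add: power_0_left)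
qed

text \<open>The fundamental theorem of calculus on the segment from \<open>s\<close> to
  \<open>y\<close>, moved into [0, \<infinity>] so that Tonelli applies without integrability
  checks. The endpoint t = 0, a null set, is dropped because the next substitution divides by
  t.\<close>

lemma diff_le_ray_integral:
  fixes \<phi> :: "'a::euclidean_space \<Rightarrow> real"
  assumes der: "\<And>x. (\<phi> has_derivative (\<lambda>h. G x \<bullet> h)) (at x)"
    and cont: "continuous_on UNIV G"
  shows "ennreal \<bar>\<phi> y - \<phi> s\<bar> \<le>
           (\<integral>\<^sup>+t. ennreal (norm (G (s + t *\<^sub>R (y - s))) * norm (y - s)) * indicator {0<..1} t \<partial>lborel)"
proof -
  let ?g = "\<lambda>t::real. G (s + t *\<^sub>R (y - s)) \<bullet> (y - s)"
  let ?h = "\<lambda>t::real. norm (G (s + t *\<^sub>R (y - s))) * norm (y - s)"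
  have contG: "continuous_on A (\<lambda>t::real. G (s + t *\<^sub>R (y - s)))" for A
    by (rule continuous_on_compose2[OF cont]) (auto intro!: continuous_intros)
  have ch: "continuous_on A ?h" for A by (intro continuous_intros contG)
  have "((\<lambda>t. \<phi> (s + t *\<^sub>R (y - s))) has_vector_derivative ?g t) (at t within {0..1})" for t
  proof -
    have "((\<lambda>t. s + t *\<^sub>R (y - s)) has_derivative (\<lambda>h. h *\<^sub>R (y - s))) (at t within {0..1})"
      by (auto intro!: derivative_eq_intros)
    from has_derivative_compose[OF this der]
    show ?thesis by (simp add: has_vector_derivative_def mult.commute)
  qed
  then have "(?g has_integral (\<phi> (s + 1 *\<^sub>R (y - s)) - \<phi> (s + 0 *\<^sub>R (y - s)))) {0..1}"
    by (intro fundamental_theorem_of_calculus) auto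
  then have g: "(?g has_integral (\<phi> y - \<phi> s)) {0..1}" by simp
  have "\<bar>?g t\<bar> \<le> ?h t" for t by (rule Cauchy_Schwarz_ineq2)
  then have "ennreal \<bar>\<phi> y - \<phi> s\<bar> \<le> (\<integral>\<^sup>+t. ennreal (?h t) * indicator {0..1} t \<partial>lborel)"
    by (rule has_integral_le_nn_integral[OF g ch])
  also have "\<dots> = (\<integral>\<^sup>+t. ennreal (?h t) * indicator {0<..1} t \<partial>lborel)"
    by (intro nn_integral_cong_AE eventually_mono[OF AE_lborel_singleton[of 0]])
       (auto simp: indicator_def)
  finally show ?thesis .
qed

text \<open>The integrand after the substitution y = s + (z - s) / t. Convexity keeps z in
  \<open>Q\<close>, the ball turns into the lower cutoff t \<ge> |z - s| / D, and the factor 1 / t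
  comes from |y - s| = |z - s| / t.\<close>

lemma scaled_ray_le:
  fixes G :: "'a::euclidean_space \<Rightarrow> 'a"
  assumes t: "0 < t" "t \<le> 1" and Q: "convex Q" "s \<in> Q" "Q \<subseteq> cball s D" and D: "D > 0"
  shows "ennreal (norm (G (s + t *\<^sub>R (s + (1/t) *\<^sub>R (z - s) - s))) * norm (s + (1/t) *\<^sub>R (z - s) - s))
           * indicator Q (s + (1/t) *\<^sub>R (z - s))
         \<le> ennreal (norm (G z) * norm (z - s)) * indicator Q z * ennreal (1/t) * indicator {norm (z - s) / D..} t"
proof (cases "s + (1/t) *\<^sub>R (z - s) \<in> Q")
  case True
  let ?y = "s + (1/t) *\<^sub>R (z - s)"
  have "(1 - t) *\<^sub>R s + t *\<^sub>R ?y \<in> Q"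
    using convexD[OF Q(1) Q(2) True, of "1 - t" t] t by auto
  moreover have "(1 - t) *\<^sub>R s + t *\<^sub>R ?y = z"
    using t by (simp add: algebra_simps)
  ultimately have z: "z \<in> Q" by simp
  have "?y \<in> cball s D" using True Q(3) by blast
  then have "norm (z - s) / t \<le> D"
    using t by (simp add: dist_norm)
  then have "norm (z - s) / D \<le> t" using t D by (simp add: field_simps)
  then show ?thesis
    using True z t by (simp add: ennreal_mult[symmetric] divide_inverse mult.assoc)
qed simp

text \<open>The classical potential estimate, without polar coordinates: for fixed t the map from z
  to y is a dilation with Jacobian t^(-N), and after exchanging the integrals the t-integral of
  t^(-N-1) from |z - s| / D to infinity is D^N / (N |z - s|^N). The factor |z - s| of the ray then
  leaves the kernel |z - s|^(1-N).\<close>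

lemma convex_diff_integral_le:
  fixes \<phi> :: "'a::euclidean_space \<Rightarrow> real"
  assumes der: "\<And>x. (\<phi> has_derivative (\<lambda>h. G x \<bullet> h)) (at x)"
    and cont: "continuous_on UNIV G"
    and Q: "convex Q" "s \<in> Q" "Q \<subseteq> cball s D" and D: "D > 0" and Qm: "Q \<in> sets borel"
  shows "(\<integral>\<^sup>+y. ennreal \<bar>\<phi> y - \<phi> s\<bar> * indicator Q y \<partial>lborel) \<le>
         ennreal (D ^ DIM('a) / DIM('a)) *
           (\<integral>\<^sup>+z. ennreal (norm (G z) * (1 / norm (z - s)) ^ (DIM('a) - 1)) * indicator Q z \<partial>lborel)"
proof -
  let ?N = "DIM('a)"
  have N: "?N > 0" by simp
  note [measurable] = Qm borel_measurable_continuous_onI[OF cont]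
  let ?F = "\<lambda>y t. ennreal (norm (G (s + t *\<^sub>R (y - s))) * norm (y - s)) * indicator Q y"
  let ?K = "\<lambda>z. ennreal (norm (G z) * norm (z - s)) * indicator Q z"
  have "(\<integral>\<^sup>+y. ennreal \<bar>\<phi> y - \<phi> s\<bar> * indicator Q y \<partial>lborel)
      \<le> (\<integral>\<^sup>+y. (\<integral>\<^sup>+t. ?F y t * indicator {0<..1::real} t \<partial>lborel) \<partial>lborel)"
  proof (intro nn_integral_mono)
    fix y :: 'a
    have eq: "(\<integral>\<^sup>+t. ennreal (norm (G (s + t *\<^sub>R (y - s))) * norm (y - s)) * indicator {0<..1} t \<partial>lborel) * indicator Q y
      = (\<integral>\<^sup>+t. ?F y t * indicator {0<..1::real} t \<partial>lborel)"
      by (subst nn_integral_multc[symmetric], measurable) (simp only: mult_ac)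
    show "ennreal \<bar>\<phi> y - \<phi> s\<bar> * indicator Q y \<le> (\<integral>\<^sup>+t. ?F y t * indicator {0<..1::real} t \<partial>lborel)"
      using mult_right_mono[OF diff_le_ray_integral[OF der cont, of y s], of "indicator Q y"]
      unfolding eq by simp
  qed
  also have "\<dots> = (\<integral>\<^sup>+t. (\<integral>\<^sup>+y. ?F y t * indicator {0<..1::real} t \<partial>lborel) \<partial>lborel)"
    by (rule lborel_pair.Fubini') measurable
  also have "\<dots> \<le> (\<integral>\<^sup>+t. (\<integral>\<^sup>+z. ?K z * (ennreal ((1/t) ^ Suc ?N) * indicator {norm (z - s) / D..} t * indicator {0<..1::real} t) \<partial>lborel) \<partial>lborel)"
  proof (rule nn_integral_mono)
    fix t :: real
    show "(\<integral>\<^sup>+y. ?F y t * indicator {0<..1::real} t \<partial>lborel) \<le> (\<integral>\<^sup>+z. ?K z * (ennreal ((1/t) ^ Suc ?N) * indicator {norm (z - s) / D..} t * indicator {0<..1::real} t) \<partial>lborel)"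
    proof (cases "t \<in> {0<..1}")
      case True
      then have t: "0 < t" "t \<le> 1" by auto
      have affine_eq: "(s - (1/t) *\<^sub>R s) + (1/t) *\<^sub>R z = s + (1/t) *\<^sub>R (z - s)" for z
        by (simp add: scaleR_diff_right)
      have abs_t: "\<bar>1/t\<bar> = 1/t" using t by simp
      have "(\<integral>\<^sup>+y. ?F y t \<partial>lborel) = ennreal (\<bar>1/t\<bar> ^ ?N) * (\<integral>\<^sup>+z. ?F ((s - (1/t) *\<^sub>R s) + (1/t) *\<^sub>R z) t \<partial>lborel)"
        by (rule nn_integral_lborel_affine[where F="\<lambda>y. ?F y t" and c="1/t"]) (measurable, use t in simp)
      also have "\<dots> = (\<integral>\<^sup>+z. ennreal ((1/t) ^ ?N) * ?F (s + (1/t) *\<^sub>R (z - s)) t \<partial>lborel)"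
        by (subst nn_integral_cmult[symmetric]) (measurable, simp only: affine_eq abs_t)
      also have "\<dots> \<le> (\<integral>\<^sup>+z. ennreal ((1/t) ^ ?N) * (?K z * ennreal (1/t) * indicator {norm (z - s) / D..} t) \<partial>lborel)"
        by (intro nn_integral_mono mult_left_mono scaled_ray_le[OF t Q D]) auto
      also have "\<dots> = (\<integral>\<^sup>+z. ?K z * (ennreal ((1/t) ^ Suc ?N) * indicator {norm (z - s) / D..} t) \<partial>lborel)"
      proof -
        have "ennreal ((1/t) ^ Suc ?N) = ennreal ((1/t) ^ ?N) * ennreal (1/t)"
          using t by (subst ennreal_mult[symmetric]) (auto simp: mult.commute)
        then show ?thesis by (simp only: mult_ac)
      qed
      finally show ?thesis using True by simp
    qed simp
  qed
  also have "\<dots> = (\<integral>\<^sup>+z. (\<integral>\<^sup>+t. ?K z * (ennreal ((1/t) ^ Suc ?N) * indicator {norm (z - s) / D..} t * indicator {0<..1::real} t) \<partial>lborel) \<partial>lborel)"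
  proof (rule lborel_pair.Fubini')
    have [measurable]: "Measurable.pred (borel \<Otimes>\<^sub>M borel) (\<lambda>x::'a \<times> real. norm (fst x - s) / D \<le> snd x)"
      by measurable
    show "(\<lambda>(y, x). ennreal (norm (G y) * norm (y - s)) * indicator Q y *
       (ennreal ((1 / x) ^ Suc DIM('a)) * indicator {norm (y - s) / D..} x * indicator {0<..1} x))
      \<in> borel_measurable (lborel \<Otimes>\<^sub>M lborel)"
      unfolding case_prod_beta indicator_def[of "atLeast _"] atLeast_iff by measurable
  qed
  also have "\<dots> \<le> (\<integral>\<^sup>+z. ennreal (D ^ ?N / ?N) * (ennreal (norm (G z) * (1 / norm (z - s)) ^ (?N - 1)) * indicator Q z) \<partial>lborel)"
  proof (intro nn_integral_mono)
    fix z :: 'a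
    show "(\<integral>\<^sup>+t. ?K z * (ennreal ((1/t) ^ Suc ?N) * indicator {norm (z - s) / D..} t * indicator {0<..1::real} t) \<partial>lborel)
        \<le> ennreal (D ^ ?N / ?N) * (ennreal (norm (G z) * (1 / norm (z - s)) ^ (?N - 1)) * indicator Q z)"
    \<comment> \<open>At z = s the factor \<open>norm (z - s)\<close> makes the left side 0, so the
      convention 1 / 0 = 0 on the right does no harm.\<close>
    proof (cases "z = s")
      case False
      define a where "a = norm (z - s) / D"
      have a: "a > 0" using False D by (simp add: a_def)
      have "(\<integral>\<^sup>+t. ?K z * (ennreal ((1/t) ^ Suc ?N) * indicator {norm (z - s) / D..} t * indicator {0<..1::real} t) \<partial>lborel)
        \<le> (\<integral>\<^sup>+t. ?K z * (ennreal ((1/t) ^ Suc ?N) * indicator {a..} t) \<partial>lborel)"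
        unfolding a_def by (intro nn_integral_mono mult_left_mono) (auto simp: indicator_def)
      also have "\<dots> = ?K z * ennreal ((1/a) ^ ?N / ?N)"
        by (subst nn_integral_cmult) (simp, subst nn_integral_power_tail[OF a N], simp)
      also have "\<dots> = ennreal (norm (G z) * norm (z - s) * ((1/a) ^ ?N / ?N)) * indicator Q z"
      proof -
        have "ennreal (norm (G z) * norm (z - s) * ((1/a) ^ ?N / ?N))
            = ennreal (norm (G z) * norm (z - s)) * ennreal ((1/a) ^ ?N / ?N)"
          using a by (intro ennreal_mult) auto
        then show ?thesis by (simp only: mult_ac)
      qed
      also have "norm (G z) * norm (z - s) * ((1/a) ^ ?N / ?N)
          = D ^ ?N / ?N * (norm (G z) * (1 / norm (z - s)) ^ (?N - 1))"
      proof -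
        obtain k where k: "?N = Suc k" using N gr0_conv_Suc by blast
        have "norm (z - s) * (1/a) ^ Suc k = D ^ Suc k * (1 / norm (z - s)) ^ k"
          unfolding a_def using False D by (simp add: field_simps)
        then have "norm (G z) * (norm (z - s) * (1/a) ^ ?N) / ?N
            = norm (G z) * (D ^ ?N * (1 / norm (z - s)) ^ (?N - 1)) / ?N"
          by (simp only: k diff_Suc_1)
        then show ?thesis by (simp add: mult_ac)
      qed
      also have "ennreal (D ^ ?N / ?N * (norm (G z) * (1 / norm (z - s)) ^ (?N - 1))) * indicator Q z
          = ennreal (D ^ ?N / ?N) * (ennreal (norm (G z) * (1 / norm (z - s)) ^ (?N - 1)) * indicator Q z)"
        using D by (subst ennreal_mult) (auto simp: mult_ac)
      finally show ?thesis .
    qed simp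
  qed
  also have "\<dots> = ennreal (D ^ ?N / ?N) *
           (\<integral>\<^sup>+z. ennreal (norm (G z) * (1 / norm (z - s)) ^ (DIM('a) - 1)) * indicator Q z \<partial>lborel)"
    by (intro nn_integral_cmult) measurable
  finally show ?thesis .
qed

section \<open>Splitting the kernel by Young's inequality; singular integrals on the line\<close>

text \<open>Young's inequality for (g a^(-\<alpha>/p)) (a^(\<alpha>/p) r^(1-N)) with a = |w_i| and r
  = |w|. The weight sits on one coordinate, the direction of the segment, where it will be averaged.
  Since N \<nu> = (N - 1 - \<alpha>/p) p / (p - 1), the conjugate power is at most r^(-N \<nu>);
  spreading it evenly over the coordinates makes its integral a product of N integrals on the line,
  finite as soon as \<nu> < 1. Zero coordinates are excluded because
  \<open>0 powr (-\<nu>) = 0\<close>.\<close>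

lemma kernel_product_le:
  fixes w :: "'a::euclidean_space"
  assumes p: "p > 1" and \<alpha>: "0 \<le> \<alpha>" "\<alpha> / p \<le> DIM('a) - 1" and i: "i \<in> Basis"
    and w: "\<And>b. b \<in> Basis \<Longrightarrow> w \<bullet> b \<noteq> 0" and g: "g \<ge> 0"
    and \<nu>: "\<nu> = (DIM('a) - 1 - \<alpha> / p) * (p / (p - 1)) / DIM('a)"
  shows "g * (1 / norm w) ^ (DIM('a) - 1)
         \<le> g powr p * \<bar>w \<bullet> i\<bar> powr (-\<alpha>) + (\<Prod>b\<in>Basis. \<bar>w \<bullet> b\<bar> powr (-\<nu>))"
proof -
  define a where "a = \<bar>w \<bullet> i\<bar>"
  define r where "r = norm w"
  define q where "q = p / (p - 1)"
  define N where "N = real DIM('a)"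
  have a: "a > 0" "a \<le> r" using w[OF i] Basis_le_norm[OF i, of w] by (auto simp: a_def r_def)
  then have r: "r > 0" by simp
  have N: "N > 0" by (simp add: N_def)
  have q: "q > 1" "1/p + 1/q = 1" using p by (auto simp: q_def field_simps)
  have n1: "real (DIM('a) - 1) = N - 1"
    using DIM_positive[where 'a='a] by (simp add: N_def of_nat_diff)
  have \<alpha>': "\<alpha> / p \<le> N - 1" using \<alpha>(2) n1 by simp
  have \<nu>': "\<nu> = (N - 1 - \<alpha> / p) * q / N"
    using \<nu> n1 by (simp add: q_def N_def)
  have \<nu>0: "\<nu> \<ge> 0" unfolding \<nu>' using \<alpha>' q N by simp
  have inv: "(1 / r) ^ (DIM('a) - 1) = r powr (- (N - 1))"
    unfolding powr_minus using r by (simp add: powr_realpow[symmetric] n1 N_def power_one_over divide_inverse inverse_powr)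
  define x where "x = g * a powr (- \<alpha> / p)"
  define y where "y = a powr (\<alpha> / p) * r powr (- (N - 1))"
  have "a powr (- \<alpha> / p) * a powr (\<alpha> / p) = 1"
    using a by (simp flip: powr_add)
  then have "g * (1 / r) ^ (DIM('a) - 1) = x * y"
    unfolding inv x_def y_def by (simp add: mult_ac)
  also have "x * y \<le> x powr p / p + y powr q / q"
    using p q g by (intro Youngs_inequality) (auto simp: x_def y_def)
  also have "\<dots> \<le> x powr p + y powr q"
    using p q by (intro add_mono) (auto simp: divide_le_eq mult_le_cancel_left1 mult_le_cancel_right1
        intro: mult_right_le_one_le)
  also have "x powr p = g powr p * a powr (-\<alpha>)"
    using p g a by (simp add: x_def powr_mult powr_powr)
  also have "y powr q \<le> (\<Prod>b\<in>Basis. \<bar>w \<bullet> b\<bar> powr (-\<nu>))"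
  proof -
    have "y \<le> r powr (\<alpha> / p) * r powr (- (N - 1))"
      unfolding y_def using a p \<alpha> by (intro mult_right_mono powr_mono2) auto
    also have "\<dots> = r powr (- (N - 1 - \<alpha> / p))"
      by (simp add: algebra_simps flip: powr_add)
    finally have "y powr q \<le> (r powr (- (N - 1 - \<alpha> / p))) powr q"
      using q a by (intro powr_mono2) (auto simp: y_def)
    also have "\<dots> = r powr (- (N * \<nu>))"
    proof -
      have "N * \<nu> = (N - 1 - \<alpha> / p) * q" using N by (simp add: \<nu>')
      then show ?thesis by (simp only: powr_powr mult_minus_left)
    qed
    also have "\<dots> = (r powr (-\<nu>)) ^ DIM('a)"
      using r by (simp add: powr_realpow[symmetric] powr_powr N_def mult_ac)
    also have "\<dots> = (\<Prod>b\<in>(Basis::'a set). r powr (-\<nu>))" by simp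
    also have "\<dots> \<le> (\<Prod>b\<in>Basis. \<bar>w \<bullet> b\<bar> powr (-\<nu>))"
      using w \<nu>0 Basis_le_norm[of _ w]
      by (intro prod_mono conjI powr_mono2') (auto simp: r_def)
    finally show ?thesis .
  qed
  finally show ?thesis by (simp add: a_def r_def)
qed

lemma nn_integral_powr_near_zero:
  fixes \<kappa> r c :: real
  assumes "\<kappa> < 1" "r \<ge> 0"
  shows "(\<integral>\<^sup>+x. ennreal (\<bar>x - c\<bar> powr (-\<kappa>)) * indicator {c - r..c + r} x \<partial>lborel)
         \<le> ennreal (2 / (1 - \<kappa>) * r powr (1 - \<kappa>))"
proof -
  let ?h = "\<lambda>x::real. x powr (-\<kappa>) * indicator {0..r} x"
  have "((\<lambda>x. if x \<in> {0..r} then x powr (-\<kappa>) else 0) has_integral r powr (- \<kappa> + 1) / (- \<kappa> + 1)) UNIV"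
    using has_integral_powr_from_0[of "-\<kappa>" r] assms by (simp only: has_integral_restrict_UNIV)
  then have "(?h has_integral (r powr (- \<kappa> + 1) / (- \<kappa> + 1))) UNIV"
    by (rule has_integral_eq_rhs[OF has_integral_eq, rotated]) (auto simp: indicator_def)
  then have h: "(\<integral>\<^sup>+x. ennreal (?h x) \<partial>lborel) = ennreal (r powr (1 - \<kappa>) / (1 - \<kappa>))"
    by (subst nn_integral_has_integral_lborel) (auto simp: add.commute)
  have m: "(\<integral>\<^sup>+x. ennreal (?h (-c + 1 * x)) \<partial>lborel) = (\<integral>\<^sup>+x. ennreal (?h x) \<partial>lborel)"
    by (subst nn_integral_real_affine[where f="\<lambda>x. ennreal (?h x)" and c=1 and t="-c"]) auto
  have m': "(\<integral>\<^sup>+x. ennreal (?h (c + -1 * x)) \<partial>lborel) = (\<integral>\<^sup>+x. ennreal (?h x) \<partial>lborel)"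
    by (subst nn_integral_real_affine[where f="\<lambda>x. ennreal (?h x)" and c="-1" and t=c]) auto
  \<comment> \<open>The interval is folded at c: each half is mapped onto {0..r}, where the
    primitive is explicit.\<close>
  have "(\<integral>\<^sup>+x. ennreal (\<bar>x - c\<bar> powr (-\<kappa>)) * indicator {c - r..c + r} x \<partial>lborel)
      \<le> (\<integral>\<^sup>+x. ennreal (?h (-c + 1 * x)) + ennreal (?h (c + -1 * x)) \<partial>lborel)"
    by (intro nn_integral_mono) (auto simp: indicator_def ennreal_plus[symmetric] simp del: ennreal_plus)
  also have "\<dots> = 2 * ennreal (r powr (1 - \<kappa>) / (1 - \<kappa>))"
    by (subst nn_integral_add) (auto simp only: m m' h mult_2, measurable)
  also have "\<dots> = ennreal (2 / (1 - \<kappa>) * r powr (1 - \<kappa>))"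
    using assms by (simp add: ennreal_mult[symmetric] flip: ennreal_numeral)
  finally show ?thesis .
qed

text \<open>Uniform in \<tau>: points \<sigma> within \<delta> of \<tau> fall under the singular
  integral centred at \<tau>, at the others the integrand is at most \<delta>^(-\<alpha>). The
  factor \<delta> is kept apart so that it cancels when averaging over the segment.\<close>

lemma nn_integral_powr_segment:
  fixes \<alpha> \<delta> \<tau> :: real
  assumes "0 \<le> \<alpha>" "\<alpha> < 1" "\<delta> > 0"
  shows "(\<integral>\<^sup>+\<sigma>. ennreal (\<bar>\<tau> - \<sigma>\<bar> powr (-\<alpha>)) * indicator {0..\<delta>} \<sigma> \<partial>lborel)
         \<le> ennreal (\<delta> * ((2 / (1 - \<alpha>) + 1) * \<delta> powr (-\<alpha>)))"
proof -
  have "(\<integral>\<^sup>+\<sigma>. ennreal (\<bar>\<tau> - \<sigma>\<bar> powr (-\<alpha>)) * indicator {0..\<delta>} \<sigma> \<partial>lborel)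
      \<le> (\<integral>\<^sup>+\<sigma>. ennreal (\<bar>\<sigma> - \<tau>\<bar> powr (-\<alpha>)) * indicator {\<tau> - \<delta>..\<tau> + \<delta>} \<sigma> +
                ennreal (\<delta> powr (-\<alpha>)) * indicator {0..\<delta>} \<sigma> \<partial>lborel)"
  proof (intro nn_integral_mono)
    fix \<sigma> :: real
    have "\<bar>\<tau> - \<sigma>\<bar> powr (-\<alpha>) \<le> \<delta> powr (-\<alpha>)" if "\<not> \<bar>\<tau> - \<sigma>\<bar> \<le> \<delta>"
      using assms that by (intro powr_mono2') auto
    then show "ennreal (\<bar>\<tau> - \<sigma>\<bar> powr (-\<alpha>)) * indicator {0..\<delta>} \<sigma>
      \<le> ennreal (\<bar>\<sigma> - \<tau>\<bar> powr (-\<alpha>)) * indicator {\<tau> - \<delta>..\<tau> + \<delta>} \<sigma> +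
                ennreal (\<delta> powr (-\<alpha>)) * indicator {0..\<delta>} \<sigma>"
      by (cases "\<bar>\<tau> - \<sigma>\<bar> \<le> \<delta>") (auto simp: indicator_def abs_minus_commute)
  qed
  also have "\<dots> \<le> ennreal (2 / (1 - \<alpha>) * \<delta> powr (1 - \<alpha>)) + ennreal (\<delta> powr (-\<alpha>)) * ennreal \<delta>"
    using assms nn_integral_powr_near_zero[of \<alpha> \<delta> \<tau>]
    by (subst nn_integral_add) (auto simp: nn_integral_cmult_indicator intro!: add_mono)
  also have "\<dots> = ennreal (\<delta> * ((2 / (1 - \<alpha>) + 1) * \<delta> powr (-\<alpha>)))"
  proof -
    have "\<delta> powr (1 - \<alpha>) = \<delta> * \<delta> powr (-\<alpha>)"
      using assms by (simp add: powr_diff powr_minus divide_inverse)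
    then show ?thesis using assms
      by (simp add: ennreal_mult[symmetric] ennreal_plus[symmetric] algebra_simps del: ennreal_plus)
  qed
  finally show ?thesis .
qed

section \<open>Functions vanishing on a grid of segments\<close>

lemma convex_diff_kernel_integral_le:
  fixes \<phi> :: "'a::euclidean_space \<Rightarrow> real"
  assumes der: "\<And>x. (\<phi> has_derivative (\<lambda>h. G x \<bullet> h)) (at x)"
    and cont: "continuous_on UNIV G"
    and Q: "convex Q" "s \<in> Q" "Q \<subseteq> cball s D" and D: "D > 0" and Qm: "Q \<in> sets borel"
    and p: "p > 1" and \<alpha>: "0 \<le> \<alpha>" "\<alpha> / p \<le> DIM('a) - 1" and i: "i \<in> Basis"
    and \<nu>: "\<nu> = (DIM('a) - 1 - \<alpha> / p) * (p / (p - 1)) / DIM('a)"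
  shows "(\<integral>\<^sup>+y. ennreal \<bar>\<phi> y - \<phi> s\<bar> * indicator Q y \<partial>lborel) \<le>
         ennreal (D ^ DIM('a) / DIM('a)) *
           ((\<integral>\<^sup>+z. ennreal (norm (G z) powr p * \<bar>(z - s) \<bullet> i\<bar> powr (-\<alpha>)) * indicator Q z \<partial>lborel) +
            (\<integral>\<^sup>+z. ennreal (\<Prod>b\<in>Basis. \<bar>(z - s) \<bullet> b\<bar> powr (-\<nu>)) * indicator Q z \<partial>lborel))"
proof -
  note [measurable] = Qm borel_measurable_continuous_onI[OF cont]
  \<comment> \<open>The Young splitting is stated for nonzero coordinates of z - s; the excluded
    points form a finite union of null hyperplanes.\<close>
  have ae: "AE z in lborel. \<forall>b\<in>Basis. z \<bullet> b \<noteq> s \<bullet> b"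
    by (rule AE_finite_allI) (auto intro: AE_lborel_inner_neq)
  have "(\<integral>\<^sup>+z. ennreal (norm (G z) * (1 / norm (z - s)) ^ (DIM('a) - 1)) * indicator Q z \<partial>lborel)
    \<le> (\<integral>\<^sup>+z. ennreal (norm (G z) powr p * \<bar>(z - s) \<bullet> i\<bar> powr (-\<alpha>)) * indicator Q z
         + ennreal (\<Prod>b\<in>Basis. \<bar>(z - s) \<bullet> b\<bar> powr (-\<nu>)) * indicator Q z \<partial>lborel)"
    using ae
  proof (intro nn_integral_mono_AE, eventually_elim)
    case (elim z)
    have "norm (G z) * (1 / norm (z - s)) ^ (DIM('a) - 1)
         \<le> norm (G z) powr p * \<bar>(z - s) \<bullet> i\<bar> powr (-\<alpha>) + (\<Prod>b\<in>Basis. \<bar>(z - s) \<bullet> b\<bar> powr (-\<nu>))"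
      using elim by (intro kernel_product_le p \<alpha> i \<nu>) (auto simp: inner_diff_left)
    then show ?case
      by (simp add: indicator_def prod_nonneg flip: ennreal_plus)
  qed
  also have "\<dots> = (\<integral>\<^sup>+z. ennreal (norm (G z) powr p * \<bar>(z - s) \<bullet> i\<bar> powr (-\<alpha>)) * indicator Q z \<partial>lborel) +
            (\<integral>\<^sup>+z. ennreal (\<Prod>b\<in>Basis. \<bar>(z - s) \<bullet> b\<bar> powr (-\<nu>)) * indicator Q z \<partial>lborel)"
    by (intro nn_integral_add) measurable
  finally show ?thesis
    by (intro order_trans[OF convex_diff_integral_le[OF der cont Q D Qm]] mult_left_mono) auto
qed

lemma nn_integral_prod_powr_le:
  fixes s :: "'a::euclidean_space"
  assumes "\<nu> < 1" "r \<ge> 0" and Q: "\<And>z b. z \<in> Q \<Longrightarrow> b \<in> Basis \<Longrightarrow> \<bar>(z - s) \<bullet> b\<bar> \<le> r"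
  shows "(\<integral>\<^sup>+z. ennreal (\<Prod>b\<in>Basis. \<bar>(z - s) \<bullet> b\<bar> powr (-\<nu>)) * indicator Q z \<partial>lborel)
     \<le> ennreal ((2 / (1 - \<nu>) * r powr (1 - \<nu>)) ^ DIM('a))"
proof -
  let ?h = "\<lambda>b x. ennreal (\<bar>x - s \<bullet> b\<bar> powr (-\<nu>)) * indicator {s \<bullet> b - r..s \<bullet> b + r} x"
  have "(\<integral>\<^sup>+z. ennreal (\<Prod>b\<in>Basis. \<bar>(z - s) \<bullet> b\<bar> powr (-\<nu>)) * indicator Q z \<partial>lborel)
    \<le> (\<integral>\<^sup>+z. (\<Prod>b\<in>Basis. ?h b (z \<bullet> b)) \<partial>lborel)"
  proof (intro nn_integral_mono)
    fix z :: 'a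
    have "(\<Prod>b\<in>Basis. ?h b (z \<bullet> b)) = ennreal (\<Prod>b\<in>Basis. \<bar>(z - s) \<bullet> b\<bar> powr (-\<nu>))" if "z \<in> Q"
    proof -
      have "z \<bullet> b \<in> {s \<bullet> b - r..s \<bullet> b + r}" if "b \<in> Basis" for b
        using Q[OF \<open>z \<in> Q\<close> that] by (auto simp: inner_diff_left)
      then show ?thesis
        by (subst prod_ennreal[symmetric]) (auto simp: inner_diff_left intro!: prod.cong)
    qed
    then show "ennreal (\<Prod>b\<in>Basis. \<bar>(z - s) \<bullet> b\<bar> powr (-\<nu>)) * indicator Q z \<le> (\<Prod>b\<in>Basis. ?h b (z \<bullet> b))"
      by (cases "z \<in> Q") auto
  qed
  also have "\<dots> = (\<Prod>b\<in>(Basis::'a set). \<integral>\<^sup>+x. ?h b x \<partial>lborel)"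
    by (rule nn_integral_lborel_prod) auto
  also have "\<dots> \<le> (\<Prod>b\<in>(Basis::'a set). ennreal (2 / (1 - \<nu>) * r powr (1 - \<nu>)))"
    using assms by (intro prod_mono_ennreal nn_integral_powr_near_zero) auto
  also have "\<dots> = ennreal ((2 / (1 - \<nu>) * r powr (1 - \<nu>)) ^ DIM('a))"
    using assms by (simp add: ennreal_power)
  finally show ?thesis .
qed

section \<open>Cells and segments of the grid\<close>

text \<open>Half-open, so that the translates by a lattice of step \<epsilon> tile the space without
  overlap.\<close>

definition grid_cell :: "'a::euclidean_space \<Rightarrow> real \<Rightarrow> 'a set" where
  "grid_cell c \<epsilon> = {x. \<forall>b\<in>Basis. c \<bullet> b \<le> x \<bullet> b \<and> x \<bullet> b < c \<bullet> b + \<epsilon>}"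

lemma grid_cell_borel [measurable]: "grid_cell c \<epsilon> \<in> sets borel"
proof -
  have "grid_cell c \<epsilon> = {x \<in> space borel. \<forall>b\<in>Basis. c \<bullet> b \<le> x \<bullet> b \<and> x \<bullet> b < c \<bullet> b + \<epsilon>}"
    by (simp add: grid_cell_def)
  also have "\<dots> \<in> sets borel" by measurable
  finally show ?thesis .
qed

lemma convex_grid_cell: "convex (grid_cell c \<epsilon>)"
proof -
  have "grid_cell c \<epsilon> = (\<Inter>b\<in>Basis. {x. b \<bullet> x \<ge> c \<bullet> b} \<inter> {x. b \<bullet> x < c \<bullet> b + \<epsilon>})"
    by (auto simp: grid_cell_def inner_commute)
  then show ?thesis
    by (auto intro!: convex_INT convex_Int convex_halfspace_ge convex_halfspace_lt)
qed

lemma grid_cell_coordinate_le: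
  assumes "x \<in> grid_cell c \<epsilon>" "y \<in> grid_cell c \<epsilon>" "b \<in> Basis"
  shows "\<bar>(x - y) \<bullet> b\<bar> \<le> \<epsilon>"
  using assms by (auto simp: grid_cell_def inner_diff_left abs_le_iff) (smt (verit))+

lemma grid_cell_subset_cball:
  fixes s :: "'a::euclidean_space"
  assumes "s \<in> grid_cell c \<epsilon>"
  shows "grid_cell c \<epsilon> \<subseteq> cball s (real DIM('a) * \<epsilon>)"
proof
  fix x assume "x \<in> grid_cell c \<epsilon>"
  then have "(\<Sum>b\<in>Basis. \<bar>(s - x) \<bullet> b\<bar>) \<le> (\<Sum>b\<in>(Basis::'a set). \<epsilon>)"
    using grid_cell_coordinate_le[OF assms] by (intro sum_mono) blast
  then have "norm (s - x) \<le> (\<Sum>b\<in>(Basis::'a set). \<epsilon>)"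
    using norm_le_l1[of "s - x"] by linarith
  then show "x \<in> cball s (real DIM('a) * \<epsilon>)" by (simp add: dist_norm)
qed

lemma segment_in_grid_cell:
  assumes "0 \<le> \<sigma>" "\<sigma> < \<epsilon>" "i \<in> Basis"
  shows "c + \<sigma> *\<^sub>R i \<in> grid_cell c \<epsilon>"
  using assms by (auto simp: grid_cell_def inner_add_left inner_Basis)

text \<open>Averaging the potential bound over the segment replaces the singular factor
  |z_i - \<sigma>|^(-\<alpha>) by a multiple of \<delta>^(-\<alpha>).\<close>

lemma cell_estimate:
  fixes \<phi> :: "'a::euclidean_space \<Rightarrow> real"
  assumes der: "\<And>x. (\<phi> has_derivative (\<lambda>h. G x \<bullet> h)) (at x)"
    and cont: "continuous_on UNIV G"
    and p: "p > 1" and \<alpha>: "0 \<le> \<alpha>" "\<alpha> < 1" "\<alpha> / p \<le> DIM('a) - 1" and i: "i \<in> Basis"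
    and \<nu>: "\<nu> = (DIM('a) - 1 - \<alpha> / p) * (p / (p - 1)) / DIM('a)" "\<nu> < 1"
    and \<delta>: "0 < \<delta>" "\<delta> < \<epsilon>"
    and zero: "\<And>\<sigma>. 0 \<le> \<sigma> \<Longrightarrow> \<sigma> \<le> \<delta> \<Longrightarrow> \<phi> (c + \<sigma> *\<^sub>R i) = 0"
  shows "(\<integral>\<^sup>+y. ennreal \<bar>\<phi> y\<bar> * indicator (grid_cell c \<epsilon>) y \<partial>lborel) \<le>
         ennreal ((real DIM('a) * \<epsilon>) ^ DIM('a) / DIM('a)) *
           (ennreal ((2 / (1 - \<alpha>) + 1) * \<delta> powr (-\<alpha>)) *
              (\<integral>\<^sup>+z. ennreal (norm (G z) powr p) * indicator (grid_cell c \<epsilon>) z \<partial>lborel) +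
            ennreal ((2 / (1 - \<nu>) * \<epsilon> powr (1 - \<nu>)) ^ DIM('a)))"
    (is "?L \<le> ?C * (ennreal ?A * ?X + ennreal ?B)")
proof -
  note [measurable] = borel_measurable_continuous_onI[OF cont]
  let ?Q = "grid_cell c \<epsilon>"
  let ?S = "{0..\<delta>}"
  have \<epsilon>: "\<epsilon> > 0" using \<delta> by simp
  have inC: "\<sigma> \<in> ?S \<Longrightarrow> c + \<sigma> *\<^sub>R i \<in> ?Q" for \<sigma>
    using \<delta> i by (intro segment_in_grid_cell) auto
  let ?k = "\<lambda>z \<sigma>. ennreal (norm (G z) powr p * \<bar>z \<bullet> i - c \<bullet> i - \<sigma>\<bar> powr (-\<alpha>)) * indicator ?Q z"
  \<comment> \<open>One potential estimate for every point \<sigma> of the segment. The Young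
    remainder is bounded uniformly in \<sigma>; only the gradient term still depends on it.\<close>
  have pt: "?L * indicator ?S \<sigma> \<le> ?C * ((\<integral>\<^sup>+z. ?k z \<sigma> \<partial>lborel) + ennreal ?B) * indicator ?S \<sigma>" for \<sigma>
  proof (cases "\<sigma> \<in> ?S")
    case True
    let ?s = "c + \<sigma> *\<^sub>R i"
    have "?L = (\<integral>\<^sup>+y. ennreal \<bar>\<phi> y - \<phi> ?s\<bar> * indicator ?Q y \<partial>lborel)"
      using zero[of \<sigma>] True by simp
    also have "\<dots> \<le> ?C * ((\<integral>\<^sup>+z. ennreal (norm (G z) powr p * \<bar>(z - ?s) \<bullet> i\<bar> powr (-\<alpha>)) * indicator ?Q z \<partial>lborel) +
            (\<integral>\<^sup>+z. ennreal (\<Prod>b\<in>Basis. \<bar>(z - ?s) \<bullet> b\<bar> powr (-\<nu>)) * indicator ?Q z \<partial>lborel))"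
      using \<epsilon> by (intro convex_diff_kernel_integral_le[OF der cont convex_grid_cell inC[OF True] grid_cell_subset_cball]
        inC True p \<alpha> i \<nu>) auto
    also have "\<dots> \<le> ?C * ((\<integral>\<^sup>+z. ?k z \<sigma> \<partial>lborel) + ennreal ?B)"
    proof (intro mult_left_mono add_mono)
      show "(\<integral>\<^sup>+z. ennreal (\<Prod>b\<in>Basis. \<bar>(z - ?s) \<bullet> b\<bar> powr (-\<nu>)) * indicator ?Q z \<partial>lborel) \<le> ennreal ?B"
        using \<nu> \<epsilon> grid_cell_coordinate_le[OF _ inC[OF True]] by (intro nn_integral_prod_powr_le) auto
    qed (use i in \<open>auto simp: inner_diff_left inner_add_left diff_diff_eq\<close>)
    finally show ?thesis using True by simp
  qed simp
  \<comment> \<open>Integrating over \<sigma> is the averaging: both sides acquire the factor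
    \<delta>, which is positive and finite and is cancelled at the end.\<close>
  have "?L * ennreal \<delta> = (\<integral>\<^sup>+\<sigma>. ?L * indicator ?S \<sigma> \<partial>lborel)"
    using \<delta> by (simp add: nn_integral_cmult_indicator)
  also have "\<dots> \<le> (\<integral>\<^sup>+\<sigma>. ?C * (((\<integral>\<^sup>+z. ?k z \<sigma> \<partial>lborel) * indicator ?S \<sigma>) + ennreal ?B * indicator ?S \<sigma>) \<partial>lborel)"
    using pt by (intro nn_integral_mono) (simp add: algebra_simps)
  also have "\<dots> = ?C * ((\<integral>\<^sup>+\<sigma>. (\<integral>\<^sup>+z. ?k z \<sigma> \<partial>lborel) * indicator ?S \<sigma> \<partial>lborel) + ennreal ?B * ennreal \<delta>)"
    using \<delta> by (simp add: nn_integral_cmult nn_integral_add nn_integral_cmult_indicator)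
  also have "(\<integral>\<^sup>+\<sigma>. (\<integral>\<^sup>+z. ?k z \<sigma> \<partial>lborel) * indicator ?S \<sigma> \<partial>lborel)
      = (\<integral>\<^sup>+\<sigma>. (\<integral>\<^sup>+z. ?k z \<sigma> * indicator ?S \<sigma> \<partial>lborel) \<partial>lborel)"
    by (simp add: nn_integral_multc)
  also have "\<dots> = (\<integral>\<^sup>+z. (\<integral>\<^sup>+\<sigma>. ?k z \<sigma> * indicator ?S \<sigma> \<partial>lborel) \<partial>lborel)"
    by (rule lborel_pair.Fubini') measurable
  also have "\<dots> \<le> (\<integral>\<^sup>+z. (ennreal (norm (G z) powr p) * indicator ?Q z) * ennreal (\<delta> * ?A) \<partial>lborel)"
  proof (rule nn_integral_mono)
    fix z
    have "(\<integral>\<^sup>+\<sigma>. ?k z \<sigma> * indicator ?S \<sigma> \<partial>lborel)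
        = (\<integral>\<^sup>+\<sigma>. (ennreal (norm (G z) powr p) * indicator ?Q z) *
             (ennreal (\<bar>(z \<bullet> i - c \<bullet> i) - \<sigma>\<bar> powr (-\<alpha>)) * indicator ?S \<sigma>) \<partial>lborel)"
      by (simp add: ennreal_mult mult_ac)
    also have "\<dots> = (ennreal (norm (G z) powr p) * indicator ?Q z) *
             (\<integral>\<^sup>+\<sigma>. ennreal (\<bar>(z \<bullet> i - c \<bullet> i) - \<sigma>\<bar> powr (-\<alpha>)) * indicator ?S \<sigma> \<partial>lborel)"
      by (rule nn_integral_cmult) measurable
    also have "\<dots> \<le> (ennreal (norm (G z) powr p) * indicator ?Q z) * ennreal (\<delta> * ?A)"
      using \<alpha> \<delta> by (intro mult_left_mono nn_integral_powr_segment) auto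
    finally show "(\<integral>\<^sup>+\<sigma>. ?k z \<sigma> * indicator ?S \<sigma> \<partial>lborel) \<le>
       (ennreal (norm (G z) powr p) * indicator ?Q z) * ennreal (\<delta> * ?A)" .
  qed
  also have "\<dots> = ?X * ennreal (\<delta> * ?A)"
    by (rule nn_integral_multc) measurable
  also have "?C * (?X * ennreal (\<delta> * ?A) + ennreal ?B * ennreal \<delta>)
       = ?C * (ennreal ?A * ?X + ennreal ?B) * ennreal \<delta>"
  proof -
    have "ennreal (\<delta> * ?A) = ennreal \<delta> * ennreal ?A"
      using \<alpha> \<delta> by (intro ennreal_mult) auto
    then show ?thesis by (simp only: distrib_left distrib_right mult_ac)
  qed
  finally have "?L * ennreal \<delta> \<le> ?C * (ennreal ?A * ?X + ennreal ?B) * ennreal \<delta>"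
    by (simp add: mult_left_mono add_right_mono)
  then show ?thesis
    using \<delta> unfolding mult.commute[of _ "ennreal \<delta>"]
    by (subst (asm) ennreal_mult_le_mult_iff) auto
qed

definition grid_corner :: "real \<Rightarrow> ('a::euclidean_space \<Rightarrow> int) \<Rightarrow> 'a" where
  "grid_corner \<epsilon> k = (\<Sum>b\<in>Basis. (\<epsilon> * of_int (k b)) *\<^sub>R b)"

text \<open>With step R / m, the indices from -m to m cover more than the open box of half-side R,
  and they are at most 3 m per coordinate when m \<ge> 1. Extensional functions make the family
  finite and let a cell determine its index.\<close>

definition grid_index :: "nat \<Rightarrow> ('a::euclidean_space \<Rightarrow> int) set" where
  "grid_index m = (\<Pi>\<^sub>E b\<in>Basis. {- int m..int m})"

definition grid_segment :: "real \<Rightarrow> real \<Rightarrow> 'a::euclidean_space \<Rightarrow> ('a \<Rightarrow> int) \<Rightarrow> 'a set" where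
  "grid_segment \<epsilon> \<delta> i k = (\<lambda>\<sigma>. grid_corner \<epsilon> k + \<sigma> *\<^sub>R i) ` {0..\<delta>}"

lemma grid_corner_inner [simp]: "b \<in> Basis \<Longrightarrow> grid_corner \<epsilon> k \<bullet> b = \<epsilon> * of_int (k b)"
  by (simp add: grid_corner_def inner_sum_left_Basis)

lemma finite_grid_index [simp]: "finite (grid_index m)"
  unfolding grid_index_def by (intro finite_PiE) auto

lemma card_grid_index_le:
  assumes "m \<ge> 1"
  shows "real (card (grid_index m :: ('a::euclidean_space \<Rightarrow> int) set)) \<le> (3 * real m) ^ DIM('a)"
proof -
  have "card (grid_index m :: ('a \<Rightarrow> int) set) = (2 * m + 1) ^ DIM('a)"
    by (simp add: grid_index_def card_PiE nat_add_distrib nat_mult_distrib)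
  also have "\<dots> \<le> (3 * m) ^ DIM('a)" using assms by (intro power_mono) auto
  finally show ?thesis by (metis of_nat_le_iff of_nat_mult of_nat_numeral of_nat_power)
qed

lemma grid_cell_containing:
  fixes x :: "'a::euclidean_space"
  assumes "m \<ge> 1" "\<And>b. b \<in> Basis \<Longrightarrow> \<bar>x \<bullet> b\<bar> < R"
  shows "\<exists>k\<in>grid_index m. x \<in> grid_cell (grid_corner (R / m) k) (R / m)"
proof -
  have R: "R > 0" using assms(2)[OF SOME_Basis] by linarith
  define \<epsilon> where "\<epsilon> = R / m"
  have \<epsilon>: "\<epsilon> > 0" "R = \<epsilon> * m" using R assms by (auto simp: \<epsilon>_def)
  define k :: "'a \<Rightarrow> int" where "k = (\<lambda>b\<in>Basis. \<lfloor>x \<bullet> b / \<epsilon>\<rfloor>)"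
  have "- int m \<le> \<lfloor>x \<bullet> b / \<epsilon>\<rfloor> \<and> \<lfloor>x \<bullet> b / \<epsilon>\<rfloor> \<le> int m" if "b \<in> Basis" for b
  proof -
    have "- (\<epsilon> * m) < x \<bullet> b" "x \<bullet> b < \<epsilon> * m"
      using assms(2)[OF that] \<epsilon>(2) by (auto simp: abs_less_iff)
    then have "- real m \<le> x \<bullet> b / \<epsilon>" "x \<bullet> b / \<epsilon> \<le> real m"
      using \<epsilon>(1) by (simp_all add: pos_le_divide_eq pos_divide_le_eq mult.commute)
    then show ?thesis by linarith
  qed
  then have "k \<in> grid_index m" by (auto simp: grid_index_def k_def)
  moreover have "\<epsilon> * of_int (k b) \<le> x \<bullet> b \<and> x \<bullet> b < \<epsilon> * of_int (k b) + \<epsilon>" if "b \<in> Basis" for b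
  proof -
    define j where "j = \<lfloor>x \<bullet> b / \<epsilon>\<rfloor>"
    have "of_int j \<le> x \<bullet> b / \<epsilon>" "x \<bullet> b / \<epsilon> < of_int j + 1"
      unfolding j_def by linarith+
    then show ?thesis
      using \<epsilon>(1) that by (simp add: k_def pos_le_divide_eq pos_divide_less_eq algebra_simps flip: j_def)
  qed
  then have "x \<in> grid_cell (grid_corner \<epsilon> k) \<epsilon>" by (simp add: grid_cell_def)
  ultimately show ?thesis by (auto simp: \<epsilon>_def)
qed

lemma disjoint_grid_cells:
  assumes "\<epsilon> > 0"
  shows "disjoint_family_on (\<lambda>k. grid_cell (grid_corner \<epsilon> k) \<epsilon>) (grid_index m)"
proof -
  have "k = l" if k: "k \<in> grid_index m" and l: "l \<in> grid_index m"
    and x: "x \<in> grid_cell (grid_corner \<epsilon> k) \<epsilon>" "x \<in> grid_cell (grid_corner \<epsilon> l) \<epsilon>" for k l and x :: 'a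
  proof (rule PiE_ext[OF k[unfolded grid_index_def] l[unfolded grid_index_def]])
    fix b :: 'a assume b: "b \<in> Basis"
    have *: "\<lfloor>x \<bullet> b / \<epsilon>\<rfloor> = k' b" if "x \<in> grid_cell (grid_corner \<epsilon> k') \<epsilon>" for k'
      using that b assms by (intro floor_unique) (auto simp: grid_cell_def field_simps)
    show "k b = l b" using *[OF x(1)] *[OF x(2)] by simp
  qed
  then show ?thesis unfolding disjoint_family_on_def by blast
qed

text \<open>Sum of the cell bounds. Disjointness adds the gradient integrals up to at most the total
  one, whereas the remainder is counted once per cell, hence the factor (3 m)^N.\<close>

lemma grid_estimate:
  fixes \<phi> :: "'a::euclidean_space \<Rightarrow> real"
  assumes der: "\<And>x. (\<phi> has_derivative (\<lambda>h. G x \<bullet> h)) (at x)"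
    and cont: "continuous_on UNIV G"
    and p: "p > 1" and \<alpha>: "0 \<le> \<alpha>" "\<alpha> < 1" "\<alpha> / p \<le> DIM('a) - 1" and i: "i \<in> Basis"
    and \<nu>: "\<nu> = (DIM('a) - 1 - \<alpha> / p) * (p / (p - 1)) / DIM('a)" "\<nu> < 1"
    and \<delta>: "0 < \<delta>" "\<delta> < R / m" and m: "m \<ge> 1"
    and zero: "\<And>k x. k \<in> grid_index m \<Longrightarrow> x \<in> grid_segment (R / m) \<delta> i k \<Longrightarrow> \<phi> x = 0"
    and supp: "\<And>x. \<phi> x \<noteq> 0 \<Longrightarrow> \<forall>b\<in>Basis. \<bar>x \<bullet> b\<bar> < R"
  shows "(\<integral>\<^sup>+y. ennreal \<bar>\<phi> y\<bar> \<partial>lborel) \<le>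
         ennreal ((real DIM('a) * (R / m)) ^ DIM('a) / DIM('a) * ((2 / (1 - \<alpha>) + 1) * \<delta> powr (-\<alpha>))) *
              (\<integral>\<^sup>+z. ennreal (norm (G z) powr p) \<partial>lborel) +
         ennreal ((real DIM('a) * (R / m)) ^ DIM('a) / DIM('a) *
              ((3 * real m) ^ DIM('a) * (2 / (1 - \<nu>) * (R / m) powr (1 - \<nu>)) ^ DIM('a)))"
    (is "_ \<le> ennreal (?c * ?A) * ?X + ennreal (?c * (?M * ?B))")
proof -
  note [measurable] = borel_measurable_continuous_onI[OF cont]
  define \<epsilon> where "\<epsilon> = R / m"
  have \<epsilon>: "\<epsilon> > 0" using \<delta> by (simp add: \<epsilon>_def)
  let ?Q = "\<lambda>k. grid_cell (grid_corner \<epsilon> k) \<epsilon>"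
  let ?K = "grid_index m :: ('a \<Rightarrow> int) set"
  let ?x = "\<lambda>k. \<integral>\<^sup>+z. ennreal (norm (G z) powr p) * indicator (?Q k) z \<partial>lborel"
  have c0: "?c \<ge> 0" "?A \<ge> 0" "?B \<ge> 0" unfolding \<epsilon>_def[symmetric] using \<epsilon> \<alpha> \<nu> by auto
  have zero': "\<phi> (grid_corner \<epsilon> k + \<sigma> *\<^sub>R i) = 0" if "k \<in> ?K" "0 \<le> \<sigma>" "\<sigma> \<le> \<delta>" for k \<sigma>
    using that by (intro zero) (auto simp: grid_segment_def \<epsilon>_def)
  have dis: "(\<Sum>k\<in>?K. indicator (?Q k) z) = (indicator (\<Union>k\<in>?K. ?Q k) z :: ennreal)" for z
    by (rule indicator_UN_disjoint[symmetric, OF finite_grid_index disjoint_grid_cells[OF \<epsilon>]])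
  have \<phi>m: "\<phi> \<in> borel_measurable borel"
    using der has_derivative_continuous by (intro borel_measurable_continuous_onI continuous_at_imp_continuous_on) blast
  note [measurable] = \<phi>m
  have "(\<integral>\<^sup>+y. ennreal \<bar>\<phi> y\<bar> \<partial>lborel) \<le> (\<integral>\<^sup>+y. (\<Sum>k\<in>?K. ennreal \<bar>\<phi> y\<bar> * indicator (?Q k) y) \<partial>lborel)"
  proof (intro nn_integral_mono)
    fix y
    have "ennreal \<bar>\<phi> y\<bar> \<le> ennreal \<bar>\<phi> y\<bar> * indicator (\<Union>k\<in>?K. ?Q k) y"
      using supp[of y] grid_cell_containing[OF m, of y R] by (cases "\<phi> y = 0") (auto simp: \<epsilon>_def)
    then show "ennreal \<bar>\<phi> y\<bar> \<le> (\<Sum>k\<in>?K. ennreal \<bar>\<phi> y\<bar> * indicator (?Q k) y)"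
      by (simp flip: sum_distrib_left dis)
  qed
  also have "\<dots> = (\<Sum>k\<in>?K. \<integral>\<^sup>+y. ennreal \<bar>\<phi> y\<bar> * indicator (?Q k) y \<partial>lborel)"
    by (intro nn_integral_sum) measurable
  also have "\<dots> \<le> (\<Sum>k\<in>?K. ennreal ?c * (ennreal ?A * ?x k + ennreal ?B))"
    unfolding \<epsilon>_def[symmetric]
    using zero' \<delta> by (intro sum_mono cell_estimate[OF der cont p \<alpha> i \<nu>]) (auto simp: \<epsilon>_def)
  also have "\<dots> = ennreal ?c * (ennreal ?A * (\<Sum>k\<in>?K. ?x k) + of_nat (card ?K) * ennreal ?B)"
    by (simp add: sum.distrib flip: sum_distrib_left)
  also have "(\<Sum>k\<in>?K. ?x k) = (\<integral>\<^sup>+z. ennreal (norm (G z) powr p) * (\<Sum>k\<in>?K. indicator (?Q k) z) \<partial>lborel)"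
    by (subst nn_integral_sum[symmetric]) (measurable, simp add: sum_distrib_left)
  also have "\<dots> \<le> ?X"
    unfolding dis by (intro nn_integral_mono) (auto simp: indicator_def)
  also have "of_nat (card ?K) * ennreal ?B \<le> ennreal (?M * ?B)"
    using card_grid_index_le[OF m, where 'a='a] c0(3)
    by (simp add: ennreal_of_nat_eq_real_of_nat flip: ennreal_mult) (intro ennreal_leI mult_right_mono, auto)
  finally have "(\<integral>\<^sup>+y. ennreal \<bar>\<phi> y\<bar> \<partial>lborel) \<le> ennreal ?c * (ennreal ?A * ?X + ennreal (?M * ?B))"
    by (simp add: mult_left_mono add_mono)
  also have "\<dots> = ennreal (?c * ?A) * ?X + ennreal (?c * (?M * ?B))"
  proof -
    have "ennreal (?c * ?A) = ennreal ?c * ennreal ?A"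
      by (rule ennreal_mult[OF c0(1,2)])
    moreover have "ennreal (?c * (?M * ?B)) = ennreal ?c * ennreal (?M * ?B)"
      by (rule ennreal_mult[OF c0(1) mult_nonneg_nonneg[OF _ c0(3)]]) simp
    ultimately show ?thesis by (simp only: distrib_left mult.assoc)
  qed
  finally show ?thesis .
qed

text \<open>The length budget forces segments of length of order \<epsilon>^N in cells of side \<epsilon>; an exponent
  \<alpha> with N - p < \<alpha> < 1 makes both error terms vanish, and it exists exactly because p > N - 1.\<close>

lemma grid_poincare:
  fixes i :: "'a::euclidean_space"
  assumes N: "DIM('a) \<ge> 2" and p: "p > real DIM('a) - 1" and R: "R > 0" and l: "l > 0"
    and i: "i \<in> Basis" and \<eta>: "\<eta> > 0"
  shows "\<forall>\<^sub>F m in sequentially. \<forall>\<phi> G. (\<forall>x. (\<phi> has_derivative (\<lambda>h. G x \<bullet> h)) (at x)) \<longrightarrow>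
     continuous_on UNIV G \<longrightarrow>
     (\<forall>k\<in>grid_index m. \<forall>x\<in>grid_segment (R / m) (min l R / (3 * real m) ^ DIM('a)) i k. \<phi> x = 0) \<longrightarrow>
     (\<forall>x. \<phi> x \<noteq> 0 \<longrightarrow> (\<forall>b\<in>Basis. \<bar>x \<bullet> b\<bar> < R)) \<longrightarrow>
     (\<integral>\<^sup>+y. ennreal \<bar>\<phi> y\<bar> \<partial>lborel) \<le> ennreal \<eta> * (\<integral>\<^sup>+z. ennreal (norm (G z) powr p) \<partial>lborel) + ennreal \<eta>"
proof -
  define N where "N = DIM('a)"
  have N2: "N \<ge> 2" using N by (simp add: N_def)
  have p1: "p > 1" using N p by simp
  have "max 0 (real N - p) < 1" using p by (auto simp: N_def)
  then obtain \<alpha> where "max 0 (real N - p) < \<alpha>" "\<alpha> < 1"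
    using dense by blast
  then have \<alpha>: "0 \<le> \<alpha>" "\<alpha> < 1" "real N - p < \<alpha>" by auto
  define \<nu> where "\<nu> = (real N - 1 - \<alpha> / p) * (p / (p - 1)) / real N"
  have "\<alpha> / p < 1" using \<alpha> p1 by (simp add: divide_less_eq)
  then have \<alpha>': "\<alpha> / p \<le> real N - 1" using N2 by simp
  \<comment> \<open>The condition \<nu> < 1 unfolds to N p - p - \<alpha> < N (p - 1), that is,
    \<alpha> > N - p.\<close>
  have "(real N - 1 - \<alpha> / p) * p = real N * p - p - \<alpha>" using p1 by (simp add: field_simps)
  also have "\<dots> < real N * (p - 1)" using \<alpha> by (simp add: algebra_simps)
  finally have \<nu>1: "\<nu> < 1" using p1 N2 by (simp add: \<nu>_def divide_less_eq mult.commute)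
  \<comment> \<open>At most (3 m)^N segments share the budget l. The minimum with R keeps each
    segment shorter than the cell side R / m even when l is large.\<close>
  define d where "d m = min l R / (3 * real m) ^ N" for m :: nat
  define a where "a m = (real N * (R / real m)) ^ N / real N * ((2 / (1 - \<alpha>) + 1) * d m powr (-\<alpha>))" for m :: nat
  define b where "b m = (real N * (R / real m)) ^ N / real N *
              ((3 * real m) ^ N * (2 / (1 - \<nu>) * (R / real m) powr (1 - \<nu>)) ^ N)" for m :: nat
  \<comment> \<open>The errors are constants times powers of m. In \<open>a\<close> the cell volume
    m^(-N) meets d^(-\<alpha>), which grows like m^(N \<alpha>); in \<open>b\<close> the cell volume
    cancels the number of cells and m^(-N (1 - \<nu>)) is left.\<close>
  define a0 where "a0 = (real N * R) ^ N / real N * (2 / (1 - \<alpha>) + 1) * (min l R / 3 ^ N) powr (-\<alpha>)"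
  define b0 where "b0 = (real N * R) ^ N / real N * 3 ^ N * (2 / (1 - \<nu>) * R powr (1 - \<nu>)) ^ N"
  have a: "a m = a0 * real m powr (- (real N * (1 - \<alpha>)))" if "m \<ge> 1" for m
  proof -
    have m: "real m > 0" using that by simp
    have "d m powr (-\<alpha>) = (min l R / 3 ^ N) powr (-\<alpha>) * (1 / real m ^ N) powr (-\<alpha>)"
      using l R m by (simp add: d_def power_mult_distrib powr_mult powr_divide)
    moreover have "(1 / real m ^ N) powr (-\<alpha>) = real m powr (real N * \<alpha>)"
    proof -
      have "1 / real m ^ N = real m powr (- real N)"
        using m by (simp add: powr_minus powr_realpow divide_inverse)
      then show ?thesis by (simp add: powr_powr)
    qed
    moreover have "(real N * (R / real m)) ^ N = (real N * R) ^ N * real m powr (- real N)"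
      using m by (simp add: power_divide powr_minus powr_realpow divide_inverse power_mult_distrib power_inverse)
    moreover have "real m powr (- real N) * real m powr (real N * \<alpha>) = real m powr (- (real N * (1 - \<alpha>)))"
      by (simp add: algebra_simps flip: powr_add)
    ultimately show ?thesis by (simp add: a_def a0_def mult_ac)
  qed
  have b: "b m = b0 * real m powr (- (real N * (1 - \<nu>)))" if "m \<ge> 1" for m
  proof -
    have m: "real m > 0" using that by simp
    have "(R / real m) powr (1 - \<nu>) = R powr (1 - \<nu>) * real m powr (- (1 - \<nu>))"
      unfolding powr_minus using R m by (simp add: powr_divide field_simps)
    moreover have "(real m powr (- (1 - \<nu>))) ^ N = real m powr (- (real N * (1 - \<nu>)))"
      using m by (simp add: powr_powr algebra_simps flip: powr_realpow)
    ultimately show ?thesis using m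
      by (simp add: b_def b0_def power_mult_distrib power_divide)
  qed
  have "(\<lambda>m. a0 * real m powr (- (real N * (1 - \<alpha>)))) \<longlonglongrightarrow> a0 * 0"
    using N2 \<alpha> by (intro tendsto_mult tendsto_const tendsto_neg_powr filterlim_real_sequentially) auto
  then have "\<forall>\<^sub>F m in sequentially. a0 * real m powr (- (real N * (1 - \<alpha>))) < \<eta>"
    using \<eta> by (intro order_tendstoD(2)) auto
  moreover have "(\<lambda>m. b0 * real m powr (- (real N * (1 - \<nu>)))) \<longlonglongrightarrow> b0 * 0"
    using N2 \<nu>1 by (intro tendsto_mult tendsto_const tendsto_neg_powr filterlim_real_sequentially) auto
  then have "\<forall>\<^sub>F m in sequentially. b0 * real m powr (- (real N * (1 - \<nu>))) < \<eta>"
    using \<eta> by (intro order_tendstoD(2)) auto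
  ultimately show ?thesis
    using eventually_ge_at_top[of 1]
  proof eventually_elim
    case (elim m)
    then have m: "m \<ge> 1" and ab: "a m < \<eta>" "b m < \<eta>" by (auto simp: a b)
    have d0: "d m > 0" using l R m by (simp add: d_def)
    have d1: "d m < R / real m"
    proof -
      have "real m < 3 * real m" using m by simp
      also have "\<dots> \<le> (3 * real m) ^ N" using m N2 by (intro self_le_power) auto
      finally have "R / (3 * real m) ^ N < R / real m" using R m by (intro divide_strict_left_mono) auto
      moreover have "d m \<le> R / (3 * real m) ^ N" unfolding d_def by (intro divide_right_mono) auto
      ultimately show ?thesis by linarith
    qed
    show ?case
    proof (intro allI impI)
      fix \<phi> :: "'a \<Rightarrow> real" and G :: "'a \<Rightarrow> 'a"
      assume *: "\<forall>x. (\<phi> has_derivative (\<lambda>h. G x \<bullet> h)) (at x)" "continuous_on UNIV G"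
        "\<forall>k\<in>grid_index m. \<forall>x\<in>grid_segment (R / real m) (min l R / (3 * real m) ^ DIM('a)) i k. \<phi> x = 0"
        "\<forall>x. \<phi> x \<noteq> 0 \<longrightarrow> (\<forall>b\<in>Basis. \<bar>x \<bullet> b\<bar> < R)"
      let ?X = "\<integral>\<^sup>+z. ennreal (norm (G z) powr p) \<partial>lborel"
      have "(\<integral>\<^sup>+y. ennreal \<bar>\<phi> y\<bar> \<partial>lborel) \<le> ennreal (a m) * ?X + ennreal (b m)"
        unfolding a_def b_def N_def
        by (rule grid_estimate[OF _ *(2) p1 \<alpha>(1,2) _ i _ \<nu>1 d0 d1 m])
          (use * \<alpha>' N2 in \<open>auto simp: \<nu>_def N_def d_def of_nat_diff\<close>)
      also have "\<dots> \<le> ennreal \<eta> * ?X + ennreal \<eta>"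
        using ab by (intro add_mono mult_right_mono ennreal_leI) auto
      finally show "(\<integral>\<^sup>+y. ennreal \<bar>\<phi> y\<bar> \<partial>lborel) \<le> ennreal \<eta> * ?X + ennreal \<eta>" .
    qed
  qed
qed

section \<open>Hoelder inequality and the Gagliardo-Nirenberg inequality\<close>

text \<open>The convention that every zeroth power is 1, including those of 0 and infinity, makes
  vanishing weights harmless in Hoelder's inequality.\<close>

definition enn_powr :: "ennreal \<Rightarrow> real \<Rightarrow> ennreal" where
  "enn_powr x a = (if a = 0 then 1 else if x = top then top else ennreal (enn2real x powr a))"

lemma enn_powr_measurable [measurable (raw)]:
  assumes [measurable]: "f \<in> borel_measurable M"
  shows "(\<lambda>x. enn_powr (f x) a) \<in> borel_measurable M"
  unfolding enn_powr_def by measurable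

lemma enn_powr_zero_right [simp]: "enn_powr x 0 = 1"
  and enn_powr_top: "a \<noteq> 0 \<Longrightarrow> enn_powr top a = top"
  and enn_powr_zero: "a \<noteq> 0 \<Longrightarrow> enn_powr 0 a = 0"
  by (auto simp: enn_powr_def)

lemma enn_powr_one [simp]: "enn_powr x 1 = x"
  by (cases x) (auto simp: enn_powr_def)

lemma enn_powr_ennreal: "x \<ge> 0 \<Longrightarrow> a \<noteq> 0 \<Longrightarrow> enn_powr (ennreal x) a = ennreal (x powr a)"
  by (auto simp: enn_powr_def)

lemma enn_powr_add:
  assumes "a \<ge> 0" "b \<ge> 0"
  shows "enn_powr x (a + b) = enn_powr x a * enn_powr x b"
proof (cases "a = 0 \<or> b = 0")
  case False
  then show ?thesis
    using assms by (cases x) (auto simp: enn_powr_def ennreal_mult powr_add ennreal_mult_top)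
qed auto

lemma enn_powr_power: "a > 0 \<Longrightarrow> enn_powr x a ^ n = enn_powr x (real n * a)"
  by (induction n) (auto simp: distrib_right enn_powr_add)

lemma enn_powr_mono:
  assumes "x \<le> y" "a \<ge> 0"
  shows "enn_powr x a \<le> enn_powr y a"
proof (cases "y = top \<or> a = 0")
  case False
  then have "x \<noteq> top" using assms(1) by (auto simp: top_unique)
  then show ?thesis using False assms
    by (auto simp: enn_powr_def intro!: ennreal_leI powr_mono2 enn2real_mono simp: top.not_eq_extremum)
qed (auto simp: enn_powr_def)

lemma enn_powr_eq_0_iff: "a > 0 \<Longrightarrow> enn_powr x a = 0 \<longleftrightarrow> x = 0"
  by (cases x) (auto simp: enn_powr_def)

section \<open>Hoelder's inequality for several factors\<close>

lemma weighted_arith_geom_mean: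
  fixes x w :: "'i \<Rightarrow> real"
  assumes "finite K" "\<And>k. k \<in> K \<Longrightarrow> x k \<ge> 0" "\<And>k. k \<in> K \<Longrightarrow> w k > 0" "sum w K = 1"
  shows "(\<Prod>k\<in>K. x k powr w k) \<le> (\<Sum>k\<in>K. w k * x k)"
proof (cases "\<exists>k\<in>K. x k = 0")
  case True
  then have "(\<Prod>k\<in>K. x k powr w k) = 0" using assms(1) by (auto intro!: prod_zero)
  moreover have "(\<Sum>k\<in>K. w k * x k) \<ge> 0" using assms by (intro sum_nonneg) (simp add: less_imp_le)
  ultimately show ?thesis by linarith
next
  case False
  then have pos: "x k > 0" if "k \<in> K" for k using assms(2)[OF that] that by force
  have "(\<Prod>k\<in>K. x k powr w k) = exp (\<Sum>k\<in>K. w k *\<^sub>R ln (x k))"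
    using pos by (simp add: exp_sum assms(1) powr_def less_imp_neq[symmetric] cong: prod.cong)
  also have "\<dots> \<le> (\<Sum>k\<in>K. w k * exp (ln (x k)))"
    using assms by (intro convex_on_sum[OF _ _ exp_convex]) (auto simp: less_imp_le)
  also have "\<dots> = (\<Sum>k\<in>K. w k * x k)" using pos by simp
  finally show ?thesis .
qed

lemma prod_ennreal_eq_top:
  fixes f :: "'i \<Rightarrow> ennreal"
  assumes "finite K" "k \<in> K" "f k = top" "\<And>k. k \<in> K \<Longrightarrow> f k \<noteq> 0"
  shows "(\<Prod>k\<in>K. f k) = top"
proof -
  have "(\<Prod>k\<in>K - {k}. f k) \<noteq> 0" using assms by (auto simp: prod_zero_iff)
  then show ?thesis using assms(3)
    by (subst prod.remove[OF assms(1,2)]) (simp add: ennreal_top_mult)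
qed

text \<open>The pointwise half of Hoelder's inequality: arithmetic-geometric mean for the quotients
  y_k / F_k. When F_k is the integral of y_k, integration turns the sum into the sum of the weights,
  which is 1.\<close>

lemma prod_enn_powr_le_sum:
  assumes K: "finite K" and w: "\<And>k. k \<in> K \<Longrightarrow> w k > 0" "sum w K = 1"
    and F: "\<And>k. k \<in> K \<Longrightarrow> F k > (0::real)"
  shows "(\<Prod>k\<in>K. enn_powr (y k) (w k)) \<le>
    ennreal (\<Prod>k\<in>K. F k powr w k) * (\<Sum>k\<in>K. ennreal (w k / F k) * y k)"
proof (cases "\<exists>k\<in>K. y k = top")
  case True
  then obtain k where k: "k \<in> K" "y k = top" by blast
  have "w k / F k > 0" using k w F by simp
  then have "ennreal (w k / F k) \<noteq> 0" by (simp add: ennreal_eq_0_iff)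
  then have "ennreal (w k / F k) * y k = top" using k by (simp add: ennreal_mult_top)
  then have "(\<Sum>k\<in>K. ennreal (w k / F k) * y k) = top"
    using k K by (auto intro!: bexI[of _ k])
  moreover have "(\<Prod>k\<in>K. F k powr w k) > 0" using F by (intro prod_pos) fastforce
  ultimately show ?thesis by (simp add: ennreal_mult_top)
next
  case False
  define z where "z k = enn2real (y k)" for k
  have y: "y k = ennreal (z k)" if "k \<in> K" for k
    using False that by (simp add: z_def top.not_eq_extremum)
  have z0: "z k \<ge> 0" for k by (simp add: z_def)
  have F0: "k \<in> K \<Longrightarrow> w k \<noteq> 0 \<and> F k \<noteq> 0 \<and> F k > 0 \<and> F k \<ge> 0 \<and> w k \<ge> 0" for k using w(1)[of k] F[of k] by auto
  have "(\<Prod>k\<in>K. enn_powr (y k) (w k)) = (\<Prod>k\<in>K. ennreal (z k powr w k))"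
    using F0 by (intro prod.cong) (auto simp: y enn_powr_ennreal z0)
  also have "\<dots> = ennreal (\<Prod>k\<in>K. z k powr w k)" by (simp add: prod_ennreal)
  also have "(\<Prod>k\<in>K. z k powr w k) = (\<Prod>k\<in>K. F k powr w k * (z k / F k) powr w k)"
    using F0 z0 by (intro prod.cong) (auto simp flip: powr_mult)
  also have "\<dots> = (\<Prod>k\<in>K. F k powr w k) * (\<Prod>k\<in>K. (z k / F k) powr w k)"
    by (rule prod.distrib)
  also have "\<dots> \<le> (\<Prod>k\<in>K. F k powr w k) * (\<Sum>k\<in>K. w k * (z k / F k))"
    using F0 z0 w by (intro mult_left_mono weighted_arith_geom_mean K prod_nonneg) auto
  also have "ennreal \<dots> = ennreal (\<Prod>k\<in>K. F k powr w k) * ennreal (\<Sum>k\<in>K. w k * (z k / F k))"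
    using F0 z0 by (intro ennreal_mult prod_nonneg sum_nonneg) auto
  also have "ennreal (\<Sum>k\<in>K. w k * (z k / F k)) = (\<Sum>k\<in>K. ennreal (w k / F k) * y k)"
    using F0 z0 by (subst sum_ennreal[symmetric]) (auto simp: y simp flip: ennreal_mult intro!: sum.cong)
  finally show ?thesis by (simp add: ennreal_leI)
qed

lemma nn_integral_Holder_prod_pos:
  assumes K: "finite K" and w: "\<And>k. k \<in> K \<Longrightarrow> w k > 0" "sum w K = 1"
    and f[measurable]: "\<And>k. k \<in> K \<Longrightarrow> f k \<in> borel_measurable M"
  shows "(\<integral>\<^sup>+x. (\<Prod>k\<in>K. enn_powr (f k x) (w k)) \<partial>M) \<le> (\<Prod>k\<in>K. enn_powr (\<integral>\<^sup>+x. f k x \<partial>M) (w k))"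
proof -
  \<comment> \<open>Normalising by the integrals needs them positive and finite. A zero integral
    kills the product almost everywhere; if there is none, an infinite integral makes the right side
    infinite.\<close>
  consider (zero) k where "k \<in> K" "(\<integral>\<^sup>+x. f k x \<partial>M) = 0"
    | (top) k where "k \<in> K" "(\<integral>\<^sup>+x. f k x \<partial>M) = top" "\<And>k. k \<in> K \<Longrightarrow> (\<integral>\<^sup>+x. f k x \<partial>M) \<noteq> 0"
    | (fin) "\<And>k. k \<in> K \<Longrightarrow> (\<integral>\<^sup>+x. f k x \<partial>M) \<noteq> 0 \<and> (\<integral>\<^sup>+x. f k x \<partial>M) \<noteq> top"
    by blast
  then show ?thesis
  proof cases
    case zero
    then have "AE x in M. f k x = 0" by (simp add: nn_integral_0_iff_AE)
    then have "AE x in M. (\<Prod>k\<in>K. enn_powr (f k x) (w k)) = 0"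
    proof eventually_elim
      case (elim x)
      then have "enn_powr (f k x) (w k) = 0" using w(1)[OF zero(1)] by (simp add: enn_powr_zero)
      then show ?case using zero(1) K by (auto intro: prod_zero)
    qed
    then have "(\<integral>\<^sup>+x. (\<Prod>k\<in>K. enn_powr (f k x) (w k)) \<partial>M) = 0"
      by (subst nn_integral_cong_AE[where v="\<lambda>_. 0"]) auto
    then show ?thesis by simp
  next
    case top
    have "(\<Prod>k\<in>K. enn_powr (\<integral>\<^sup>+x. f k x \<partial>M) (w k)) = top"
      using w(1) top by (intro prod_ennreal_eq_top[OF K top(1)])
        (auto simp: enn_powr_eq_0_iff enn_powr_top less_imp_neq[symmetric])
    then show ?thesis by simp
  next
    case fin
    define F where "F k = enn2real (\<integral>\<^sup>+x. f k x \<partial>M)" for k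
    have F: "F k > 0" "(\<integral>\<^sup>+x. f k x \<partial>M) = ennreal (F k)" if "k \<in> K" for k
      using fin[OF that] by (auto simp: F_def enn2real_positive_iff top.not_eq_extremum zero_less_iff_neq_zero)
    have "(\<integral>\<^sup>+x. (\<Prod>k\<in>K. enn_powr (f k x) (w k)) \<partial>M)
        \<le> (\<integral>\<^sup>+x. ennreal (\<Prod>k\<in>K. F k powr w k) * (\<Sum>k\<in>K. ennreal (w k / F k) * f k x) \<partial>M)"
      by (intro nn_integral_mono prod_enn_powr_le_sum K w F)
    also have "\<dots> = ennreal (\<Prod>k\<in>K. F k powr w k) * (\<Sum>k\<in>K. ennreal (w k / F k) * (\<integral>\<^sup>+x. f k x \<partial>M))"
      by (simp add: nn_integral_cmult nn_integral_sum)
    also have "(\<Sum>k\<in>K. ennreal (w k / F k) * (\<integral>\<^sup>+x. f k x \<partial>M)) = (\<Sum>k\<in>K. ennreal (w k))"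
      using F w(1) by (intro sum.cong) (auto simp: less_imp_le less_imp_neq[symmetric] simp flip: ennreal_mult)
    also have "\<dots> = 1" using w by (simp add: sum_ennreal less_imp_le)
    also have "ennreal (\<Prod>k\<in>K. F k powr w k) * 1 = (\<Prod>k\<in>K. enn_powr (\<integral>\<^sup>+x. f k x \<partial>M) (w k))"
      using F w(1) by (simp add: prod_ennreal[symmetric] enn_powr_ennreal less_imp_le less_imp_neq[symmetric] cong: prod.cong)
    finally show ?thesis .
  qed
qed

lemma nn_integral_Holder_prod:
  assumes K: "finite K" and w: "\<And>k. k \<in> K \<Longrightarrow> w k \<ge> 0" "sum w K = 1"
    and f[measurable]: "\<And>k. k \<in> K \<Longrightarrow> f k \<in> borel_measurable M"
  shows "(\<integral>\<^sup>+x. (\<Prod>k\<in>K. enn_powr (f k x) (w k)) \<partial>M) \<le> (\<Prod>k\<in>K. enn_powr (\<integral>\<^sup>+x. f k x \<partial>M) (w k))"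
proof -
  let ?K = "{k\<in>K. w k > 0}"
  have *: "(\<Prod>k\<in>K. enn_powr (g k) (w k)) = (\<Prod>k\<in>?K. enn_powr (g k) (w k))" for g
    using K w(1) by (intro prod.mono_neutral_right) (auto simp: order_less_le)
  have "sum w ?K = sum w K"
    using K w(1) by (intro sum.mono_neutral_left) (auto simp: order_less_le)
  then show ?thesis
    unfolding * using K w by (intro nn_integral_Holder_prod_pos) auto
qed

lemma nn_integral_Holder:
  assumes [measurable]: "f \<in> borel_measurable M" "g \<in> borel_measurable M"
    and pq: "p > 1" "1 / p + 1 / q = (1::real)"
  shows "(\<integral>\<^sup>+x. ennreal (\<bar>f x\<bar> * \<bar>g x\<bar>) \<partial>M) \<le>
    enn_powr (\<integral>\<^sup>+x. ennreal (\<bar>f x\<bar> powr p) \<partial>M) (1 / p) * enn_powr (\<integral>\<^sup>+x. ennreal (\<bar>g x\<bar> powr q) \<partial>M) (1 / q)"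
proof -
  let ?F = "\<lambda>b x. if b then ennreal (\<bar>f x\<bar> powr p) else ennreal (\<bar>g x\<bar> powr q)"
  let ?w = "\<lambda>b. if b then 1 / p else 1 / q"
  have "1 / p < 1" using pq by simp
  then have "1 / q > 0" using pq(2) by linarith
  then have q: "q > 0" by simp
  have eq: "ennreal (\<bar>f x\<bar> * \<bar>g x\<bar>) = (\<Prod>b\<in>UNIV. enn_powr (?F b x) (?w b))" for x
    using q pq by (simp add: UNIV_bool enn_powr_ennreal powr_powr ennreal_mult mult.commute)
  have "(\<integral>\<^sup>+x. ennreal (\<bar>f x\<bar> * \<bar>g x\<bar>) \<partial>M) \<le> (\<Prod>b\<in>UNIV. enn_powr (\<integral>\<^sup>+x. ?F b x \<partial>M) (?w b))"
    unfolding eq using q pq by (intro nn_integral_Holder_prod) (auto simp: UNIV_bool add.commute)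
  then show ?thesis by (simp add: UNIV_bool mult.commute)
qed

text \<open>Integrating out one coordinate at a time: Hoelder's inequality in the new variable moves the
  integral inside all the other factors.\<close>

lemma grid_lines_inequality:
  fixes f :: "('i \<Rightarrow> real) \<Rightarrow> ennreal"
  assumes "finite I" "q \<ge> 0" "(real (card I) - 1) * q \<le> 1"
    and "f \<in> borel_measurable (Pi\<^sub>M I (\<lambda>_. lborel))"
  shows "(\<integral>\<^sup>+x. enn_powr (f x) (1 - (real (card I) - 1) * q) *
             (\<Prod>j\<in>I. enn_powr (\<integral>\<^sup>+t. f (x(j := t)) \<partial>lborel) q) \<partial>Pi\<^sub>M I (\<lambda>_. lborel))
         \<le> enn_powr (\<integral>\<^sup>+x. f x \<partial>Pi\<^sub>M I (\<lambda>_. lborel)) (1 + q)"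
  using assms
proof (induction I arbitrary: f rule: finite_induct)
  case empty
  interpret product_sigma_finite "\<lambda>_::'i. lborel :: real measure" ..
  show ?case by (simp add: nn_integral_empty)
next
  case (insert i I)
  interpret product_sigma_finite "\<lambda>_::'i. lborel :: real measure" ..
  let ?M = "Pi\<^sub>M I (\<lambda>_. lborel :: real measure)" and ?M' = "Pi\<^sub>M (insert i I) (\<lambda>_. lborel :: real measure)"
  note [measurable] = insert.prems(3)
  define n where "n = real (card I)"
  have n: "real (card (insert i I)) - 1 = n" "n \<ge> 0" using insert.hyps by (auto simp: n_def)
  have nq: "n * q \<le> 1" using insert.prems(2) n by simp
  have q: "q \<ge> 0" by fact
  define F where "F x = (\<integral>\<^sup>+s. f (x(i := s)) \<partial>lborel)" for x
  have upd[measurable]: "(\<lambda>z. (fst z)(j := snd z)) \<in> ?M' \<Otimes>\<^sub>M lborel \<rightarrow>\<^sub>M ?M'" if "j \<in> insert i I" for j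
    by (rule measurable_fun_upd[where J="insert i I"]) (use that in auto)
  have upd'[measurable]: "(\<lambda>z. (fst z)(i := snd z)) \<in> ?M \<Otimes>\<^sub>M lborel \<rightarrow>\<^sub>M ?M'"
    by (rule measurable_fun_upd[where J=I]) auto
  have fi[measurable]: "(\<lambda>z. f ((fst z)(i := snd z))) \<in> borel_measurable (?M \<Otimes>\<^sub>M lborel)"
    by (rule measurable_compose[OF upd' insert.prems(3)])
  have F[measurable]: "F \<in> borel_measurable ?M"
    unfolding F_def using fi by (intro lborel.borel_measurable_nn_integral) (simp add: case_prod_beta del: fun_upd_apply)
  have marg[measurable]: "(\<lambda>x. \<integral>\<^sup>+t. f (x(j := t)) \<partial>lborel) \<in> borel_measurable ?M'" if "j \<in> insert i I" for j
    using measurable_compose[OF upd[OF that] insert.prems(3)]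
    by (intro lborel.borel_measurable_nn_integral) (simp add: case_prod_beta del: fun_upd_apply)
  let ?e = "1 - (real (card (insert i I)) - 1) * q"
  let ?g = "\<lambda>x. enn_powr (f x) ?e * (\<Prod>j\<in>insert i I. enn_powr (\<integral>\<^sup>+t. f (x(j := t)) \<partial>lborel) q)"
  have e: "?e = 1 - n * q" using n by simp
  have gm: "?g \<in> borel_measurable ?M'"
    using marg by (intro borel_measurable_times_ennreal borel_measurable_prod_ennreal enn_powr_measurable insert.prems(3)) auto
  have "(\<integral>\<^sup>+x. ?g x \<partial>?M') = (\<integral>\<^sup>+x. (\<integral>\<^sup>+t. ?g (x(i := t)) \<partial>lborel) \<partial>?M)"
    by (rule product_nn_integral_insert[OF insert.hyps gm])
  also have "\<dots> \<le> (\<integral>\<^sup>+x. enn_powr (F x) (1 - (real (card I) - 1) * q) *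
             (\<Prod>j\<in>I. enn_powr (\<integral>\<^sup>+t. F (x(j := t)) \<partial>lborel) q) \<partial>?M)"
  proof (rule nn_integral_mono)
    fix x assume x: "x \<in> space ?M"
    have ti: "(\<lambda>t. x(i := t)) \<in> lborel \<rightarrow>\<^sub>M ?M'"
      by (rule measurable_component_update[OF x insert.hyps(2)])
    have fx[measurable]: "(\<lambda>t. f (x(i := t))) \<in> borel_measurable lborel"
      by (rule measurable_compose[OF ti insert.prems(3)])
    have Ax: "(\<lambda>t. \<integral>\<^sup>+s. f ((x(i := t))(j := s)) \<partial>lborel) \<in> borel_measurable lborel" if "j \<in> I" for j
      using measurable_compose[OF ti marg[of j]] that by simp
    let ?A = "\<lambda>k t. if k = i then f (x(i := t)) else (\<integral>\<^sup>+s. f ((x(i := t))(k := s)) \<partial>lborel)"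
    let ?w = "\<lambda>k. if k = i then 1 - n * q else q"
    have neq: "j \<in> I \<Longrightarrow> j \<noteq> i" for j using insert.hyps(2) by auto
    \<comment> \<open>The factor for j = i does not depend on t, since the update at i overwrites
      it, and leaves the integral as F^q. The remaining exponents, 1 - n q and n times q, sum to 1
      as Hoelder's inequality requires.\<close>
    have "(\<integral>\<^sup>+t. ?g (x(i := t)) \<partial>lborel) = (\<integral>\<^sup>+t. enn_powr (F x) q * (\<Prod>k\<in>insert i I. enn_powr (?A k t) (?w k)) \<partial>lborel)"
      using insert.hyps neq
      by (intro nn_integral_cong) (simp add: e F_def n_def mult_ac cong: prod.cong)
    also have "\<dots> = enn_powr (F x) q * (\<integral>\<^sup>+t. (\<Prod>k\<in>insert i I. enn_powr (?A k t) (?w k)) \<partial>lborel)"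
      using fx Ax by (intro nn_integral_cmult borel_measurable_prod_ennreal enn_powr_measurable) auto
    also have "\<dots> \<le> enn_powr (F x) q * (\<Prod>k\<in>insert i I. enn_powr (\<integral>\<^sup>+t. ?A k t \<partial>lborel) (?w k))"
    proof (intro mult_left_mono nn_integral_Holder_prod)
      have "sum ?w I = (\<Sum>k\<in>I. q)" using neq by (intro sum.cong) auto
      then show "sum ?w (insert i I) = 1"
        using insert.hyps by (simp add: n_def)
    qed (use insert.hyps nq q fx Ax in auto)
    also have "\<dots> = enn_powr (F x) q * enn_powr (F x) (1 - n * q) * (\<Prod>j\<in>I. enn_powr (\<integral>\<^sup>+t. (\<integral>\<^sup>+s. f ((x(i := t))(j := s)) \<partial>lborel) \<partial>lborel) q)"
      using insert.hyps neq by (simp add: F_def mult_ac cong: prod.cong)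
    \<comment> \<open>The exponents q and 1 - n q add up to 1 - (n - 1) q, the one that the
      induction hypothesis expects for \<open>I\<close> and \<open>F\<close>.\<close>
    also have "enn_powr (F x) q * enn_powr (F x) (1 - n * q) = enn_powr (F x) (1 - (real (card I) - 1) * q)"
      using q nq by (subst enn_powr_add[symmetric]) (auto simp: n_def algebra_simps)
    also have "(\<Prod>j\<in>I. enn_powr (\<integral>\<^sup>+t. (\<integral>\<^sup>+s. f ((x(i := t))(j := s)) \<partial>lborel) \<partial>lborel) q)
      = (\<Prod>j\<in>I. enn_powr (\<integral>\<^sup>+s. F (x(j := s)) \<partial>lborel) q)"
    proof (intro prod.cong refl)
      fix j assume j: "j \<in> I"
      have tj: "(\<lambda>z. ((x(i := fst z))(j := snd z))) \<in> lborel \<Otimes>\<^sub>M lborel \<rightarrow>\<^sub>M ?M'"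
        using measurable_compose[OF measurable_Pair[OF measurable_compose[OF measurable_fst ti] measurable_snd] upd[of j]] j
        by simp
      have "(\<integral>\<^sup>+t. (\<integral>\<^sup>+s. f ((x(i := t))(j := s)) \<partial>lborel) \<partial>lborel) = (\<integral>\<^sup>+s. (\<integral>\<^sup>+t. f ((x(i := t))(j := s)) \<partial>lborel) \<partial>lborel)"
        using measurable_compose[OF tj insert.prems(3)]
        by (intro lborel_pair.Fubini'[symmetric]) (simp add: case_prod_beta del: fun_upd_apply)
      also have "\<dots> = (\<integral>\<^sup>+s. F (x(j := s)) \<partial>lborel)"
        using neq[OF j] by (simp add: F_def fun_upd_twist)
      finally show "enn_powr (\<integral>\<^sup>+t. (\<integral>\<^sup>+s. f ((x(i := t))(j := s)) \<partial>lborel) \<partial>lborel) q = enn_powr (\<integral>\<^sup>+s. F (x(j := s)) \<partial>lborel) q"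
        by simp
    qed
    finally show "(\<integral>\<^sup>+t. ?g (x(i := t)) \<partial>lborel) \<le> enn_powr (F x) (1 - (real (card I) - 1) * q) *
             (\<Prod>j\<in>I. enn_powr (\<integral>\<^sup>+t. F (x(j := t)) \<partial>lborel) q)" .
  qed
  also have "\<dots> \<le> enn_powr (\<integral>\<^sup>+x. F x \<partial>?M) (1 + q)"
  proof (rule insert.IH[OF q _ F])
    have "(real (card I) - 1) * q \<le> n * q" using q by (intro mult_right_mono) (auto simp: n_def)
    then show "(real (card I) - 1) * q \<le> 1" using nq by simp
  qed
  also have "(\<integral>\<^sup>+x. F x \<partial>?M) = (\<integral>\<^sup>+x. f x \<partial>?M')"
    unfolding F_def by (rule product_nn_integral_insert[OF insert.hyps insert.prems(3), symmetric])
  finally show ?case .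
qed

text \<open>The case q = 1 / (N - 1) of the preceding inequality: the exponent of \<open>h\<close>
  itself becomes 0, and the N line integrals, each to the power q, dominate v^(N/(N-1)). Only a
  bound by integrals over coordinate lines is assumed, so that \<open>v\<close> may be a power of a
  smooth function.\<close>

lemma gagliardo_nirenberg:
  fixes v h :: "'a::euclidean_space \<Rightarrow> real"
  assumes N: "DIM('a) \<ge> 2"
    and [measurable]: "v \<in> borel_measurable borel" "h \<in> borel_measurable borel"
    and v: "\<And>x. v x \<ge> 0"
    and le: "\<And>x b. b \<in> Basis \<Longrightarrow> ennreal (v x) \<le> (\<integral>\<^sup>+t. ennreal (h (x + t *\<^sub>R b)) \<partial>lborel)"
  shows "(\<integral>\<^sup>+x. ennreal (v x powr (DIM('a) / (DIM('a) - 1))) \<partial>lborel)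
    \<le> enn_powr (\<integral>\<^sup>+x. ennreal (h x) \<partial>lborel) (DIM('a) / (DIM('a) - 1))"
proof -
  let ?M = "Pi\<^sub>M (Basis :: 'a set) (\<lambda>_. lborel :: real measure)"
  let ?e = "\<lambda>g. \<Sum>b\<in>Basis. g b *\<^sub>R b :: 'a"
  define N where "N = real DIM('a)"
  have N2: "N \<ge> 2" using assms(1) by (simp add: N_def)
  define q where "q = 1 / (N - 1)"
  have q: "q > 0" "(N - 1) * q = 1" "1 + q = N / (N - 1)" "N * q = N / (N - 1)"
    using N2 by (auto simp: q_def field_simps)
  have n1: "real (DIM('a) - 1) = N - 1" using assms(1) by (simp add: N_def of_nat_diff)
  have em[measurable]: "?e \<in> ?M \<rightarrow>\<^sub>M borel" by measurable
  have line: "(\<integral>\<^sup>+t. ennreal (h (?e (x(b := t)))) \<partial>lborel) = (\<integral>\<^sup>+t. ennreal (h (?e x + t *\<^sub>R b)) \<partial>lborel)"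
    if b: "b \<in> Basis" for x b
  proof -
    have "?e (x(b := t)) = ?e x + (- x b + 1 * t) *\<^sub>R b" for t
    proof (rule euclidean_eqI)
      fix c :: 'a assume "c \<in> Basis"
      then show "?e (x(b := t)) \<bullet> c = (?e x + (- x b + 1 * t) *\<^sub>R b) \<bullet> c"
        using b by (simp add: inner_sum_left_Basis inner_add_left inner_Basis)
    qed
    then show ?thesis
      by (subst nn_integral_real_affine[where c=1 and t="- x b", of "\<lambda>t. ennreal (h (?e x + t *\<^sub>R b))"]) simp_all
  qed
  have "(\<integral>\<^sup>+x. ennreal (v x powr (N / (N - 1))) \<partial>lborel) = (\<integral>\<^sup>+x. ennreal (v (?e x) powr (N / (N - 1))) \<partial>?M)"
    by (subst lborel_eq) (simp add: nn_integral_distr)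
  also have "\<dots> \<le> (\<integral>\<^sup>+x. enn_powr (ennreal (h (?e x))) (1 - (real (card (Basis :: 'a set)) - 1) * q) *
             (\<Prod>j\<in>Basis. enn_powr (\<integral>\<^sup>+t. ennreal (h (?e (x(j := t)))) \<partial>lborel) q) \<partial>?M)"
  proof (rule nn_integral_mono)
    fix x
    have "ennreal (v (?e x) powr (N / (N - 1))) = enn_powr (ennreal (v (?e x))) q ^ DIM('a)"
      using q v N2 by (subst enn_powr_power) (auto simp: enn_powr_ennreal simp flip: N_def)
    also have "\<dots> = (\<Prod>j\<in>(Basis :: 'a set). enn_powr (ennreal (v (?e x))) q)" by simp
    also have "\<dots> \<le> (\<Prod>j\<in>(Basis :: 'a set). enn_powr (\<integral>\<^sup>+t. ennreal (h (?e (x(j := t)))) \<partial>lborel) q)"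
      using q le by (intro prod_mono_ennreal enn_powr_mono) (simp_all add: line del: fun_upd_apply)
    finally show "ennreal (v (?e x) powr (N / (N - 1))) \<le> enn_powr (ennreal (h (?e x))) (1 - (real (card (Basis :: 'a set)) - 1) * q) *
             (\<Prod>j\<in>Basis. enn_powr (\<integral>\<^sup>+t. ennreal (h (?e (x(j := t)))) \<partial>lborel) q)"
      using q(2) by (simp flip: N_def)
  qed
  also have "\<dots> \<le> enn_powr (\<integral>\<^sup>+x. ennreal (h (?e x)) \<partial>?M) (1 + q)"
    using q by (intro grid_lines_inequality) (auto simp flip: N_def)
  also have "(\<integral>\<^sup>+x. ennreal (h (?e x)) \<partial>?M) = (\<integral>\<^sup>+x. ennreal (h x) \<partial>lborel)"
    by (subst (2) lborel_eq) (simp add: nn_integral_distr)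
  finally show ?thesis using q(3) n1 by (simp add: N_def)
qed

section \<open>Sobolev inequalities and the linear term\<close>

lemma has_real_derivative_abs_powr:
  fixes v :: real
  assumes "\<gamma> > 1"
  shows "((\<lambda>v. \<bar>v\<bar> powr \<gamma>) has_real_derivative \<gamma> * \<bar>v\<bar> powr (\<gamma> - 1) * sgn v) (at v)"
proof -
  consider "v > 0" | "v < 0" | "v = 0" by linarith
  then show ?thesis
  proof cases
    case 1
    have "((\<lambda>v. v powr \<gamma>) has_real_derivative \<gamma> * v powr (\<gamma> - 1)) (at v)"
      using 1 by (rule has_real_derivative_powr)
    then have "((\<lambda>v. \<bar>v\<bar> powr \<gamma>) has_real_derivative \<gamma> * v powr (\<gamma> - 1)) (at v)"
      by (rule has_field_derivative_transform_within_open[where S="{0<..}"]) (use 1 in auto)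
    then show ?thesis using 1 by simp
  next
    case 2
    have "((\<lambda>v. (- v) powr \<gamma>) has_real_derivative (\<gamma> * (- v) powr (\<gamma> - 1)) * (- 1)) (at v)"
      by (rule DERIV_chain2[where f="\<lambda>x. x powr \<gamma>"])
         (use 2 in \<open>auto intro!: has_real_derivative_powr derivative_eq_intros\<close>)
    then have "((\<lambda>v. \<bar>v\<bar> powr \<gamma>) has_real_derivative (\<gamma> * (- v) powr (\<gamma> - 1)) * (- 1)) (at v)"
      by (rule has_field_derivative_transform_within_open[where S="{..<0}"]) (use 2 in auto)
    then show ?thesis using 2 by simp
  next
    \<comment> \<open>At the origin \<gamma> > 1 is essential: the difference quotient is at most
      |h|^(\<gamma>-1) in absolute value.\<close>
    case 3
    have "((\<lambda>h. \<bar>\<bar>h\<bar> powr (\<gamma> - 1)\<bar>) \<longlongrightarrow> \<bar>\<bar>0\<bar> powr (\<gamma> - 1)\<bar>) (at (0::real))"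
      using assms by (intro tendsto_intros tendsto_powr') auto
    then have lim: "((\<lambda>h. \<bar>\<bar>h\<bar> powr (\<gamma> - 1)\<bar>) \<longlongrightarrow> 0) (at (0::real))" using assms by simp
    have "norm (\<bar>h\<bar> powr \<gamma> / h) \<le> \<bar>\<bar>h\<bar> powr (\<gamma> - 1)\<bar>" for h :: real
      by (cases "h = 0") (auto simp: powr_diff)
    then have "((\<lambda>h. \<bar>h\<bar> powr \<gamma> / h) \<longlongrightarrow> 0) (at (0::real))"
      by (intro Lim_null_comparison[OF always_eventually lim]) blast
    then show ?thesis using 3 assms by (simp add: DERIV_def)
  qed
qed

lemma abs_powr_le_line_integral:
  fixes \<phi> :: "'a::euclidean_space \<Rightarrow> real"
  assumes der: "\<And>x. (\<phi> has_derivative (\<lambda>h. G x \<bullet> h)) (at x)"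
    and cont: "continuous_on UNIV G" and \<gamma>: "\<gamma> > 1" and b: "b \<in> Basis"
    and supp: "\<And>x. \<phi> x \<noteq> 0 \<Longrightarrow> \<forall>b\<in>Basis. \<bar>x \<bullet> b\<bar> < R"
  shows "ennreal (\<bar>\<phi> x\<bar> powr \<gamma>)
    \<le> (\<integral>\<^sup>+t. ennreal (\<gamma> * (\<bar>\<phi> (x + t *\<^sub>R b)\<bar> powr (\<gamma> - 1) * norm (G (x + t *\<^sub>R b)))) \<partial>lborel)"
proof -
  \<comment> \<open>Far enough back along the line to have left the box of half-side R, so the
    integration starts where \<phi> vanishes.\<close>
  define T where "T = \<bar>x \<bullet> b\<bar> + \<bar>R\<bar> + 1"
  have "\<bar>(x + (- T) *\<^sub>R b) \<bullet> b\<bar> \<ge> R"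
    using b by (simp add: T_def inner_add_left inner_diff_left)
  then have z: "\<phi> (x + (- T) *\<^sub>R b) = 0" using supp[of "x + (- T) *\<^sub>R b"] b by fastforce
  have c\<phi>: "continuous_on UNIV \<phi>"
    using der has_derivative_continuous by (intro continuous_at_imp_continuous_on) blast
  let ?g = "\<lambda>t. (\<gamma> * \<bar>\<phi> (x + t *\<^sub>R b)\<bar> powr (\<gamma> - 1) * sgn (\<phi> (x + t *\<^sub>R b))) * (G (x + t *\<^sub>R b) \<bullet> b)"
  let ?h = "\<lambda>t. \<gamma> * (\<bar>\<phi> (x + t *\<^sub>R b)\<bar> powr (\<gamma> - 1) * norm (G (x + t *\<^sub>R b)))"
  have "((\<lambda>t. \<bar>\<phi> (x + t *\<^sub>R b)\<bar> powr \<gamma>) has_real_derivative ?g t) (at t)" for t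
  proof -
    have "((\<lambda>t. x + t *\<^sub>R b) has_derivative (\<lambda>h. h *\<^sub>R b)) (at t)"
      by (auto intro!: derivative_eq_intros)
    from has_derivative_compose[OF this der]
    have "((\<lambda>t. \<phi> (x + t *\<^sub>R b)) has_real_derivative (G (x + t *\<^sub>R b) \<bullet> b)) (at t)"
      by (simp add: has_field_derivative_def mult_commute_abs)
    from DERIV_chain2[OF has_real_derivative_abs_powr[OF \<gamma>] this] show ?thesis .
  qed
  then have "(?g has_integral (\<bar>\<phi> (x + 0 *\<^sub>R b)\<bar> powr \<gamma> - \<bar>\<phi> (x + (- T) *\<^sub>R b)\<bar> powr \<gamma>)) {- T..0}"
    by (intro fundamental_theorem_of_calculus)
       (auto simp: T_def has_real_derivative_iff_has_vector_derivative[symmetric] intro: has_field_derivative_at_within)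
  then have g: "(?g has_integral (\<bar>\<phi> x\<bar> powr \<gamma>)) {- T..0}" using z by simp
  have h: "continuous_on UNIV ?h"
    using \<gamma> by (intro continuous_intros continuous_on_powr' continuous_on_compose2[OF c\<phi>] continuous_on_compose2[OF cont]) auto
  have "\<bar>?g t\<bar> \<le> ?h t" for t
  proof -
    have "\<bar>?g t\<bar> \<le> \<gamma> * \<bar>\<phi> (x + t *\<^sub>R b)\<bar> powr (\<gamma> - 1) * \<bar>G (x + t *\<^sub>R b) \<bullet> b\<bar>"
      using \<gamma> by (auto simp: abs_mult abs_sgn_eq)
    also have "\<dots> \<le> \<gamma> * \<bar>\<phi> (x + t *\<^sub>R b)\<bar> powr (\<gamma> - 1) * norm (G (x + t *\<^sub>R b))"
      using \<gamma> Basis_le_norm[OF b] by (intro mult_left_mono) auto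
    finally show ?thesis by (simp add: mult.assoc)
  qed
  from has_integral_le_nn_integral[OF g h this]
  have "ennreal (\<bar>\<phi> x\<bar> powr \<gamma>) \<le> (\<integral>\<^sup>+t. ennreal (?h t) * indicator {- T..0} t \<partial>lborel)"
    by simp
  also have "\<dots> \<le> (\<integral>\<^sup>+t. ennreal (?h t) \<partial>lborel)"
    by (intro nn_integral_mono) (auto simp: indicator_def)
  finally show ?thesis .
qed

text \<open>Finiteness is what later permits dividing an inequality by a power of this
  integral.\<close>

lemma nn_integral_abs_powr_finite:
  fixes \<phi> :: "'a::euclidean_space \<Rightarrow> real"
  assumes c: "continuous_on UNIV \<phi>" and s: "s > 0"
    and supp: "\<And>x. \<phi> x \<noteq> 0 \<Longrightarrow> \<forall>b\<in>Basis. \<bar>x \<bullet> b\<bar> < R"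
  shows "(\<integral>\<^sup>+x. ennreal (\<bar>\<phi> x\<bar> powr s) \<partial>lborel) < \<infinity>"
proof -
  let ?B = "cbox (- (R *\<^sub>R One)) (R *\<^sub>R One) :: 'a set"
  have "compact (\<phi> ` ?B)"
    by (intro compact_continuous_image continuous_on_subset[OF c] compact_cbox) auto
  then obtain M where M: "\<forall>y\<in>\<phi> ` ?B. norm y \<le> M" "M > 0"
    using compact_imp_bounded bounded_pos by metis
  have "ennreal (\<bar>\<phi> x\<bar> powr s) \<le> ennreal (M powr s) * indicator ?B x" for x
  proof (cases "\<phi> x = 0")
    case False
    then have x: "x \<in> ?B" using supp[OF False] by (auto simp: mem_box abs_less_iff less_imp_le)
    then have "\<bar>\<phi> x\<bar> powr s \<le> M powr s" using M s by (intro powr_mono2) auto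
    then show ?thesis using x by (simp add: ennreal_leI)
  qed simp
  then have "(\<integral>\<^sup>+x. ennreal (\<bar>\<phi> x\<bar> powr s) \<partial>lborel) \<le> (\<integral>\<^sup>+x. ennreal (M powr s) * indicator ?B x \<partial>lborel)"
    by (intro nn_integral_mono)
  also have "\<dots> = ennreal (M powr s) * emeasure lborel ?B"
    by (rule nn_integral_cmult_indicator) auto
  also have "\<dots> < \<infinity>"
    using emeasure_lborel_cbox_finite[of "- (R *\<^sub>R One) :: 'a" "R *\<^sub>R One"] by (simp add: ennreal_mult_less_top)
  finally show ?thesis .
qed

text \<open>Gagliardo-Nirenberg for |\<phi>|^\<gamma>, whose gradient is at most \<gamma>
  |\<phi>|^(\<gamma>-1) |G|, followed by Hoelder. With \<kappa> = N / (N - 1) and q conjugate to r,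
  the choice of \<gamma> gives \<gamma> \<kappa> = s = (\<gamma> - 1) q. Hence the same integral X
  of |\<phi>|^s stands on both sides, its power 1/q is absorbed on the left, and the exponent
  1/\<kappa> - 1/q = 1/s remains.\<close>

lemma sobolev_inequality:
  fixes \<phi> :: "'a::euclidean_space \<Rightarrow> real" and r s \<gamma> :: real
  assumes der: "\<And>x. (\<phi> has_derivative (\<lambda>h. G x \<bullet> h)) (at x)"
    and cont: "continuous_on UNIV G"
    and supp: "\<And>x. \<phi> x \<noteq> 0 \<Longrightarrow> \<forall>b\<in>Basis. \<bar>x \<bullet> b\<bar> < R"
    and N: "DIM('a) \<ge> 2" and r: "1 < r" "r < DIM('a)"
    and s: "s = DIM('a) * r / (DIM('a) - r)" and \<gamma>: "\<gamma> = r * (real DIM('a) - 1) / (DIM('a) - r)"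
  shows "enn_powr (\<integral>\<^sup>+x. ennreal (\<bar>\<phi> x\<bar> powr s) \<partial>lborel) (1 / s)
    \<le> ennreal \<gamma> * enn_powr (\<integral>\<^sup>+x. ennreal (norm (G x) powr r) \<partial>lborel) (1 / r)"
    (is "enn_powr ?X _ \<le> _ * enn_powr ?Y _")
proof (cases "?Y = top")
  case True
  have "\<gamma> > 0" using N r by (simp add: \<gamma>)
  then show ?thesis using True r by (simp add: enn_powr_top ennreal_mult_top)
next
  case False
  define n where "n = real DIM('a)"
  have n: "n \<ge> 2" "1 < r" "r < n" using N r by (auto simp: n_def)
  have n1: "real (DIM('a) - 1) = n - 1" using N by (simp add: n_def of_nat_diff)
  have s': "s = n * r / (n - r)" and \<gamma>': "\<gamma> = r * (n - 1) / (n - r)" using s \<gamma> by (auto simp: n_def)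
  have s0: "s > 0" using n by (simp add: s')
  have "(n - 1) * r > n - r" using n by (simp add: algebra_simps)
  then have \<gamma>1: "\<gamma> > 1" using n by (simp add: \<gamma>' less_divide_eq mult.commute)
  define q where "q = r / (r - 1)"
  define \<kappa> where "\<kappa> = n / (n - 1)"
  have q: "q > 1" "1 / r + 1 / q = 1" using n by (auto simp: q_def field_simps)
  have \<kappa>: "\<kappa> > 0" using n by (simp add: \<kappa>_def)
  have \<gamma>\<kappa>: "\<gamma> * \<kappa> = s" using n by (simp add: \<gamma>' \<kappa>_def s')
  have "\<gamma> - 1 = (r * (n - 1) - (n - r)) / (n - r)" using n by (simp add: \<gamma>' diff_divide_distrib)
  also have "r * (n - 1) - (n - r) = n * (r - 1)" by (simp add: algebra_simps)
  finally have \<gamma>q: "(\<gamma> - 1) * q = s" using n by (simp add: q_def s')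
  have "1 / \<kappa> - 1 / q = 1 / r - 1 / n"
    using n by (simp add: \<kappa>_def q_def diff_divide_distrib)
  also have "\<dots> = 1 / s" using n by (simp add: s' field_simps)
  finally have es: "1 / \<kappa> - 1 / q = 1 / s" .
  have c\<phi>: "continuous_on UNIV \<phi>"
    using der has_derivative_continuous by (intro continuous_at_imp_continuous_on) blast
  note [measurable] = borel_measurable_continuous_onI[OF c\<phi>] borel_measurable_continuous_onI[OF cont]
  obtain X where X: "?X = ennreal X" "X \<ge> 0"
    using nn_integral_abs_powr_finite[OF c\<phi> s0 supp] by (cases ?X) auto
  obtain Y where Y: "?Y = ennreal Y" "Y \<ge> 0"
    using False by (cases ?Y) auto
  let ?h = "\<lambda>x. \<gamma> * (\<bar>\<phi> x\<bar> powr (\<gamma> - 1) * norm (G x))"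
  have "(\<integral>\<^sup>+x. ennreal (\<bar>\<bar>\<phi> x\<bar> powr (\<gamma> - 1)\<bar> * \<bar>norm (G x)\<bar>) \<partial>lborel) \<le>
     enn_powr (\<integral>\<^sup>+x. ennreal (\<bar>\<bar>\<phi> x\<bar> powr (\<gamma> - 1)\<bar> powr q) \<partial>lborel) (1 / q) *
     enn_powr (\<integral>\<^sup>+x. ennreal (\<bar>norm (G x)\<bar> powr r) \<partial>lborel) (1 / r)"
    using q by (intro nn_integral_Holder) (auto simp: add.commute)
  also have "(\<integral>\<^sup>+x. ennreal (\<bar>\<bar>\<phi> x\<bar> powr (\<gamma> - 1)\<bar> powr q) \<partial>lborel) = ?X"
    by (simp add: powr_powr \<gamma>q)
  finally have H: "(\<integral>\<^sup>+x. ennreal (\<bar>\<phi> x\<bar> powr (\<gamma> - 1) * norm (G x)) \<partial>lborel)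
      \<le> ennreal (X powr (1 / q) * Y powr (1 / r))"
    using q n X Y by (simp add: enn_powr_ennreal ennreal_mult)
  have "(\<integral>\<^sup>+x. ennreal (?h x) \<partial>lborel) = ennreal \<gamma> * (\<integral>\<^sup>+x. ennreal (\<bar>\<phi> x\<bar> powr (\<gamma> - 1) * norm (G x)) \<partial>lborel)"
    using \<gamma>1 by (subst nn_integral_cmult[symmetric]) (auto simp: ennreal_mult)
  also have "\<dots> \<le> ennreal \<gamma> * ennreal (X powr (1 / q) * Y powr (1 / r))"
    by (intro mult_left_mono H) auto
  also have "\<dots> = ennreal (\<gamma> * (X powr (1 / q) * Y powr (1 / r)))"
    using \<gamma>1 by (intro ennreal_mult[symmetric]) auto
  finally have H2: "(\<integral>\<^sup>+x. ennreal (?h x) \<partial>lborel) \<le> ennreal (\<gamma> * (X powr (1 / q) * Y powr (1 / r)))" .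
  have "?X = (\<integral>\<^sup>+x. ennreal ((\<bar>\<phi> x\<bar> powr \<gamma>) powr \<kappa>) \<partial>lborel)"
    by (simp add: powr_powr \<gamma>\<kappa>)
  also have "\<dots> \<le> enn_powr (\<integral>\<^sup>+x. ennreal (?h x) \<partial>lborel) \<kappa>"
    using gagliardo_nirenberg[OF N, of "\<lambda>x. \<bar>\<phi> x\<bar> powr \<gamma>" ?h] abs_powr_le_line_integral[OF der cont \<gamma>1 _ supp]
    by (simp add: \<kappa>_def n_def n1)
  also have "\<dots> \<le> enn_powr (ennreal (\<gamma> * (X powr (1 / q) * Y powr (1 / r)))) \<kappa>"
    using \<kappa> by (intro enn_powr_mono H2) auto
  also have "\<dots> = ennreal ((\<gamma> * (X powr (1 / q) * Y powr (1 / r))) powr \<kappa>)"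
    using \<kappa> \<gamma>1 by (intro enn_powr_ennreal) auto
  finally have "X \<le> (\<gamma> * (X powr (1 / q) * Y powr (1 / r))) powr \<kappa>"
    using X by simp
  then have "X powr (1 / \<kappa>) \<le> ((\<gamma> * (X powr (1 / q) * Y powr (1 / r))) powr \<kappa>) powr (1 / \<kappa>)"
    using \<kappa> X by (intro powr_mono2) auto
  also have "\<dots> = \<gamma> * (X powr (1 / q) * Y powr (1 / r))"
    using \<kappa> \<gamma>1 by (simp add: powr_powr)
  finally have le: "X powr (1 / \<kappa>) \<le> \<gamma> * (X powr (1 / q) * Y powr (1 / r))" .
  have "X powr (1 / s) \<le> \<gamma> * Y powr (1 / r)"
  proof (cases "X = 0")
    case False
    have "X powr (1 / s) = X powr (1 / \<kappa>) / X powr (1 / q)"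
      by (simp add: es[symmetric] powr_diff)
    also have "\<dots> \<le> \<gamma> * Y powr (1 / r)"
      using le False X(2) by (simp add: divide_le_eq mult_ac)
    finally show ?thesis .
  qed (use \<gamma>1 in simp)
  then have "ennreal (X powr (1 / s)) \<le> ennreal \<gamma> * ennreal (Y powr (1 / r))"
    using \<gamma>1 by (simp add: ennreal_leI flip: ennreal_mult)
  then show ?thesis using X Y s0 n by (simp add: enn_powr_ennreal)
qed

section \<open>Uniform bounds for C^1 functions supported in a box\<close>

definition c1_in_box :: "real \<Rightarrow> ('a::euclidean_space \<Rightarrow> real) \<Rightarrow> ('a \<Rightarrow> 'a) \<Rightarrow> bool" where
  "c1_in_box R \<phi> G \<longleftrightarrow> (\<forall>x. (\<phi> has_derivative (\<lambda>h. G x \<bullet> h)) (at x)) \<and> continuous_on UNIV G \<and>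
     (\<forall>x. \<phi> x \<noteq> 0 \<longrightarrow> (\<forall>b\<in>Basis. \<bar>x \<bullet> b\<bar> < R)) \<and> (\<forall>x. G x \<noteq> 0 \<longrightarrow> (\<forall>b\<in>Basis. \<bar>x \<bullet> b\<bar> < R))"

lemma c1_in_boxD:
  assumes "c1_in_box R \<phi> G"
  shows "\<And>x. (\<phi> has_derivative (\<lambda>h. G x \<bullet> h)) (at x)" "continuous_on UNIV G"
    "\<And>x. \<phi> x \<noteq> 0 \<Longrightarrow> \<forall>b\<in>Basis. \<bar>x \<bullet> b\<bar> < R" "\<And>x. G x \<noteq> 0 \<Longrightarrow> \<forall>b\<in>Basis. \<bar>x \<bullet> b\<bar> < R"
    "continuous_on UNIV \<phi>" "\<phi> \<in> borel_measurable borel" "G \<in> borel_measurable borel"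
proof -
  show "\<And>x. (\<phi> has_derivative (\<lambda>h. G x \<bullet> h)) (at x)" and G: "continuous_on UNIV G" and
    "\<And>x. \<phi> x \<noteq> 0 \<Longrightarrow> \<forall>b\<in>Basis. \<bar>x \<bullet> b\<bar> < R" and "\<And>x. G x \<noteq> 0 \<Longrightarrow> \<forall>b\<in>Basis. \<bar>x \<bullet> b\<bar> < R"
    using assms by (auto simp: c1_in_box_def)
  then show \<phi>: "continuous_on UNIV \<phi>"
    using has_derivative_continuous by (intro continuous_at_imp_continuous_on) blast
  show "\<phi> \<in> borel_measurable borel" "G \<in> borel_measurable borel"
    using \<phi> G by (auto intro: borel_measurable_continuous_onI)
qed

lemma c1_in_box_scale:
  assumes "c1_in_box R \<phi> G"
  shows "c1_in_box R (\<lambda>x. c * \<phi> x) (\<lambda>x. c *\<^sub>R G x)"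
  using assms unfolding c1_in_box_def
  by (auto intro!: continuous_intros) (auto intro!: derivative_eq_intros)

text \<open>For p > N the conjugate power of the kernel is integrable without any weight, so the
  potential estimate applies with \<alpha> = 0. The point x takes the place of \<open>s\<close>, and
  \<phi>(x) is recovered by averaging over a cube where \<phi> = 0. The right side is not
  homogeneous in \<phi>; a rescaling makes up for this later.\<close>

lemma supercritical_sup_bound:
  fixes R p :: real
  assumes p: "p > DIM('a::euclidean_space)" and R: "R > 0"
  shows "\<exists>C>0. \<forall>\<phi> (G :: 'a \<Rightarrow> 'a). c1_in_box R \<phi> G \<longrightarrow>
    (\<forall>x. ennreal \<bar>\<phi> x\<bar> \<le> ennreal C * ((\<integral>\<^sup>+z. ennreal (norm (G z) powr p) \<partial>lborel) + 1))"
proof -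
  define N where "N = DIM('a)"
  have N: "N \<ge> 1" by (simp add: N_def Suc_leI)
  define \<nu> where "\<nu> = (real DIM('a) - 1 - 0 / p) * (p / (p - 1)) / DIM('a)"
  have "real DIM('a) \<ge> 1" using N by (simp add: N_def)
  then have p1: "p > 1" using p by linarith
  have "(real N - 1) * p < real N * (p - 1)" using p by (simp add: N_def algebra_simps)
  then have \<nu>1: "\<nu> < 1" using p1 N by (simp add: \<nu>_def divide_less_eq mult.commute flip: N_def)
  define D where "D = real N * (3 * R)"
  have D: "D > 0" using R N by (simp add: D_def)
  define K where "K = D ^ N / real N"
  define B where "B = max 1 ((2 / (1 - \<nu>) * (3 * R) powr (1 - \<nu>)) ^ N)"
  define C where "C = K * B / R ^ N"
  have K: "K > 0" using D N by (simp add: K_def)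
  have B: "B \<ge> 1" by (simp add: B_def)
  have C: "C > 0" using K B R by (simp add: C_def)
  obtain i :: 'a where i: "i \<in> Basis" using nonempty_Basis by blast
  \<comment> \<open>\<open>?Q\<close> is convex and contains both the box of half-side R and
    \<open>?P\<close>, a cube of side R on which \<phi> vanishes.\<close>
  let ?Q = "cbox (- ((2 * R) *\<^sub>R One)) ((2 * R) *\<^sub>R One) :: 'a set"
  let ?P = "cbox (R *\<^sub>R One) ((2 * R) *\<^sub>R One) :: 'a set"
  have P: "emeasure lborel ?P = ennreal (R ^ N)"
    using R by (subst emeasure_lborel_cbox) (auto simp: N_def inner_diff_left)
  have PQ: "?P \<subseteq> ?Q" using R by (auto simp: mem_box) (smt (verit))
  show ?thesis
  proof (intro exI[of _ C] conjI C allI impI)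
    fix \<phi> and G :: "'a \<Rightarrow> 'a" and x
    assume c1: "c1_in_box R \<phi> G"
    note [measurable] = c1_in_boxD(6,7)[OF c1]
    let ?Y = "\<integral>\<^sup>+z. ennreal (norm (G z) powr p) \<partial>lborel"
    show "ennreal \<bar>\<phi> x\<bar> \<le> ennreal C * (?Y + 1)"
    proof (cases "\<phi> x = 0")
      case False
      note x = c1_in_boxD(3)[OF c1 False]
      have coord: "\<bar>(z - x) \<bullet> b\<bar> \<le> 3 * R" if "z \<in> ?Q" "b \<in> Basis" for z b
      proof -
        have "- (2 * R) \<le> z \<bullet> b" "z \<bullet> b \<le> 2 * R" using that by (auto simp: mem_box)
        moreover have "\<bar>x \<bullet> b\<bar> < R" using x that(2) by blast
        ultimately show ?thesis unfolding inner_diff_left by linarith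
      qed
      have "- (2 * R) \<le> x \<bullet> b \<and> x \<bullet> b \<le> 2 * R" if "b \<in> Basis" for b
        using x[rule_format, OF that] R by linarith
      then have xQ: "x \<in> ?Q" by (simp add: mem_box)
      have QD: "?Q \<subseteq> cball x D"
      proof
        fix z assume z: "z \<in> ?Q"
        have "norm (z - x) \<le> (\<Sum>b\<in>(Basis::'a set). \<bar>(z - x) \<bullet> b\<bar>)" by (rule norm_le_l1)
        also have "\<dots> \<le> (\<Sum>b\<in>(Basis::'a set). 3 * R)" using coord[OF z] by (intro sum_mono)
        finally show "z \<in> cball x D" by (simp add: D_def N_def dist_norm norm_minus_commute)
      qed
      have zero: "\<phi> y = 0" if "y \<in> ?P" for y
      proof (rule ccontr)
        assume "\<phi> y \<noteq> 0"
        from c1_in_boxD(3)[OF c1 this] i have "\<bar>y \<bullet> i\<bar> < R" by blast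
        moreover have "R \<le> y \<bullet> i" using that i by (auto simp: mem_box)
        ultimately show False by simp
      qed
      have "ennreal (R ^ N) * ennreal \<bar>\<phi> x\<bar> = (\<integral>\<^sup>+y. ennreal \<bar>\<phi> x\<bar> * indicator ?P y \<partial>lborel)"
        by (subst nn_integral_cmult_indicator) (simp, simp only: P mult.commute[of "ennreal (R ^ N)"])
      also have "\<dots> \<le> (\<integral>\<^sup>+y. ennreal \<bar>\<phi> y - \<phi> x\<bar> * indicator ?Q y \<partial>lborel)"
      proof (rule nn_integral_mono)
        fix y
        show "ennreal \<bar>\<phi> x\<bar> * indicator ?P y \<le> ennreal \<bar>\<phi> y - \<phi> x\<bar> * indicator ?Q y"
          using zero[of y] subsetD[OF PQ, of y] by (cases "y \<in> ?P") simp_all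
      qed
      also have "\<dots> \<le> ennreal (D ^ DIM('a) / DIM('a)) *
           ((\<integral>\<^sup>+z. ennreal (norm (G z) powr p * \<bar>(z - x) \<bullet> i\<bar> powr (-0)) * indicator ?Q z \<partial>lborel) +
            (\<integral>\<^sup>+z. ennreal (\<Prod>b\<in>Basis. \<bar>(z - x) \<bullet> b\<bar> powr (-\<nu>)) * indicator ?Q z \<partial>lborel))"
        by (rule convex_diff_kernel_integral_le[OF c1_in_boxD(1,2)[OF c1] convex_box(1) xQ QD D _ p1 _ _ i])
           (use N in \<open>auto simp: \<nu>_def N_def of_nat_diff\<close>)
      also have "\<dots> \<le> ennreal K * (ennreal B * (?Y + 1))"
      proof -
        have "(\<integral>\<^sup>+z. ennreal (norm (G z) powr p * \<bar>(z - x) \<bullet> i\<bar> powr (-0)) * indicator ?Q z \<partial>lborel) \<le> ?Y"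
          by (intro nn_integral_mono) (auto simp: indicator_def)
        also have "?Y \<le> ennreal B * ?Y"
          using mult_right_mono[of 1 "ennreal B" ?Y] B by simp
        finally have 1: "(\<integral>\<^sup>+z. ennreal (norm (G z) powr p * \<bar>(z - x) \<bullet> i\<bar> powr (-0)) * indicator ?Q z \<partial>lborel) \<le> ennreal B * ?Y" .
        have "(\<integral>\<^sup>+z. ennreal (\<Prod>b\<in>Basis. \<bar>(z - x) \<bullet> b\<bar> powr (-\<nu>)) * indicator ?Q z \<partial>lborel)
          \<le> ennreal ((2 / (1 - \<nu>) * (3 * R) powr (1 - \<nu>)) ^ DIM('a))"
          using R coord by (intro nn_integral_prod_powr_le \<nu>1) auto
        also have "\<dots> \<le> ennreal B" by (intro ennreal_leI) (simp add: B_def N_def)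
        finally show ?thesis
          using 1 by (auto simp: K_def N_def distrib_left intro!: mult_left_mono add_mono)
      qed
      also have "\<dots> = ennreal (R ^ N) * (ennreal C * (?Y + 1))"
      proof -
        have "ennreal K * ennreal B = ennreal (R ^ N) * ennreal C"
          using K B R C by (simp add: C_def flip: ennreal_mult)
        then show ?thesis by (simp only: mult.assoc[symmetric])
      qed
      finally show ?thesis
        using R by (subst (asm) ennreal_mult_le_mult_iff) auto
    qed simp
  qed
qed

section \<open>The linear term controlled by the gradient\<close>

text \<open>One notion for the three cases of q0: q is conjugate to the Sobolev exponent of some r <
  N with r \<le> p. For p < N take r = p; for p = N, values of r close to N bring q as close to 1 as
  desired; for p > N also q = 1 is allowed.\<close>

definition dual_exponent :: "nat \<Rightarrow> real \<Rightarrow> real \<Rightarrow> bool" where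
  "dual_exponent N p q \<longleftrightarrow> p > real N \<and> q = 1 \<or>
     (\<exists>r. 1 < r \<and> r < real N \<and> r \<le> p \<and>
        q = (real N * r / (real N - r)) / (real N * r / (real N - r) - 1))"

lemma sobolev_exponent_gt_1:
  fixes n r :: real
  assumes "1 < r" "r < n"
  shows "n * r / (n - r) > 1"
proof -
  have "n * 1 < n * r" using assms by (intro mult_strict_left_mono) auto
  then have "n - r < n * r" using assms by linarith
  then show ?thesis using assms by (simp add: less_divide_eq)
qed

lemma dual_exponent_ge_1:
  assumes "dual_exponent N p q"
  shows "q \<ge> 1"
  using assms unfolding dual_exponent_def
proof (elim disjE exE conjE)
  fix r assume r: "1 < r" "r < real N"
    and q: "q = real N * r / (real N - r) / (real N * r / (real N - r) - 1)"
  define s where "s = real N * r / (real N - r)"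
  have "s > 1" unfolding s_def by (rule sobolev_exponent_gt_1[OF r])
  then show ?thesis unfolding q s_def[symmetric] by (simp add: le_divide_eq)
qed simp

lemma nn_integral_powr_le_box:
  fixes G :: "'a::euclidean_space \<Rightarrow> 'a"
  assumes c1: "c1_in_box R \<phi> G" and R: "R > 0" and r: "0 < r" "r \<le> p"
  shows "(\<integral>\<^sup>+z. ennreal (norm (G z) powr r) \<partial>lborel) \<le>
    (\<integral>\<^sup>+z. ennreal (norm (G z) powr p) \<partial>lborel) + ennreal ((2 * R) ^ DIM('a))"
proof -
  note [measurable] = c1_in_boxD(6,7)[OF c1]
  let ?B = "cbox (- (R *\<^sub>R One)) (R *\<^sub>R One) :: 'a set"
  have "ennreal (norm (G z) powr r) \<le> ennreal (norm (G z) powr p) + indicator ?B z" for z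
  proof (cases "G z = 0")
    case False
    then have "z \<in> ?B" using c1_in_boxD(4)[OF c1 False] by (auto simp: mem_box abs_less_iff less_imp_le)
    moreover have "norm (G z) powr r \<le> norm (G z) powr p + 1"
    proof (cases "norm (G z) \<le> 1")
      case True
      then have "norm (G z) powr r \<le> 1" using r powr_mono2[of r "norm (G z)" 1] by simp
      then show ?thesis using powr_ge_zero[of "norm (G z)" p] by linarith
    next
      case F: False
      then have "norm (G z) powr r \<le> norm (G z) powr p" using r by (intro powr_mono) auto
      then show ?thesis by simp
    qed
    then have "ennreal (norm (G z) powr r) \<le> ennreal (norm (G z) powr p) + 1"
      by (metis ennreal_1 ennreal_leI ennreal_plus powr_ge_zero zero_le_one)
    ultimately show ?thesis by simp
  qed (use r in simp)
  then have "(\<integral>\<^sup>+z. ennreal (norm (G z) powr r) \<partial>lborel) \<le> (\<integral>\<^sup>+z. ennreal (norm (G z) powr p) + indicator ?B z \<partial>lborel)"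
    by (rule nn_integral_mono)
  also have "\<dots> = (\<integral>\<^sup>+z. ennreal (norm (G z) powr p) \<partial>lborel) + emeasure lborel ?B"
    by (subst nn_integral_add) auto
  also have "emeasure lborel ?B = ennreal ((2 * R) ^ DIM('a))"
  proof -
    have "(\<Prod>b\<in>(Basis::'a set). (R *\<^sub>R One - - (R *\<^sub>R One)) \<bullet> b) = (\<Prod>b\<in>(Basis::'a set). 2 * R)"
      by (intro prod.cong refl) (simp add: inner_add_left)
    then show ?thesis using R by (subst emeasure_lborel_cbox) simp_all
  qed
  finally show ?thesis .
qed

lemma enn_powr_le_add_1:
  assumes "0 < a" "a \<le> 1"
  shows "enn_powr x a \<le> x + 1"
proof (cases x)
  case (real y)
  have "y powr a \<le> y + 1"
  proof (cases "y \<le> 1")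
    case True
    then have "y powr a \<le> 1" using assms real powr_mono2[of a y 1] by simp
    then show ?thesis using real by linarith
  next
    case False
    then have "y powr a \<le> y powr 1" using assms by (intro powr_mono) auto
    then show ?thesis using real by simp
  qed
  then show ?thesis using real assms
    by (simp add: enn_powr_ennreal) (metis ennreal_1 ennreal_leI ennreal_plus zero_le_one)
qed simp

text \<open>The constant depends on neither \<open>g\<close> nor \<phi>: the bound serves once for
  \<open>g\<close> itself and once for a tail of \<open>g\<close> whose L^q norm is small.\<close>

lemma linear_term_bound:
  fixes R p q :: real
  assumes N: "DIM('a::euclidean_space) \<ge> 2" and R: "R > 0" and q: "dual_exponent DIM('a) p q"
  shows "\<exists>A>0. \<forall>(g :: 'a \<Rightarrow> real) \<phi> (G :: 'a \<Rightarrow> 'a). g \<in> borel_measurable borel \<longrightarrow> (\<forall>x. g x \<ge> 0) \<longrightarrow> c1_in_box R \<phi> G \<longrightarrow>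
    (\<integral>\<^sup>+x. ennreal (g x * \<bar>\<phi> x\<bar>) \<partial>lborel) \<le>
     ennreal A * enn_powr (\<integral>\<^sup>+x. ennreal (g x powr q) \<partial>lborel) (1 / q) *
       ((\<integral>\<^sup>+z. ennreal (norm (G z) powr p) \<partial>lborel) + 1)"
  using q unfolding dual_exponent_def
proof (elim disjE exE conjE)
  assume p: "p > real DIM('a)" and q1: "q = 1"
  from supercritical_sup_bound[OF p R] obtain C where C: "C > 0" and
    sup: "\<And>\<phi> (G :: 'a \<Rightarrow> 'a) x. c1_in_box R \<phi> G \<Longrightarrow> ennreal \<bar>\<phi> x\<bar> \<le> ennreal C * ((\<integral>\<^sup>+z. ennreal (norm (G z) powr p) \<partial>lborel) + 1)"
    by blast
  show ?thesis
  proof (intro exI[of _ C] conjI C allI impI)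
    fix g :: "'a \<Rightarrow> real" and \<phi> and G :: "'a \<Rightarrow> 'a"
    assume g[measurable]: "g \<in> borel_measurable borel" and g0: "\<forall>x. g x \<ge> 0" and c1: "c1_in_box R \<phi> G"
    let ?Y = "(\<integral>\<^sup>+z. ennreal (norm (G z) powr p) \<partial>lborel) + 1"
    have "(\<integral>\<^sup>+x. ennreal (g x * \<bar>\<phi> x\<bar>) \<partial>lborel) \<le> (\<integral>\<^sup>+x. ennreal (g x) * (ennreal C * ?Y) \<partial>lborel)"
      using g0 sup[OF c1] by (intro nn_integral_mono) (simp add: ennreal_mult mult_left_mono)
    also have "\<dots> = (\<integral>\<^sup>+x. ennreal (g x) \<partial>lborel) * (ennreal C * ?Y)"
      by (rule nn_integral_multc) auto
    finally show "(\<integral>\<^sup>+x. ennreal (g x * \<bar>\<phi> x\<bar>) \<partial>lborel) \<le>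
     ennreal C * enn_powr (\<integral>\<^sup>+x. ennreal (g x powr q) \<partial>lborel) (1 / q) * ?Y"
      using g0 q1 by (simp add: mult_ac)
  qed
next
  fix r assume r: "1 < r" "r < real DIM('a)" "r \<le> p"
    and q: "q = (real DIM('a) * r / (real DIM('a) - r)) / (real DIM('a) * r / (real DIM('a) - r) - 1)"
  define s where "s = real DIM('a) * r / (real DIM('a) - r)"
  define \<gamma> where "\<gamma> = r * (real DIM('a) - 1) / (real DIM('a) - r)"
  have \<gamma>: "\<gamma> > 0" using r N by (simp add: \<gamma>_def)
  have "s > 1" unfolding s_def by (rule sobolev_exponent_gt_1[OF r(1,2)])
  moreover have qs: "q = s / (s - 1)" using q by (simp add: s_def)
  ultimately have s: "q > 1" "1 / q + 1 / s = 1"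
    by (simp_all add: qs less_divide_eq diff_divide_distrib)
  define V where "V = (2 * R) ^ DIM('a) + 1"
  have V: "V \<ge> 1" using R by (simp add: V_def)
  show ?thesis
  proof (intro exI[of _ "\<gamma> * V"] conjI allI impI)
    show "\<gamma> * V > 0" using \<gamma> V by simp
    fix g :: "'a \<Rightarrow> real" and \<phi> and G :: "'a \<Rightarrow> 'a"
    assume g[measurable]: "g \<in> borel_measurable borel" and g0: "\<forall>x. g x \<ge> 0" and c1: "c1_in_box R \<phi> G"
    note [measurable] = c1_in_boxD(6,7)[OF c1]
    let ?Y = "\<integral>\<^sup>+z. ennreal (norm (G z) powr p) \<partial>lborel"
    let ?Z = "\<integral>\<^sup>+z. ennreal (norm (G z) powr r) \<partial>lborel"
    let ?g = "enn_powr (\<integral>\<^sup>+x. ennreal (g x powr q) \<partial>lborel) (1 / q)"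
    have "(\<integral>\<^sup>+x. ennreal (\<bar>g x\<bar> * \<bar>\<phi> x\<bar>) \<partial>lborel) \<le>
      enn_powr (\<integral>\<^sup>+x. ennreal (\<bar>g x\<bar> powr q) \<partial>lborel) (1 / q) * enn_powr (\<integral>\<^sup>+x. ennreal (\<bar>\<phi> x\<bar> powr s) \<partial>lborel) (1 / s)"
      by (rule nn_integral_Holder) (use s in auto)
    also have "enn_powr (\<integral>\<^sup>+x. ennreal (\<bar>\<phi> x\<bar> powr s) \<partial>lborel) (1 / s) \<le> ennreal \<gamma> * enn_powr ?Z (1 / r)"
      by (rule sobolev_inequality[OF c1_in_boxD(1-3)[OF c1] N r(1,2) s_def \<gamma>_def])
    also have "enn_powr ?Z (1 / r) \<le> ?Z + 1"
      using r by (intro enn_powr_le_add_1) auto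
    also have "?Z \<le> ?Y + ennreal ((2 * R) ^ DIM('a))"
      using r by (intro nn_integral_powr_le_box[OF c1 R]) auto
    also have "?Y + ennreal ((2 * R) ^ DIM('a)) + 1 = ?Y + ennreal V"
      using R by (simp add: V_def add.assoc)
    also have "?Y + ennreal V \<le> ennreal V * (?Y + 1)"
      using mult_right_mono[of 1 "ennreal V" ?Y] V by (simp add: distrib_left)
    finally have "(\<integral>\<^sup>+x. ennreal (g x * \<bar>\<phi> x\<bar>) \<partial>lborel) \<le> ?g * (ennreal \<gamma> * (ennreal V * (?Y + 1)))"
      using g0 by (simp add: mult_left_mono add_mono)
    also have "\<dots> = ennreal (\<gamma> * V) * ?g * (?Y + 1)"
      using \<gamma> V by (simp add: ennreal_mult mult_ac)
    finally show "(\<integral>\<^sup>+x. ennreal (g x * \<bar>\<phi> x\<bar>) \<partial>lborel) \<le> ennreal (\<gamma> * V) * ?g * (?Y + 1)" .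
  qed
qed

text \<open>Applied to \<phi> / t, the previous bound K (Y + 1) becomes K (t^(1-p) Y + t), and as p
  > 1 a large t makes the gradient coefficient at most \<eta>. Nothing is asked of the zeros of
  \<phi> inside the box: this is what bounds the energy from below whatever set is removed.\<close>

lemma linear_term_le_gradient:
  fixes R p q :: real and g :: "'a::euclidean_space \<Rightarrow> real"
  assumes N: "DIM('a) \<ge> 2" and R: "R > 0" and q: "dual_exponent DIM('a) p q" and p: "p > 1"
    and g[measurable]: "g \<in> borel_measurable borel" and g0: "\<And>x. g x \<ge> 0"
    and fin: "(\<integral>\<^sup>+x. ennreal (g x powr q) \<partial>lborel) < top" and \<eta>: "\<eta> > 0"
  shows "\<exists>B\<ge>0. \<forall>\<phi> (G :: 'a \<Rightarrow> 'a). c1_in_box R \<phi> G \<longrightarrow>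
    (\<integral>\<^sup>+x. ennreal (g x * \<bar>\<phi> x\<bar>) \<partial>lborel) \<le>
     ennreal \<eta> * (\<integral>\<^sup>+z. ennreal (norm (G z) powr p) \<partial>lborel) + ennreal B"
proof -
  obtain A where A: "A > 0" and bound: "\<And>\<phi> (G :: 'a \<Rightarrow> 'a). c1_in_box R \<phi> G \<Longrightarrow>
    (\<integral>\<^sup>+x. ennreal (g x * \<bar>\<phi> x\<bar>) \<partial>lborel) \<le>
     ennreal A * enn_powr (\<integral>\<^sup>+x. ennreal (g x powr q) \<partial>lborel) (1 / q) *
       ((\<integral>\<^sup>+z. ennreal (norm (G z) powr p) \<partial>lborel) + 1)"
    using linear_term_bound[OF N R q] g g0 by blast
  have q1: "q \<ge> 1" by (rule dual_exponent_ge_1[OF q])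
  obtain a where a: "(\<integral>\<^sup>+x. ennreal (g x powr q) \<partial>lborel) = ennreal a" "a \<ge> 0"
    using fin by (cases "\<integral>\<^sup>+x. ennreal (g x powr q) \<partial>lborel") auto
  define K where "K = A * a powr (1 / q)"
  have K: "K \<ge> 0" using A by (simp add: K_def)
  have AK: "ennreal A * enn_powr (\<integral>\<^sup>+x. ennreal (g x powr q) \<partial>lborel) (1 / q) = ennreal K"
    using a q1 A by (simp add: K_def enn_powr_ennreal ennreal_mult)
  \<comment> \<open>Gives K t^(1-p) = K / (K / \<eta> + 1), which is at most \<eta>; the added 1
    keeps t positive when K = 0.\<close>
  define t where "t = (K / \<eta> + 1) powr (1 / (p - 1))"
  have t: "t > 0" using K \<eta> by (simp add: t_def add_nonneg_pos less_imp_neq[symmetric])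
  have tp: "t * (1 / t) powr p = 1 / (K / \<eta> + 1)"
  proof -
    have pos: "K / \<eta> + 1 > 0" using K \<eta> by (simp add: add_nonneg_pos)
    have "t * (1 / t) powr p = t powr (1 - p)"
      using t by (simp add: powr_divide powr_diff)
    also have "\<dots> = (K / \<eta> + 1) powr (- 1)"
    proof -
      have "1 / (p - 1) * (1 - p) = - 1" using p by (simp add: divide_eq_eq)
      then show ?thesis unfolding t_def powr_powr by simp
    qed
    finally show ?thesis using pos by (simp add: powr_minus divide_inverse)
  qed
  have Kt: "K * (t * (1 / t) powr p) \<le> \<eta>"
    unfolding tp using K \<eta> by (simp add: divide_le_eq add_nonneg_pos field_simps)
  show ?thesis
  proof (intro exI[of _ "K * t"] conjI allI impI)
    show "K * t \<ge> 0" using K t by simp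
    fix \<phi> and G :: "'a \<Rightarrow> 'a" assume c1: "c1_in_box R \<phi> G"
    note [measurable] = c1_in_boxD(6,7)[OF c1]
    let ?Y = "\<integral>\<^sup>+z. ennreal (norm (G z) powr p) \<partial>lborel"
    let ?c = "1 / t"
    have "(\<integral>\<^sup>+x. ennreal (g x * \<bar>\<phi> x\<bar>) \<partial>lborel) = (\<integral>\<^sup>+x. ennreal t * ennreal (g x * \<bar>?c * \<phi> x\<bar>) \<partial>lborel)"
      using t g0 by (intro nn_integral_cong) (simp add: abs_mult flip: ennreal_mult)
    also have "\<dots> = ennreal t * (\<integral>\<^sup>+x. ennreal (g x * \<bar>?c * \<phi> x\<bar>) \<partial>lborel)"
      by (rule nn_integral_cmult) measurable
    also have "\<dots> \<le> ennreal t * (ennreal K * ((\<integral>\<^sup>+z. ennreal (norm (?c *\<^sub>R G z) powr p) \<partial>lborel) + 1))"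
      using bound[OF c1_in_box_scale[OF c1, of ?c]] unfolding AK by (intro mult_left_mono) auto
    also have "(\<integral>\<^sup>+z. ennreal (norm (?c *\<^sub>R G z) powr p) \<partial>lborel) = (\<integral>\<^sup>+z. ennreal (?c powr p) * ennreal (norm (G z) powr p) \<partial>lborel)"
      using t by (intro nn_integral_cong) (simp add: powr_mult powr_divide flip: ennreal_mult)
    also have "\<dots> = ennreal (?c powr p) * ?Y"
      by (rule nn_integral_cmult) measurable
    also have "ennreal t * (ennreal K * (ennreal (?c powr p) * ?Y + 1)) = ennreal (K * (t * ?c powr p)) * ?Y + ennreal (K * t)"
    proof -
      have "ennreal (K * (t * ?c powr p)) = ennreal K * (ennreal t * ennreal (?c powr p))"
        using K t by (subst ennreal_mult, simp, simp, subst ennreal_mult) auto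
      moreover have "ennreal (K * t) = ennreal K * ennreal t" using K t by (intro ennreal_mult) auto
      ultimately show ?thesis by (simp only: distrib_left mult_ac mult_1_left mult_1_right)
    qed
    also have "\<dots> \<le> ennreal \<eta> * ?Y + ennreal (K * t)"
      using Kt by (intro add_right_mono mult_right_mono ennreal_leI) auto
    finally show "(\<integral>\<^sup>+x. ennreal (g x * \<bar>\<phi> x\<bar>) \<partial>lborel) \<le> ennreal \<eta> * ?Y + ennreal (K * t)" .
  qed
qed

lemma nn_integral_powr_tail_small:
  fixes g :: "'a::euclidean_space \<Rightarrow> real"
  assumes g[measurable]: "g \<in> borel_measurable borel"
    and fin: "(\<integral>\<^sup>+x. ennreal (g x powr q) \<partial>lborel) < top" and \<epsilon>: "\<epsilon> > 0"
  shows "\<exists>M::nat. (\<integral>\<^sup>+x. ennreal ((if g x > real M then g x else 0) powr q) \<partial>lborel) < ennreal \<epsilon>"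
proof -
  have "(\<lambda>M. \<integral>\<^sup>+x. ennreal ((if g x > real M then g x else 0) powr q) \<partial>lborel) \<longlonglongrightarrow> (\<integral>\<^sup>+(x::'a). 0 \<partial>lborel)"
  proof (rule nn_integral_dominated_convergence[where w="\<lambda>x. ennreal (g x powr q)"])
    show "AE x in lborel. (\<lambda>M. ennreal ((if g x > real M then g x else 0) powr q)) \<longlonglongrightarrow> 0"
    proof (rule AE_I2)
      fix x
      obtain M0 :: nat where M0: "g x < real M0" using reals_Archimedean2 by blast
      have "\<forall>\<^sub>F M in sequentially. ennreal ((if g x > real M then g x else 0) powr q) = 0"
        using eventually_ge_at_top[of M0] by eventually_elim (use M0 in auto)
      then show "(\<lambda>M. ennreal ((if g x > real M then g x else 0) powr q)) \<longlonglongrightarrow> 0"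
        by (rule tendsto_eventually)
    qed
  qed (use fin in \<open>auto intro!: AE_I2 ennreal_leI\<close>)
  then have "\<forall>\<^sub>F M in sequentially. (\<integral>\<^sup>+x. ennreal ((if g x > real M then g x else 0) powr q) \<partial>lborel) < ennreal \<epsilon>"
    using \<epsilon> by (intro order_tendstoD(2)) auto
  from eventually_happens'[OF _ this] show ?thesis by simp
qed

text \<open>\<open>g\<close> is truncated at a level M. The tail has small L^q norm and is
  controlled by \<open>linear_term_bound\<close> alone; the rest is at most M times the integral of
  |\<phi>|, which a fine grid makes small. M is fixed before the mesh is refined.\<close>

lemma linear_term_small_on_grid:
  fixes R p q :: real and g :: "'a::euclidean_space \<Rightarrow> real"
  assumes N: "DIM('a) \<ge> 2" and R: "R > 0" and q: "dual_exponent DIM('a) p q" and p: "p > real DIM('a) - 1"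
    and g[measurable]: "g \<in> borel_measurable borel" and g0: "\<And>x. g x \<ge> 0"
    and fin: "(\<integral>\<^sup>+x. ennreal (g x powr q) \<partial>lborel) < top" and \<eta>: "\<eta> > 0"
    and l: "l > 0" and i: "i \<in> Basis"
  shows "\<forall>\<^sub>F m in sequentially. \<forall>\<phi> (G :: 'a \<Rightarrow> 'a). c1_in_box R \<phi> G \<longrightarrow>
     (\<forall>k\<in>grid_index m. \<forall>x\<in>grid_segment (R / m) (min l R / (3 * real m) ^ DIM('a)) i k. \<phi> x = 0) \<longrightarrow>
     (\<integral>\<^sup>+x. ennreal (g x * \<bar>\<phi> x\<bar>) \<partial>lborel) \<le>
       ennreal \<eta> * (\<integral>\<^sup>+z. ennreal (norm (G z) powr p) \<partial>lborel) + ennreal \<eta>"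
proof -
  obtain A where A: "A > 0" and bound: "\<And>g \<phi> (G :: 'a \<Rightarrow> 'a). g \<in> borel_measurable borel \<Longrightarrow> (\<And>x. g x \<ge> 0) \<Longrightarrow> c1_in_box R \<phi> G \<Longrightarrow>
    (\<integral>\<^sup>+x. ennreal (g x * \<bar>\<phi> x\<bar>) \<partial>lborel) \<le>
     ennreal A * enn_powr (\<integral>\<^sup>+x. ennreal (g x powr q) \<partial>lborel) (1 / q) *
       ((\<integral>\<^sup>+z. ennreal (norm (G z) powr p) \<partial>lborel) + 1)"
    using linear_term_bound[OF N R q] by blast
  have q1: "q \<ge> 1" by (rule dual_exponent_ge_1[OF q])
  \<comment> \<open>Chosen so that A \<epsilon>^(1/q) = \<eta> / 2.\<close>
  define \<epsilon> where "\<epsilon> = (\<eta> / (2 * A)) powr q"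
  have "\<epsilon> > 0" using \<eta> A by (simp add: \<epsilon>_def)
  then obtain M :: nat where M: "(\<integral>\<^sup>+x. ennreal ((if g x > real M then g x else 0) powr q) \<partial>lborel) < ennreal \<epsilon>"
    using nn_integral_powr_tail_small[OF g fin] by blast
  define h where "h x = (if g x > real M then g x else 0)" for x
  have "h \<in> borel_measurable borel" unfolding h_def by measurable
  moreover have "\<And>x. h x \<ge> 0" using g0 by (simp add: h_def)
  ultimately have h: "h \<in> borel_measurable borel" "\<And>x. h x \<ge> 0" by blast+
  have "ennreal A * enn_powr (\<integral>\<^sup>+x. ennreal (h x powr q) \<partial>lborel) (1 / q) \<le> ennreal A * enn_powr (ennreal \<epsilon>) (1 / q)"
    using M q1 by (intro mult_left_mono enn_powr_mono) (auto simp: h_def)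
  also have "\<dots> = ennreal (\<eta> / 2)"
    using \<eta> A q1 by (simp add: \<epsilon>_def enn_powr_ennreal powr_powr flip: ennreal_mult)
  finally have hA: "ennreal A * enn_powr (\<integral>\<^sup>+x. ennreal (h x powr q) \<partial>lborel) (1 / q) \<le> ennreal (\<eta> / 2)" .
  \<comment> \<open>M + 1 in place of M covers the level M = 0.\<close>
  define \<mu> where "\<mu> = \<eta> / (2 * (real M + 1))"
  have \<mu>: "\<mu> > 0" "real M * \<mu> \<le> \<eta> / 2" using \<eta> by (auto simp: \<mu>_def field_simps)
  show ?thesis
    using grid_poincare[OF N p R l i \<mu>(1)]
  proof eventually_elim
    case (elim m)
    show ?case
    proof (intro allI impI)
      fix \<phi> and G :: "'a \<Rightarrow> 'a"
      assume c1: "c1_in_box R \<phi> G" and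
        z: "\<forall>k\<in>grid_index m. \<forall>x\<in>grid_segment (R / m) (min l R / (3 * real m) ^ DIM('a)) i k. \<phi> x = 0"
      note [measurable] = c1_in_boxD(6,7)[OF c1] h(1)
      let ?Y = "\<integral>\<^sup>+z. ennreal (norm (G z) powr p) \<partial>lborel"
      have P: "(\<integral>\<^sup>+y. ennreal \<bar>\<phi> y\<bar> \<partial>lborel) \<le> ennreal \<mu> * ?Y + ennreal \<mu>"
        using elim c1_in_boxD(1-3)[OF c1] z by blast
      have "(\<integral>\<^sup>+x. ennreal (g x * \<bar>\<phi> x\<bar>) \<partial>lborel) \<le> (\<integral>\<^sup>+x. ennreal (h x * \<bar>\<phi> x\<bar>) + ennreal (real M) * ennreal \<bar>\<phi> x\<bar> \<partial>lborel)"
        using g0 by (intro nn_integral_mono)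
          (auto simp: h_def not_less mult_right_mono simp flip: ennreal_mult intro!: ennreal_leI)
      also have "\<dots> = (\<integral>\<^sup>+x. ennreal (h x * \<bar>\<phi> x\<bar>) \<partial>lborel) + ennreal (real M) * (\<integral>\<^sup>+y. ennreal \<bar>\<phi> y\<bar> \<partial>lborel)"
        by (simp add: nn_integral_add nn_integral_cmult)
      also have "\<dots> \<le> ennreal (\<eta> / 2) * (?Y + 1) + ennreal (real M) * (ennreal \<mu> * ?Y + ennreal \<mu>)"
        by (intro add_mono mult_left_mono P order_trans[OF bound[OF h c1]] mult_right_mono hA) auto
      also have "ennreal (real M) * (ennreal \<mu> * ?Y + ennreal \<mu>) = ennreal (real M * \<mu>) * (?Y + 1)"
        using \<mu>(1) by (simp add: ennreal_mult distrib_left mult_ac)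
      also have "\<dots> \<le> ennreal (\<eta> / 2) * (?Y + 1)"
        using \<mu>(2) by (intro mult_right_mono ennreal_leI) auto
      also have "ennreal (\<eta> / 2) * (?Y + 1) + ennreal (\<eta> / 2) * (?Y + 1) = ennreal \<eta> * ?Y + ennreal \<eta>"
      proof -
        have "ennreal (\<eta> / 2) + ennreal (\<eta> / 2) = ennreal \<eta>"
          using \<eta> by (simp flip: ennreal_plus)
        then show ?thesis by (simp flip: distrib_right) (simp add: distrib_left)
      qed
      finally show "(\<integral>\<^sup>+x. ennreal (g x * \<bar>\<phi> x\<bar>) \<partial>lborel) \<le> ennreal \<eta> * ?Y + ennreal \<eta>"
        by (simp add: add_mono)
    qed
  qed
qed

section \<open>Test functions and the zero-trace Sobolev space\<close>

text \<open>Off the closed support \<phi> is zero in a neighbourhood, hence so is its gradient.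
  Continuity of \<open>G\<close> comes from the existence of second derivatives.\<close>

lemma test_function_gradient:
  fixes \<phi> :: "'a::euclidean_space \<Rightarrow> real"
  assumes \<phi>: "\<phi> \<in> test_functions U" and der: "\<And>x. (\<phi> has_derivative (\<lambda>h. G x \<bullet> h)) (at x)"
  shows "continuous_on UNIV G" "\<And>x. x \<notin> U \<Longrightarrow> \<phi> x = 0" "\<And>x. x \<notin> U \<Longrightarrow> G x = 0"
proof -
  obtain D where D0: "\<And>x. D 0 x [] = \<phi> x" and
    D: "\<And>k x vs. length vs = k \<Longrightarrow> ((\<lambda>y. D k y vs) has_derivative (\<lambda>h. D (Suc k) x (h # vs))) (at x)"
    using \<phi> unfolding test_functions_def smooth_fun_def by blast
  have G: "G x \<bullet> h = D (Suc 0) x [h]" for x h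
    using has_derivative_unique[OF der[of x], of "\<lambda>h. D (Suc 0) x [h]"] D[of "[]" 0 x] by (simp add: D0 fun_eq_iff)
  have "continuous_on UNIV (\<lambda>x. G x \<bullet> b)" for b
    unfolding G using has_derivative_continuous[OF D[of "[b]" "Suc 0"]]
    by (intro continuous_at_imp_continuous_on) auto
  then show "continuous_on UNIV G" by (subst continuous_on_componentwise) auto
  let ?S = "closure {x. \<phi> x \<noteq> 0}"
  have SU: "?S \<subseteq> U" using \<phi> by (simp add: test_functions_def)
  then show "x \<notin> U \<Longrightarrow> \<phi> x = 0" for x using closure_subset[of "{x. \<phi> x \<noteq> 0}"] by blast
  show "G x = 0" if "x \<notin> U" for x
  proof -
    have x: "x \<in> - ?S" using SU that by blast
    have "(\<phi> has_derivative (\<lambda>h. 0)) (at x)"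
    proof (rule has_derivative_transform_within_open[of "\<lambda>_. 0" _ _ UNIV "- ?S"])
      fix y assume "y \<in> - ?S"
      then have "y \<notin> {x. \<phi> x \<noteq> 0}" using closure_subset[of "{x. \<phi> x \<noteq> 0}"] by blast
      then show "0 = \<phi> y" by simp
    qed (use x in auto)
    from has_derivative_unique[OF der this] have "G x \<bullet> G x = 0" by (simp add: fun_eq_iff)
    then show ?thesis by simp
  qed
qed

lemma test_function_c1_in_box:
  assumes "\<phi> \<in> test_functions U" "\<And>x. (\<phi> has_derivative (\<lambda>h. G x \<bullet> h)) (at x)"
    and "\<And>x. x \<in> U \<Longrightarrow> \<forall>b\<in>Basis. \<bar>x \<bullet> b\<bar> < R"
  shows "c1_in_box R \<phi> G"
  unfolding c1_in_box_def using assms test_function_gradient[OF assms(1,2)] by blast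

lemma powr_add_le:
  fixes a b p :: real
  assumes "a \<ge> 0" "b \<ge> 0" "p > 0"
  shows "(a + b) powr p \<le> 2 powr p * (a powr p + b powr p)"
proof -
  have "(a + b) powr p \<le> (2 * max a b) powr p" using assms by (intro powr_mono2) auto
  also have "\<dots> = 2 powr p * max a b powr p" using assms by (simp add: powr_mult)
  also have "max a b powr p \<le> a powr p + b powr p" by (simp add: max_def)
  finally show ?thesis by (simp add: mult_left_mono)
qed

lemma nn_integral_powr_norm_le:
  fixes G g :: "'a::euclidean_space \<Rightarrow> 'a"
  assumes [measurable]: "G \<in> borel_measurable lebesgue" "g \<in> borel_measurable lebesgue" "A \<in> sets lebesgue"
    and p: "p > 0"
  shows "(\<integral>\<^sup>+x. ennreal (norm (G x) powr p) * indicator A x \<partial>lebesgue)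
    \<le> ennreal (2 powr p) * ((\<integral>\<^sup>+x. ennreal (norm (g x) powr p) * indicator A x \<partial>lebesgue)
        + (\<integral>\<^sup>+x. ennreal (norm (G x - g x) powr p) \<partial>lebesgue))"
proof -
  have "ennreal (norm (G x) powr p) \<le> ennreal (2 powr p) * (ennreal (norm (g x) powr p) + ennreal (norm (G x - g x) powr p))" for x
  proof -
    have "norm (G x) powr p \<le> (norm (g x) + norm (G x - g x)) powr p"
      using p norm_triangle_sub[of "G x" "g x"] by (intro powr_mono2) auto
    also have "\<dots> \<le> 2 powr p * (norm (g x) powr p + norm (G x - g x) powr p)"
      using p by (intro powr_add_le) auto
    finally show ?thesis by (simp add: ennreal_leI flip: ennreal_plus ennreal_mult)
  qed
  then have "(\<integral>\<^sup>+x. ennreal (norm (G x) powr p) * indicator A x \<partial>lebesgue) \<le>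
    (\<integral>\<^sup>+x. ennreal (2 powr p) * (ennreal (norm (g x) powr p) * indicator A x + ennreal (norm (G x - g x) powr p)) \<partial>lebesgue)"
    by (intro nn_integral_mono) (auto simp: indicator_def)
  also have "\<dots> = ennreal (2 powr p) * ((\<integral>\<^sup>+x. ennreal (norm (g x) powr p) * indicator A x \<partial>lebesgue)
        + (\<integral>\<^sup>+x. ennreal (norm (G x - g x) powr p) \<partial>lebesgue))"
    by (simp add: nn_integral_cmult nn_integral_add)
  finally show ?thesis .
qed

lemma nn_integral_powr_AE_subseq:
  fixes u :: "nat \<Rightarrow> 'a \<Rightarrow> real"
  assumes [measurable]: "\<And>k. u k \<in> borel_measurable M" and p: "p > 0"
    and fin: "\<And>k. (\<integral>\<^sup>+x. ennreal (\<bar>u k x\<bar> powr p) \<partial>M) < top"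
    and lim: "(\<lambda>k. \<integral>\<^sup>+x. ennreal (\<bar>u k x\<bar> powr p) \<partial>M) \<longlonglongrightarrow> 0"
  shows "\<exists>r::nat\<Rightarrow>nat. strict_mono r \<and> (AE x in M. (\<lambda>k. u (r k) x) \<longlonglongrightarrow> 0)"
proof -
  have int: "integrable M (\<lambda>x. \<bar>u k x\<bar> powr p)" for k
    using fin[of k] by (intro integrableI_bounded) auto
  have "(\<lambda>k. enn2real (\<integral>\<^sup>+x. ennreal (\<bar>u k x\<bar> powr p) \<partial>M)) \<longlonglongrightarrow> 0"
    by (rule tendsto_enn2real) (use lim in auto)
  then have "(\<lambda>k. (\<integral>x. norm (\<bar>u k x\<bar> powr p) \<partial>M)) \<longlonglongrightarrow> 0"
    by (simp add: integral_eq_nn_integral)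
  from tendsto_L1_AE_subseq[OF int this] obtain r :: "nat \<Rightarrow> nat" where r: "strict_mono r"
    and ae: "AE x in M. (\<lambda>k. \<bar>u (r k) x\<bar> powr p) \<longlonglongrightarrow> 0" by blast
  from ae have "AE x in M. (\<lambda>k. u (r k) x) \<longlonglongrightarrow> 0"
  proof eventually_elim
    case (elim x)
    have "(\<lambda>k. (\<bar>u (r k) x\<bar> powr p) powr (1 / p)) \<longlonglongrightarrow> 0 powr (1 / p)"
      using p by (intro tendsto_powr' elim tendsto_const) auto
    then show ?case using p by (simp add: powr_powr tendsto_rabs_zero_iff)
  qed
  with r show ?thesis by blast
qed

text \<open>Carries a bound from test functions to their closure. Convergence is in L^p while h is
  merely measurable, so the integral of h |\<phi>_k| need not converge; an almost everywhere
  convergent subsequence and Fatou's lemma suffice for an upper bound. Estimating |G_k|^p by |g|^p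
  costs the factor 2^p.\<close>

lemma sobolev0_bound:
  fixes u :: "'a::euclidean_space \<Rightarrow> real" and g :: "'a \<Rightarrow> 'a"
  assumes sob: "sobolev0 p U u g" and p: "p > 1"
    and box: "\<And>x. x \<in> U \<Longrightarrow> \<forall>b\<in>Basis. \<bar>x \<bullet> b\<bar> < R"
    and \<Omega>: "U \<subseteq> \<Omega>" "\<Omega> \<in> sets lebesgue"
    and h[measurable]: "h \<in> borel_measurable lebesgue" and h0: "\<And>x. h x \<ge> 0" and a: "a \<ge> 0"
    and bound: "\<And>\<phi> G. \<phi> \<in> test_functions U \<Longrightarrow> (\<And>x. (\<phi> has_derivative (\<lambda>h. G x \<bullet> h)) (at x)) \<Longrightarrow>
      (\<integral>\<^sup>+x. ennreal (h x * \<bar>\<phi> x\<bar>) \<partial>lebesgue) \<le> ennreal a * (\<integral>\<^sup>+z. ennreal (norm (G z) powr p) \<partial>lborel) + B"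
  shows "(\<integral>\<^sup>+x. ennreal (norm (g x) powr p) * indicator \<Omega> x \<partial>lebesgue) < top"
    and "(\<integral>\<^sup>+x. ennreal (h x * \<bar>u x\<bar>) \<partial>lebesgue) \<le>
      ennreal (a * 2 powr p) * (\<integral>\<^sup>+x. ennreal (norm (g x) powr p) * indicator \<Omega> x \<partial>lebesgue) + B"
proof -
  note [measurable] = \<Omega>(2)
  from sob obtain \<phi>' G' where u[measurable]: "u \<in> borel_measurable lebesgue" and g[measurable]: "g \<in> borel_measurable lebesgue"
    and t': "\<And>k. \<phi>' k \<in> test_functions U" and d': "\<And>k x. (\<phi>' k has_derivative (\<lambda>h. G' k x \<bullet> h)) (at x)"
    and l1: "(\<lambda>k. \<integral>\<^sup>+ x. ennreal (\<bar>\<phi>' k x - u x\<bar> powr p) \<partial>lebesgue) \<longlonglongrightarrow> 0"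
    and l2: "(\<lambda>k. \<integral>\<^sup>+ x. ennreal (norm (G' k x - g x) powr p) \<partial>lebesgue) \<longlonglongrightarrow> 0"
    unfolding sobolev0_def by blast
  \<comment> \<open>Convergence to 0 in [0, \<infinity>] forces finiteness only from some index on,
    so the sequence is shifted by K.\<close>
  have "\<forall>\<^sub>F k in sequentially. (\<integral>\<^sup>+ x. ennreal (\<bar>\<phi>' k x - u x\<bar> powr p) \<partial>lebesgue) < 1 \<and>
      (\<integral>\<^sup>+ x. ennreal (norm (G' k x - g x) powr p) \<partial>lebesgue) < 1"
    by (intro eventually_conj order_tendstoD(2)[OF l1] order_tendstoD(2)[OF l2]) auto
  then obtain K where K: "\<And>k. k \<ge> K \<Longrightarrow> (\<integral>\<^sup>+ x. ennreal (\<bar>\<phi>' k x - u x\<bar> powr p) \<partial>lebesgue) < 1 \<and>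
      (\<integral>\<^sup>+ x. ennreal (norm (G' k x - g x) powr p) \<partial>lebesgue) < 1"
    unfolding eventually_sequentially by blast
  define \<phi> where "\<phi> k = \<phi>' (k + K)" for k
  define G where "G k = G' (k + K)" for k
  have t: "\<And>k. \<phi> k \<in> test_functions U" and d: "\<And>k x. (\<phi> k has_derivative (\<lambda>h. G k x \<bullet> h)) (at x)"
    using t' d' by (auto simp: \<phi>_def G_def)
  have L1: "(\<lambda>k. \<integral>\<^sup>+ x. ennreal (\<bar>\<phi> k x - u x\<bar> powr p) \<partial>lebesgue) \<longlonglongrightarrow> 0"
    and L2: "(\<lambda>k. \<integral>\<^sup>+ x. ennreal (norm (G k x - g x) powr p) \<partial>lebesgue) \<longlonglongrightarrow> 0"
    unfolding \<phi>_def G_def by (rule LIMSEQ_ignore_initial_segment[OF l1], rule LIMSEQ_ignore_initial_segment[OF l2])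
  have F1: "(\<integral>\<^sup>+ x. ennreal (\<bar>\<phi> k x - u x\<bar> powr p) \<partial>lebesgue) < top" and F2: "(\<integral>\<^sup>+ x. ennreal (norm (G k x - g x) powr p) \<partial>lebesgue) < top" for k
    using K[of "k + K"] by (auto simp: \<phi>_def G_def intro: less_trans[OF _ ennreal_one_less_top])
  have c1: "c1_in_box R (\<phi> k) (G k)" for k
    by (rule test_function_c1_in_box[OF t d box])
  have \<phi>m[measurable]: "\<phi> k \<in> borel_measurable lebesgue" and Gm[measurable]: "G k \<in> borel_measurable lebesgue" for k
    using c1_in_boxD(6,7)[OF c1[of k]] by (auto intro: measurable_completion)
  let ?Y = "\<integral>\<^sup>+x. ennreal (norm (g x) powr p) * indicator \<Omega> x \<partial>lebesgue"
  let ?e = "\<lambda>k. \<integral>\<^sup>+ x. ennreal (norm (G k x - g x) powr p) \<partial>lebesgue"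
  \<comment> \<open>The energy integrates the gradient over \<Omega> only; for test functions this
    loses nothing, as \<open>G k\<close> vanishes off \<open>U\<close>.\<close>
  have GY: "(\<integral>\<^sup>+z. ennreal (norm (G k z) powr p) \<partial>lborel) = (\<integral>\<^sup>+x. ennreal (norm (G k x) powr p) * indicator \<Omega> x \<partial>lebesgue)" for k
    unfolding nn_integral_completion using test_function_gradient(3)[OF t d] \<Omega>(1) p
    by (intro nn_integral_cong) (auto simp: indicator_def)
  show "?Y < top"
  proof -
    have "?Y \<le> ennreal (2 powr p) * ((\<integral>\<^sup>+x. ennreal (norm (G 0 x) powr p) * indicator \<Omega> x \<partial>lebesgue) + (\<integral>\<^sup>+x. ennreal (norm (g x - G 0 x) powr p) \<partial>lebesgue))"
      using p by (intro nn_integral_powr_norm_le) auto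
    also have "(\<integral>\<^sup>+x. ennreal (norm (G 0 x) powr p) * indicator \<Omega> x \<partial>lebesgue) = (\<integral>\<^sup>+z. ennreal (\<bar>norm (G 0 z)\<bar> powr p) \<partial>lborel)"
      unfolding GY[symmetric] by simp
    also have "ennreal (2 powr p) * (\<dots> + (\<integral>\<^sup>+x. ennreal (norm (g x - G 0 x) powr p) \<partial>lebesgue)) < top"
    proof -
      have "(\<integral>\<^sup>+z. ennreal (\<bar>norm (G 0 z)\<bar> powr p) \<partial>lborel) < \<infinity>"
        using p c1_in_boxD(4)[OF c1[of 0]]
        by (intro nn_integral_abs_powr_finite continuous_on_norm c1_in_boxD(2)[OF c1]) auto
      then show ?thesis using F2[of 0] by (auto simp: ennreal_mult_less_top norm_minus_commute)
    qed
    finally show ?thesis .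
  qed
  from nn_integral_powr_AE_subseq[OF _ _ F1 L1] p obtain r :: "nat \<Rightarrow> nat"
    where r: "strict_mono r" and ae: "AE x in lebesgue. (\<lambda>k. \<phi> (r k) x - u x) \<longlonglongrightarrow> 0"
    by auto
  have "(\<integral>\<^sup>+x. ennreal (h x * \<bar>u x\<bar>) \<partial>lebesgue) = (\<integral>\<^sup>+x. liminf (\<lambda>k. ennreal (h x * \<bar>\<phi> (r k) x\<bar>)) \<partial>lebesgue)"
    using ae
  proof (intro nn_integral_cong_AE, eventually_elim)
    case (elim x)
    have "(\<lambda>k. ennreal (h x * \<bar>\<phi> (r k) x\<bar>)) \<longlonglongrightarrow> ennreal (h x * \<bar>u x\<bar>)"
      using elim by (intro tendsto_ennrealI tendsto_intros) (simp add: LIM_zero_iff)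
    then show ?case by (simp add: lim_imp_Liminf)
  qed
  also have "\<dots> \<le> liminf (\<lambda>k. \<integral>\<^sup>+x. ennreal (h x * \<bar>\<phi> (r k) x\<bar>) \<partial>lebesgue)"
    by (rule nn_integral_liminf) measurable
  also have "\<dots> \<le> liminf (\<lambda>k. ennreal a * (ennreal (2 powr p) * (?Y + ?e (r k))) + B)"
  proof (intro Liminf_mono always_eventually allI)
    fix k
    have "(\<integral>\<^sup>+x. ennreal (h x * \<bar>\<phi> (r k) x\<bar>) \<partial>lebesgue) \<le> ennreal a * (\<integral>\<^sup>+z. ennreal (norm (G (r k) z) powr p) \<partial>lborel) + B"
      by (rule bound[OF t d])
    also have "\<dots> \<le> ennreal a * (ennreal (2 powr p) * (?Y + ?e (r k))) + B"
      unfolding GY using p by (intro add_right_mono mult_left_mono nn_integral_powr_norm_le) auto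
    finally show "(\<integral>\<^sup>+x. ennreal (h x * \<bar>\<phi> (r k) x\<bar>) \<partial>lebesgue) \<le> ennreal a * (ennreal (2 powr p) * (?Y + ?e (r k))) + B" .
  qed
  also have "\<dots> = ennreal a * (ennreal (2 powr p) * (?Y + 0)) + B"
  proof (rule lim_imp_Liminf)
    show "(\<lambda>k. ennreal a * (ennreal (2 powr p) * (?Y + ?e (r k))) + B) \<longlonglongrightarrow> ennreal a * (ennreal (2 powr p) * (?Y + 0)) + B"
      by (intro tendsto_add tendsto_const ennreal_tendsto_cmult LIMSEQ_subseq_LIMSEQ[OF L2 r, unfolded comp_def]) auto
  qed simp
  also have "\<dots> = ennreal (a * 2 powr p) * ?Y + B"
    using a by (simp add: ennreal_mult mult.assoc)
  finally show "(\<integral>\<^sup>+x. ennreal (h x * \<bar>u x\<bar>) \<partial>lebesgue) \<le> ennreal (a * 2 powr p) * ?Y + B" .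
qed

section \<open>One-dimensional Hausdorff measure\<close>

text \<open>Covers are indexed by all naturals; the surplus indices receive the empty set, whose
  diameter is 0.\<close>

lemma hausdorff_pre1_le_finite:
  fixes A :: "'i \<Rightarrow> 'a::metric_space set"
  assumes I: "finite I" and S: "S \<subseteq> (\<Union>i\<in>I. A i)" and \<delta>: "\<delta> \<ge> 0"
    and A: "\<And>i. i \<in> I \<Longrightarrow> bounded (A i) \<and> diameter (A i) \<le> \<delta>"
  shows "hausdorff_pre1 \<delta> S \<le> (\<Sum>i\<in>I. ennreal (diameter (A i)))"
proof -
  obtain h where h: "bij_betw h {0..<card I} I" using ex_bij_betw_nat_finite[OF I] by blast
  define C where "C n = (if n < card I then A (h n) else {})" for n
  have hI: "n < card I \<Longrightarrow> h n \<in> I" for n using bij_betwE[OF h] by simp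
  have "S \<subseteq> (\<Union>n. C n)"
  proof
    fix x assume "x \<in> S"
    then obtain i where i: "i \<in> I" "x \<in> A i" using S by blast
    from i(1) have "i \<in> h ` {0..<card I}" using bij_betw_imp_surj_on[OF h] by simp
    then obtain n where "n < card I" "i = h n" by auto
    then show "x \<in> (\<Union>n. C n)" using i by (auto simp: C_def intro!: exI[of _ n])
  qed
  moreover have "bounded (C n) \<and> diameter (C n) \<le> \<delta>" for n
    using A[OF hI] \<delta> by (auto simp: C_def)
  ultimately have "hausdorff_pre1 \<delta> S \<le> (\<Sum>n. ennreal (diameter (C n)))"
    unfolding hausdorff_pre1_def by (intro INF_lower) auto
  also have "\<dots> = (\<Sum>n\<in>{0..<card I}. ennreal (diameter (C n)))"
    by (rule suminf_finite) (auto simp: C_def)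
  also have "\<dots> = (\<Sum>n\<in>{0..<card I}. ennreal (diameter (A (h n))))"
    by (intro sum.cong) (auto simp: C_def)
  also have "\<dots> = (\<Sum>i\<in>I. ennreal (diameter (A i)))"
    by (rule sum.reindex_bij_betw[OF h])
  finally show ?thesis .
qed

text \<open>Cutting every segment into n pieces of length d / n \<le> \<delta> leaves the total
  length unchanged, so the bound does not depend on \<delta>.\<close>

lemma hausdorff1_segments_le:
  fixes c :: "'k \<Rightarrow> 'a::euclidean_space"
  assumes K: "finite K" and i: "norm i = 1" and d: "d > 0"
    and S: "S \<subseteq> (\<Union>k\<in>K. (\<lambda>\<sigma>. c k + \<sigma> *\<^sub>R i) ` {0..d})"
  shows "hausdorff1 S \<le> ennreal (real (card K) * d)"
  unfolding hausdorff1_def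
proof (rule SUP_least)
  fix \<delta> :: real assume "\<delta> \<in> {0<..}"
  then have \<delta>: "\<delta> > 0" by simp
  obtain n :: nat where n: "d / \<delta> < real n" using reals_Archimedean2 by blast
  moreover have "d / \<delta> > 0" using d \<delta> by simp
  ultimately have n0: "n > 0" by (cases n) auto
  have dn: "d / real n \<le> \<delta>" using n \<delta> n0 by (simp add: field_simps)
  let ?A = "\<lambda>(k, j). (\<lambda>\<sigma>. c k + \<sigma> *\<^sub>R i) ` {real j * (d / n)..real (Suc j) * (d / n)}"
  have dA: "bounded (?A z) \<and> diameter (?A z) \<le> d / n" for z
  proof -
    obtain k j where z: "z = (k, j)" by (cases z)
    have "compact (?A z)" unfolding z
      by (auto intro!: compact_continuous_image continuous_intros)
    moreover have "diameter (?A z) \<le> d / n"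
    proof (rule diameter_le)
      fix x y assume "x \<in> ?A z" "y \<in> ?A z"
      then have xy: "x \<in> (\<lambda>\<sigma>. c k + \<sigma> *\<^sub>R i) ` {real j * (d / n)..real (Suc j) * (d / n)}"
        "y \<in> (\<lambda>\<sigma>. c k + \<sigma> *\<^sub>R i) ` {real j * (d / n)..real (Suc j) * (d / n)}"
        by (simp_all only: z prod.case)
      from xy(1) obtain s where s: "x = c k + s *\<^sub>R i" "s \<in> {real j * (d / n)..real (Suc j) * (d / n)}"
        by (rule imageE)
      from xy(2) obtain t where t: "y = c k + t *\<^sub>R i" "t \<in> {real j * (d / n)..real (Suc j) * (d / n)}"
        by (rule imageE)
      have "x - y = (s - t) *\<^sub>R i" using s t by (simp add: scaleR_diff_left)
      then have "norm (x - y) = \<bar>s - t\<bar>" using i by simp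
      also have "real (Suc j) * (d / n) = real j * (d / n) + d / n" by (simp add: distrib_right add_divide_distrib)
      then have "\<bar>s - t\<bar> \<le> d / n" using s(2) t(2) unfolding atLeastAtMost_iff by linarith
      finally show "norm (x - y) \<le> d / n" .
    qed (use d in simp)
    ultimately show ?thesis by (simp add: compact_imp_bounded)
  qed
  have "hausdorff_pre1 \<delta> S \<le> (\<Sum>z\<in>K \<times> {..<n}. ennreal (diameter (?A z)))"
  proof (rule hausdorff_pre1_le_finite)
    show "finite (K \<times> {..<n})" using K by simp
    show "S \<subseteq> (\<Union>z\<in>K \<times> {..<n}. ?A z)"
    proof
      fix x assume "x \<in> S"
      then have "x \<in> (\<Union>k\<in>K. (\<lambda>\<sigma>. c k + \<sigma> *\<^sub>R i) ` {0..d})" using S by (rule subsetD[rotated])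
      then obtain k where kK: "k \<in> K" and "x \<in> (\<lambda>\<sigma>. c k + \<sigma> *\<^sub>R i) ` {0..d}" by (rule UN_E)
      from this(2) obtain \<sigma> where "x = c k + \<sigma> *\<^sub>R i" "\<sigma> \<in> {0..d}" by (rule imageE)
      with kK have k: "k \<in> K" "0 \<le> \<sigma>" "\<sigma> \<le> d" "x = c k + \<sigma> *\<^sub>R i" by simp_all
      define e where "e = d / real n"
      have e: "e > 0" "d = real n * e" using d n0 by (auto simp: e_def)
      obtain j where j: "j < n" "real j * e \<le> \<sigma>" "\<sigma> \<le> real (Suc j) * e"
      \<comment> \<open>Rounding down would give the right endpoint the index n; it belongs to the
        last piece, n - 1.\<close>
      proof (cases "\<sigma> = d")
        case True
        then show ?thesis using that[of "n - 1"] n0 e by (simp add: of_nat_diff mult_right_mono)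
      next
        case False
        then have \<sigma>: "\<sigma> < real n * e" using k e by simp
        define j where "j = nat \<lfloor>\<sigma> / e\<rfloor>"
        have q: "\<sigma> / e \<ge> 0" "\<sigma> / e < real n" using k e \<sigma> by (auto simp: divide_less_eq)
        then have "real j \<le> \<sigma> / e" "\<sigma> / e < real j + 1" unfolding j_def by linarith+
        moreover have "j < n" using q unfolding j_def by linarith
        ultimately show ?thesis using that[of j] e by (simp add: pos_le_divide_eq pos_divide_less_eq distrib_right add.commute)
      qed
      show "x \<in> (\<Union>z\<in>K \<times> {..<n}. ?A z)"
        by (rule UN_I[of "(k, j)"]) (use k j in \<open>auto simp: e_def\<close>)
    qed
  qed (use \<delta> dA dn in \<open>auto intro: order_trans\<close>)
  also have "\<dots> \<le> (\<Sum>z\<in>K \<times> {..<n}. ennreal (d / n))"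
    using dA by (intro sum_mono ennreal_leI) blast
  also have "\<dots> = ennreal (real (card K) * d)"
    using d n0 by (simp add: card_cartesian_product ennreal_of_nat_eq_real_of_nat flip: ennreal_mult)
  finally show "hausdorff_pre1 \<delta> S \<le> ennreal (real (card K) * d)" .
qed

text \<open>Projection to coordinate i does not increase distances, so each covering set projects
  into an interval whose radius is its diameter, around a chosen point. This costs a factor 2, hence
  the lower bound d / 2; only positivity matters.\<close>

lemma hausdorff1_segment_pos:
  fixes c :: "'a::euclidean_space"
  assumes i: "i \<in> Basis" and d: "d > 0" and S: "(\<lambda>\<sigma>. c + \<sigma> *\<^sub>R i) ` {0..d} \<subseteq> S"
  shows "hausdorff1 S > 0"
proof -
  have "ennreal (d / 2) \<le> hausdorff_pre1 1 S"
    unfolding hausdorff_pre1_def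
  proof (rule INF_greatest)
    fix C :: "nat \<Rightarrow> 'a set"
    assume "C \<in> {C. S \<subseteq> (\<Union>i. C i) \<and> (\<forall>i. bounded (C i) \<and> diameter (C i) \<le> 1)}"
    then have C: "S \<subseteq> (\<Union>n. C n)" "\<And>n. bounded (C n)" by auto
    \<comment> \<open>For an empty \<open>C n\<close> the choice is arbitrary; the diameter is 0, so
      \<open>J n\<close> is a single point and adds no length.\<close>
    define x where "x n = (SOME y. y \<in> C n)" for n
    define J where "J n = {x n \<bullet> i - diameter (C n)..x n \<bullet> i + diameter (C n)}" for n
    have dm: "diameter (C n) \<ge> 0" for n using diameter_ge_0[OF C(2)] .
    have "{c \<bullet> i..c \<bullet> i + d} \<subseteq> (\<Union>n. J n)"
    proof
      fix t assume t: "t \<in> {c \<bullet> i..c \<bullet> i + d}"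
      let ?y = "c + (t - c \<bullet> i) *\<^sub>R i"
      have "?y \<in> S" using S t by force
      then obtain n where n: "?y \<in> C n" using C by blast
      then have "x n \<in> C n" unfolding x_def by (rule someI)
      then have "norm (?y - x n) \<le> diameter (C n)"
        using diameter_bounded_bound[OF C(2) n] by (simp add: dist_norm)
      then have "\<bar>(?y - x n) \<bullet> i\<bar> \<le> diameter (C n)" using Basis_le_norm[OF i] order_trans by blast
      moreover have "?y \<bullet> i = t" using i by (simp add: inner_add_left)
      ultimately have "t \<in> J n" by (auto simp: J_def inner_diff_left abs_le_iff)
      then show "t \<in> (\<Union>n. J n)" by blast
    qed
    then have "emeasure lborel {c \<bullet> i..c \<bullet> i + d} \<le> emeasure lborel (\<Union>n. J n)"
      by (intro emeasure_mono) (auto simp: J_def)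
    also have "\<dots> \<le> (\<Sum>n. emeasure lborel (J n))"
      by (intro emeasure_subadditive_countably) (auto simp: J_def)
    also have "\<dots> = (\<Sum>n. 2 * ennreal (diameter (C n)))"
    proof (intro suminf_cong)
      fix n
      have "emeasure lborel (J n) = ennreal (2 * diameter (C n))" using dm by (simp add: J_def)
      then show "emeasure lborel (J n) = 2 * ennreal (diameter (C n))" using dm by (simp add: ennreal_mult)
    qed
    also have "\<dots> = 2 * (\<Sum>n. ennreal (diameter (C n)))" by (rule ennreal_suminf_cmult)
    finally have "ennreal d \<le> 2 * (\<Sum>n. ennreal (diameter (C n)))" using d by simp
    moreover have "ennreal d = 2 * ennreal (d / 2)"
      using d by (simp add: ennreal_mult[symmetric] flip: ennreal_numeral)
    ultimately show "ennreal (d / 2) \<le> (\<Sum>n. ennreal (diameter (C n)))"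
      by (simp add: ennreal_mult_le_mult_iff)
  qed
  also have "\<dots> \<le> hausdorff1 S" unfolding hausdorff1_def by (rule SUP_upper) simp
  finally show ?thesis using d by (auto intro: less_le_trans[of 0 "ennreal (d / 2)"])
qed

text \<open>A set of diameter d \<le> \<delta> \<le> 1 lies in a cube of volume (2 d)^N \<le> 2^N
  \<delta> d, where N \<ge> 2 supplies the spare factor d \<le> \<delta>. Summation gives a bound
  proportional to \<delta>.\<close>

lemma hausdorff1_finite_null:
  fixes S :: "'a::euclidean_space set"
  assumes N: "DIM('a) \<ge> 2" and S: "closed S" and L: "hausdorff1 S \<le> ennreal L" "L > 0"
  shows "S \<in> null_sets lborel"
proof -
  have le: "emeasure lborel S \<le> ennreal (2 ^ DIM('a) * (L + 1) * \<delta>)" if \<delta>: "0 < \<delta>" "\<delta> \<le> 1" for \<delta> :: real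
  proof -
    have "hausdorff_pre1 \<delta> S \<le> hausdorff1 S" unfolding hausdorff1_def using \<delta> by (intro SUP_upper) simp
    \<comment> \<open>The added 1 gives a strict inequality, from which a cover can be extracted
      although the infimum need not be attained.\<close>
    also have "\<dots> < ennreal (L + 1)" using L by (auto intro: le_less_trans[of _ "ennreal L"] simp: ennreal_less_iff)
    finally obtain C :: "nat \<Rightarrow> 'a set" where C: "S \<subseteq> (\<Union>n. C n)" "\<And>n. bounded (C n)" "\<And>n. diameter (C n) \<le> \<delta>"
      and sum: "(\<Sum>n. ennreal (diameter (C n))) < ennreal (L + 1)"
      unfolding hausdorff_pre1_def INF_less_iff by blast
    define x where "x n = (SOME y. y \<in> C n)" for n
    have dm: "diameter (C n) \<ge> 0" for n using diameter_ge_0[OF C(2)] .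
    define B where "B n = cbox (x n - diameter (C n) *\<^sub>R One) (x n + diameter (C n) *\<^sub>R One)" for n
    have "C n \<subseteq> B n" for n
    proof
      fix y assume y: "y \<in> C n"
      then have "x n \<in> C n" unfolding x_def by (rule someI)
      then have n: "norm (y - x n) \<le> diameter (C n)"
        using diameter_bounded_bound[OF C(2) y] by (simp add: dist_norm)
      have "\<bar>(y - x n) \<bullet> b\<bar> \<le> diameter (C n)" if "b \<in> Basis" for b
        using Basis_le_norm[OF that, of "y - x n"] n by linarith
      then have "x n \<bullet> b - diameter (C n) \<le> y \<bullet> b \<and> y \<bullet> b \<le> x n \<bullet> b + diameter (C n)" if "b \<in> Basis" for b
        using that unfolding inner_diff_left by (smt (verit))
      then show "y \<in> B n"
        by (simp add: B_def mem_box inner_diff_left inner_add_left)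
    qed
    then have "(\<Union>n. C n) \<subseteq> (\<Union>n. B n)" by (intro UN_mono) auto
    with C(1) have "S \<subseteq> (\<Union>n. B n)" by (rule order_trans)
    then have "emeasure lborel S \<le> emeasure lborel (\<Union>n. B n)"
      by (rule emeasure_mono) (simp add: B_def)
    also have "\<dots> \<le> (\<Sum>n. emeasure lborel (B n))"
      by (intro emeasure_subadditive_countably) (auto simp: B_def)
    also have "\<dots> \<le> (\<Sum>n. ennreal (2 ^ DIM('a) * \<delta>) * ennreal (diameter (C n)))"
    proof (intro suminf_le summableI)
      fix n
      let ?d = "diameter (C n)"
      obtain k where k: "DIM('a) = Suc (Suc k)" using N le_Suc_ex[of 2 "DIM('a)"] by auto
      have "(\<Prod>b\<in>(Basis::'a set). (x n + ?d *\<^sub>R One - (x n - ?d *\<^sub>R One)) \<bullet> b) = (\<Prod>b\<in>(Basis::'a set). 2 * ?d)"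
        by (intro prod.cong refl) (simp add: inner_add_left inner_diff_left)
      then have "emeasure lborel (B n) = ennreal ((2 * ?d) ^ DIM('a))"
        unfolding B_def using dm[of n] by (subst emeasure_lborel_cbox) (auto simp: inner_add_left inner_diff_left)
      also have "(2 * ?d) ^ DIM('a) \<le> 2 ^ DIM('a) * \<delta> * ?d"
      proof -
        have "?d ^ k \<le> 1" using dm[of n] C(3)[of n] \<delta> by (intro power_le_one) auto
        then have "?d * ?d ^ k \<le> \<delta> * 1" using dm[of n] C(3)[of n] \<delta> by (intro mult_mono) auto
        then have "(?d * ?d ^ k) * ?d \<le> \<delta> * ?d" using dm[of n] by (intro mult_right_mono) auto
        then have "?d ^ DIM('a) \<le> \<delta> * ?d" unfolding k by (simp add: mult_ac)
        then show ?thesis by (simp add: power_mult_distrib mult_left_mono mult.assoc)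
      qed
      also have "ennreal (2 ^ DIM('a) * \<delta> * ?d) = ennreal (2 ^ DIM('a) * \<delta>) * ennreal ?d"
        using dm[of n] \<delta> by (intro ennreal_mult) auto
      finally show "emeasure lborel (B n) \<le> ennreal (2 ^ DIM('a) * \<delta>) * ennreal ?d" by (simp add: ennreal_leI)
    qed
    also have "\<dots> = ennreal (2 ^ DIM('a) * \<delta>) * (\<Sum>n. ennreal (diameter (C n)))"
      by (rule ennreal_suminf_cmult)
    also have "\<dots> \<le> ennreal (2 ^ DIM('a) * \<delta>) * ennreal (L + 1)"
      using sum by (intro mult_left_mono) auto
    also have "\<dots> = ennreal (2 ^ DIM('a) * (L + 1) * \<delta>)"
      using \<delta> L by (simp add: ennreal_mult[symmetric] mult_ac del: ennreal_plus)
    finally show ?thesis .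
  qed
  have "emeasure lborel S \<le> 0"
  proof (rule ennreal_le_epsilon)
    fix e :: real assume e: "e > 0"
    define M where "M = 2 ^ DIM('a) * (L + 1)"
    have M: "M > 0" using L by (simp add: M_def)
    have "emeasure lborel S \<le> ennreal (M * min 1 (e / M))"
      using le[of "min 1 (e / M)"] M e by (simp add: M_def)
    also have "M * min 1 (e / M) \<le> e" using M e by (auto simp: min_def field_simps)
    finally show "emeasure lborel S \<le> 0 + ennreal e" by (simp add: ennreal_leI)
  qed
  then show ?thesis using S by (auto simp: null_sets_def)
qed

section \<open>Smooth bump functions and the fundamental lemma\<close>

text \<open>The parameter m closes the family under differentiation, up to linear combinations; c is
  later sent to 0, so that products of these functions converge to indicators of boxes.\<close>

definition exp_bump :: "real \<Rightarrow> nat \<Rightarrow> real \<Rightarrow> real" where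
  "exp_bump c m t = (if t > 0 then (1 / t) ^ m * exp (- (c / t)) else 0)"

text \<open>With s = c / t, this is the decay of s^m / exp s at infinity.\<close>

lemma exp_bump_tendsto_0:
  assumes c: "c > 0"
  shows "(exp_bump c m \<longlongrightarrow> 0) (at 0)"
proof -
  have "((\<lambda>s::real. s ^ m / exp s) \<longlongrightarrow> 0) at_top" by (rule tendsto_power_div_exp_0)
  moreover have "filterlim (\<lambda>t. c * inverse t) at_top (at_right (0::real))"
    by (rule filterlim_tendsto_pos_mult_at_top[OF tendsto_const c filterlim_inverse_at_top_right])
  ultimately have "((\<lambda>t. (c * inverse t) ^ m / exp (c * inverse t)) \<longlongrightarrow> 0) (at_right 0)"
    by (rule filterlim_compose)
  then have "((\<lambda>t. (1 / c ^ m) * ((c * inverse t) ^ m / exp (c * inverse t))) \<longlongrightarrow> (1 / c ^ m) * 0) (at_right 0)"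
    by (intro tendsto_mult tendsto_const)
  moreover have "\<forall>\<^sub>F t in at_right 0. (1 / c ^ m) * ((c * inverse t) ^ m / exp (c * inverse t)) = exp_bump c m t"
    using eventually_at_right_less[of "0::real"]
    by eventually_elim (use c in \<open>simp add: exp_bump_def power_mult_distrib exp_minus divide_inverse\<close>)
  ultimately have "(exp_bump c m \<longlongrightarrow> 0) (at_right 0)"
    by (simp add: filterlim_cong)
  moreover have "(exp_bump c m \<longlongrightarrow> 0) (at_left 0)"
  proof (rule tendsto_eventually)
    show "\<forall>\<^sub>F t in at_left 0. exp_bump c m t = 0"
      unfolding eventually_at_filter by (rule always_eventually) (auto simp: exp_bump_def)
  qed
  ultimately show ?thesis by (simp add: filterlim_at_split)
qed

lemma exp_bump_has_derivative:
  assumes c: "c > 0"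
  shows "(exp_bump c m has_real_derivative c * exp_bump c (m + 2) t - real m * exp_bump c (m + 1) t) (at t)"
proof -
  consider "t > 0" | "t < 0" | "t = 0" by linarith
  then show ?thesis
  proof cases
    case 1
    have inv: "((\<lambda>t. 1 / t) has_real_derivative - ((1 / t) * (1 / t))) (at t)"
      using 1 by (auto intro!: derivative_eq_intros)
    have "((\<lambda>t. (1 / t) ^ m) has_real_derivative - (real m * (1 / t) ^ (m + 1))) (at t)"
    proof (cases m)
      case (Suc k)
      show ?thesis using DERIV_power[OF inv, of m] by (simp add: Suc mult_ac)
    qed simp
    moreover have "((\<lambda>t. exp (- (c / t))) has_real_derivative exp (- (c / t)) * (c * ((1 / t) * (1 / t)))) (at t)"
      using DERIV_fun_exp[OF DERIV_minus[OF DERIV_cmult[OF inv, of c]]] by simp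
    ultimately have "((\<lambda>t. (1 / t) ^ m * exp (- (c / t))) has_real_derivative
      - (real m * (1 / t) ^ (m + 1)) * exp (- (c / t)) + exp (- (c / t)) * (c * ((1 / t) * (1 / t))) * (1 / t) ^ m) (at t)"
      by (rule DERIV_mult)
    then have "((\<lambda>t. (1 / t) ^ m * exp (- (c / t))) has_real_derivative
      c * exp_bump c (m + 2) t - real m * exp_bump c (m + 1) t) (at t)"
      by (rule DERIV_cong) (use 1 in \<open>simp add: exp_bump_def mult_ac\<close>)
    then show ?thesis
      by (rule has_field_derivative_transform_within_open[where S="{0<..}"]) (use 1 in \<open>auto simp: exp_bump_def\<close>)
  next
    case 2
    have "((\<lambda>_. 0) has_real_derivative 0) (at t)" by simp
    then have "(exp_bump c m has_real_derivative 0) (at t)"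
      by (rule has_field_derivative_transform_within_open[where S="{..<0}"]) (use 2 in \<open>auto simp: exp_bump_def\<close>)
    then show ?thesis using 2 by (simp add: exp_bump_def)
  next
    case 3
    \<comment> \<open>At the origin the difference quotient is itself a member of the family, the
      one with m + 1.\<close>
    have "(\<lambda>h. (exp_bump c m (0 + h) - exp_bump c m 0) / h) = exp_bump c (m + 1)"
      by (auto simp: exp_bump_def fun_eq_iff)
    then have "(exp_bump c m has_real_derivative 0) (at 0)"
      using exp_bump_tendsto_0[OF c, of "m + 1"] unfolding DERIV_def by simp
    then show ?thesis using 3 by (simp add: exp_bump_def)
  qed
qed

text \<open>Closed under directional derivatives, which is what makes its members smooth.\<close>

inductive_set bump_algebra :: "('a::euclidean_space \<Rightarrow> real) set" where
  const: "(\<lambda>_. r) \<in> bump_algebra"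
| atom: "c > 0 \<Longrightarrow> (\<lambda>x. exp_bump c m (x \<bullet> v + a)) \<in> bump_algebra"
| add: "f \<in> bump_algebra \<Longrightarrow> g \<in> bump_algebra \<Longrightarrow> (\<lambda>x. f x + g x) \<in> bump_algebra"
| mult: "f \<in> bump_algebra \<Longrightarrow> g \<in> bump_algebra \<Longrightarrow> (\<lambda>x. f x * g x) \<in> bump_algebra"

lemma bump_algebra_derivative:
  "f \<in> bump_algebra \<Longrightarrow> \<exists>f'. (\<forall>x. (f has_derivative (\<lambda>h. f' h x)) (at x)) \<and> (\<forall>h. f' h \<in> bump_algebra)"
proof (induction rule: bump_algebra.induct)
  case (const r)
  then show ?case using bump_algebra.const[of 0] by (intro exI[of _ "\<lambda>_ _. 0"]) auto
next
  case (atom c m v a)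
  let ?f' = "\<lambda>h x. (h \<bullet> v) * (c * exp_bump c (m + 2) (x \<bullet> v + a) + - real m * exp_bump c (m + 1) (x \<bullet> v + a))"
  have "((\<lambda>x. exp_bump c m (x \<bullet> v + a)) has_derivative (\<lambda>h. ?f' h x)) (at x)" for x
  proof -
    have "((\<lambda>x. x \<bullet> v + a) has_derivative (\<lambda>h. h \<bullet> v)) (at x)"
      by (auto intro!: derivative_eq_intros)
    from has_derivative_compose[OF this exp_bump_has_derivative[OF atom, unfolded has_field_derivative_def]]
    show ?thesis by (simp add: mult.commute)
  qed
  moreover have "?f' h \<in> bump_algebra" for h
    by (intro bump_algebra.intros atom)
  ultimately show ?case by (intro exI[of _ ?f']) blast
next
  case (add f g)
  then obtain f' g' where *: "\<And>x. (f has_derivative (\<lambda>h. f' h x)) (at x)" "\<And>h. f' h \<in> bump_algebra"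
    "\<And>x. (g has_derivative (\<lambda>h. g' h x)) (at x)" "\<And>h. g' h \<in> bump_algebra" by blast
  show ?case
    by (intro exI[of _ "\<lambda>h x. f' h x + g' h x"] conjI allI has_derivative_add bump_algebra.add *)
next
  case (mult f g)
  then obtain f' g' where *: "\<And>x. (f has_derivative (\<lambda>h. f' h x)) (at x)" "\<And>h. f' h \<in> bump_algebra"
    "\<And>x. (g has_derivative (\<lambda>h. g' h x)) (at x)" "\<And>h. g' h \<in> bump_algebra" by blast
  show ?case
    by (intro exI[of _ "\<lambda>h x. f x * g' h x + f' h x * g x"] conjI allI has_derivative_mult
        bump_algebra.add bump_algebra.mult mult.hyps *)
qed

text \<open>\<open>smooth_fun\<close> asks for derivatives of all orders, applied to lists of
  vectors. A directional derivative chosen inside the algebra and iterated along the list supplies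
  them all at once.\<close>

lemma bump_algebra_smooth:
  fixes f :: "'a::euclidean_space \<Rightarrow> real"
  assumes "f \<in> bump_algebra"
  shows "smooth_fun f"
proof -
  obtain d where d: "\<And>(f :: 'a \<Rightarrow> real) x. f \<in> bump_algebra \<Longrightarrow> (f has_derivative (\<lambda>h. d f h x)) (at x)"
    "\<And>(f :: 'a \<Rightarrow> real) h. f \<in> bump_algebra \<Longrightarrow> d f h \<in> bump_algebra"
    using bump_algebra_derivative by metis
  define D where "D vs = foldr (\<lambda>h g. d g h) vs f" for vs
  have D: "D vs \<in> bump_algebra" for vs
    by (induction vs) (auto simp: D_def assms d(2))
  show ?thesis
    unfolding smooth_fun_def
    by (intro exI[of _ "\<lambda>_ x vs. D vs x"] conjI allI impI) (use d(1)[OF D] in \<open>auto simp: D_def\<close>)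
qed

lemma bump_algebra_prod:
  "finite I \<Longrightarrow> (\<And>i. i \<in> I \<Longrightarrow> f i \<in> bump_algebra) \<Longrightarrow> (\<lambda>x. \<Prod>i\<in>I. f i x) \<in> bump_algebra"
  by (induction rule: finite_induct) (auto intro: bump_algebra.intros)

section \<open>Box bumps; functions orthogonal to all test functions\<close>

text \<open>One factor per face, vanishing on the outer side of that face; the product is therefore
  nonzero exactly on the open box.\<close>

definition box_bump :: "real \<Rightarrow> 'a::euclidean_space \<Rightarrow> 'a \<Rightarrow> 'a \<Rightarrow> real" where
  "box_bump c a b x = (\<Prod>i\<in>Basis. exp_bump c 0 (x \<bullet> i + - (a \<bullet> i)) * exp_bump c 0 (x \<bullet> (- i) + b \<bullet> i))"

lemma box_bump_nonzero: "box_bump c a b x \<noteq> 0 \<longleftrightarrow> x \<in> box a b"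
  by (auto simp: box_bump_def exp_bump_def mem_box)

lemma box_bump_bounds: "0 \<le> box_bump c a b x" "c > 0 \<Longrightarrow> box_bump c a b x \<le> 1"
proof -
  have *: "0 \<le> exp_bump c 0 t" "c > 0 \<Longrightarrow> exp_bump c 0 t \<le> 1" for t by (auto simp: exp_bump_def)
  show "0 \<le> box_bump c a b x" unfolding box_bump_def by (intro prod_nonneg) (simp add: *)
  show "c > 0 \<Longrightarrow> box_bump c a b x \<le> 1" unfolding box_bump_def by (intro prod_le_1) (simp add: * mult_le_one)
qed

lemma box_bump_test_function:
  assumes c: "c > 0" and U: "cbox a b \<subseteq> U"
  shows "box_bump c a b \<in> test_functions U"
proof -
  have "smooth_fun (\<lambda>x. \<Prod>i\<in>Basis. exp_bump c 0 (x \<bullet> i + - (a \<bullet> i)) * exp_bump c 0 (x \<bullet> (- i) + b \<bullet> i))"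
    using c by (intro bump_algebra_smooth bump_algebra_prod bump_algebra.intros) auto
  moreover have "(\<lambda>x. \<Prod>i\<in>Basis. exp_bump c 0 (x \<bullet> i + - (a \<bullet> i)) * exp_bump c 0 (x \<bullet> (- i) + b \<bullet> i)) = box_bump c a b"
    by (simp add: box_bump_def fun_eq_iff)
  moreover have "{x. box_bump c a b x \<noteq> 0} = box a b" by (simp add: box_bump_nonzero)
  moreover have "closure (box a b) \<subseteq> cbox a b" by (intro closure_minimal box_subset_cbox closed_cbox)
  ultimately show ?thesis
    using U bounded_box[of a b] by (auto simp: test_functions_def)
qed

lemma box_bump_tendsto:
  "(\<lambda>n. box_bump (1 / real (Suc n)) a b x) \<longlonglongrightarrow> indicator (box a b) x"
proof (cases "x \<in> box a b")
  case True
  have *: "(\<lambda>n. exp_bump (1 / real (Suc n)) 0 t) \<longlonglongrightarrow> 1" if "t > 0" for t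
  proof -
    have "(\<lambda>n. exp (- (1 / real (Suc n) / t))) \<longlonglongrightarrow> exp (- (0 / t))"
      by (intro tendsto_intros LIMSEQ_Suc[OF lim_1_over_n]) (use that in auto)
    then show ?thesis using that by (simp add: exp_bump_def)
  qed
  have "(\<lambda>n. box_bump (1 / real (Suc n)) a b x) \<longlonglongrightarrow> (\<Prod>i\<in>(Basis::'a set). 1 * 1)"
    unfolding box_bump_def using True by (intro tendsto_prod tendsto_mult *) (auto simp: mem_box)
  then show ?thesis using True by simp
next
  case False
  then have "box_bump c a b x = 0" for c using box_bump_nonzero[of c a b x] by blast
  then show ?thesis using False by simp
qed

text \<open>\<open>ennreal\<close> cuts off negative values, so \<open>F\<close> and
  \<open>- F\<close> are the densities of the positive and the negative part. The two measures agree
  on open boxes, a generator stable under intersection, hence everywhere. By uniqueness of densities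
  the two parts coincide, and as one of them is 0 at each point, both are.\<close>

lemma AE_zero_of_box_integrals:
  fixes F :: "'a::euclidean_space \<Rightarrow> real"
  assumes F: "integrable lborel F"
    and box: "\<And>a b. (\<integral>x. F x * indicator (box a b) x \<partial>lborel) = 0"
  shows "AE x in lborel. F x = 0"
proof -
  note [measurable] = borel_measurable_integrable[OF F]
  let ?D = "\<lambda>f :: 'a \<Rightarrow> real. density lborel (\<lambda>x. ennreal (f x))"
  have eq: "emeasure (?D F) (box a b) = emeasure (?D (\<lambda>x. - F x)) (box a b)
      \<and> emeasure (?D F) (box a b) \<noteq> \<infinity>" for a b
  proof -
    let ?H = "\<lambda>x. F x * indicator (box a b) x"
    have H: "integrable lborel ?H"
      using integrable_mult_indicator[OF _ F, of "box a b"] by (simp add: mult.commute)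
    have e: "emeasure (?D F) (box a b) = (\<integral>\<^sup>+x. ennreal (?H x) \<partial>lborel)"
      by (subst emeasure_density) (auto intro!: nn_integral_cong simp: indicator_def)
    have e': "emeasure (?D (\<lambda>x. - F x)) (box a b) = (\<integral>\<^sup>+x. ennreal (- ?H x) \<partial>lborel)"
      by (subst emeasure_density) (auto intro!: nn_integral_cong simp: indicator_def)
    have fin: "(\<integral>\<^sup>+x. ennreal (?H x) \<partial>lborel) \<noteq> \<infinity>" "(\<integral>\<^sup>+x. ennreal (- ?H x) \<partial>lborel) \<noteq> \<infinity>"
      using H unfolding real_integrable_def by auto
    have "enn2real (\<integral>\<^sup>+x. ennreal (?H x) \<partial>lborel) = enn2real (\<integral>\<^sup>+x. ennreal (- ?H x) \<partial>lborel)"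
      using real_lebesgue_integral_def[OF H] box[of a b] by simp
    then have "(\<integral>\<^sup>+x. ennreal (?H x) \<partial>lborel) = (\<integral>\<^sup>+x. ennreal (- ?H x) \<partial>lborel)"
      using fin by (subst (1 2) ennreal_enn2real[symmetric]) (simp_all add: top.not_eq_extremum)
    then show ?thesis using e e' fin by simp
  qed
  have "?D F = ?D (\<lambda>x. - F x)"
  proof (rule measure_eqI_generator_eq[where E="range (\<lambda>(a, b). box a b)" and \<Omega>=UNIV
        and A="\<lambda>n. box (- (real n *\<^sub>R One)) (real n *\<^sub>R One)"])
    show "Int_stable (range (\<lambda>(a, b). box a b :: 'a set))"
      by (auto simp: Int_stable_def box_Int_box)
    show "sets (?D F) = sigma_sets UNIV (range (\<lambda>(a, b). box a b))"
      "sets (?D (\<lambda>x. - F x)) = sigma_sets UNIV (range (\<lambda>(a, b). box a b))"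
      by (simp_all add: borel_eq_box)
    show "(\<Union>n. box (- (real n *\<^sub>R One)) (real n *\<^sub>R One)) = (UNIV :: 'a set)"
      by (rule UN_box_eq_UNIV)
    show "emeasure (?D F) (box (- (real n *\<^sub>R One)) (real n *\<^sub>R One)) \<noteq> \<infinity>" for n
      using eq by blast
    show "emeasure (?D F) X = emeasure (?D (\<lambda>x. - F x)) X" if "X \<in> range (\<lambda>(a, b). box a b)" for X
      using that eq by auto
  qed auto
  then have "AE x in lborel. ennreal (F x) = ennreal (- F x)"
    by (intro sigma_finite_measure.density_unique[OF sigma_finite_lborel]) auto
  then show ?thesis
  proof eventually_elim
    case (elim x)
    show "F x = 0"
    proof (cases "F x \<ge> 0")
      case True
      then have "ennreal (- F x) = 0" by (simp add: ennreal_neg)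
      then show ?thesis using elim True by simp
    next
      case False
      then have "ennreal (F x) = 0" by (simp add: ennreal_neg)
      then show ?thesis using elim False by simp
    qed
  qed
qed

text \<open>Box bumps tend to indicators of boxes under the dominating function |F|, and countably
  many closed boxes fill an open set. Cutting \<open>F\<close> off to one of them reduces the claim
  to integrals over boxes in the whole space, because boxes intersect in boxes.\<close>

lemma fundamental_lemma_of_variations:
  fixes F :: "'a::euclidean_space \<Rightarrow> real"
  assumes F: "integrable lborel F" and U: "open U"
    and zero: "\<And>\<phi>. \<phi> \<in> test_functions U \<Longrightarrow> (\<integral>x. F x * \<phi> x \<partial>lborel) = 0"
  shows "AE x in lborel. x \<in> U \<longrightarrow> F x = 0"
proof -
  note [measurable] = borel_measurable_integrable[OF F]
  have box0: "(\<integral>x. F x * indicator (box a b) x \<partial>lborel) = 0" if ab: "cbox a b \<subseteq> U" for a b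
  proof -
    have m[measurable]: "box_bump c a b \<in> borel_measurable borel" for c
      unfolding box_bump_def exp_bump_def by measurable
    have "(\<lambda>n. \<integral>x. F x * box_bump (1 / real (Suc n)) a b x \<partial>lborel) \<longlonglongrightarrow> (\<integral>x. F x * indicator (box a b) x \<partial>lborel)"
    proof (rule integral_dominated_convergence[where w="\<lambda>x. norm (F x)"])
      show "integrable lborel (\<lambda>x. norm (F x))" using F by (rule integrable_norm)
      show "AE x in lborel. (\<lambda>n. F x * box_bump (1 / real (Suc n)) a b x) \<longlonglongrightarrow> F x * indicator (box a b) x"
        by (intro AE_I2 tendsto_mult tendsto_const box_bump_tendsto)
      show "AE x in lborel. norm (F x * box_bump (1 / real (Suc n)) a b x) \<le> norm (F x)" for n
        using box_bump_bounds[of "1 / real (Suc n)" a b] by (intro AE_I2) (simp add: abs_mult mult_left_le)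
    qed measurable
    moreover have "(\<integral>x. F x * box_bump (1 / real (Suc n)) a b x \<partial>lborel) = 0" for n
      using ab by (intro zero box_bump_test_function) auto
    ultimately show ?thesis by (simp add: LIMSEQ_const_iff)
  qed
  obtain \<D> where \<D>: "countable \<D>" "\<D> \<subseteq> Pow U" "\<And>X. X \<in> \<D> \<Longrightarrow> \<exists>a b. X = cbox a b" "\<Union>\<D> = U"
    using open_countable_Union_open_cbox[OF U] by metis
  have "AE x in lborel. x \<in> X \<longrightarrow> F x = 0" if X: "X \<in> \<D>" for X
  proof -
    obtain a b where ab: "X = cbox a b" using \<D>(3)[OF X] by blast
    then have abU: "cbox a b \<subseteq> U" using \<D>(2) X by blast
    let ?F = "\<lambda>x. F x * indicator (box a b) x"
    have "AE x in lborel. ?F x = 0"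
    proof (rule AE_zero_of_box_integrals)
      show "integrable lborel ?F"
        using integrable_mult_indicator[OF _ F, of "box a b"] by (simp add: mult.commute)
      fix c d :: 'a
      obtain e g where eg: "box a b \<inter> box c d = box e g" using box_Int_box[of a b c d] by blast
      have "(\<integral>x. ?F x * indicator (box c d) x \<partial>lborel) = (\<integral>x. F x * indicator (box e g) x \<partial>lborel)"
        unfolding eg[symmetric] by (intro Bochner_Integration.integral_cong) (auto simp: indicator_def)
      also have "\<dots> = 0"
      proof (cases "box e g = {}")
        case False
        have "cbox e g = closure (box e g)" by (rule closure_box[OF False, symmetric])
        also have "box e g \<subseteq> cbox a b" using box_subset_cbox[of a b] unfolding eg[symmetric] by blast
        then have "closure (box e g) \<subseteq> cbox a b" by (intro closure_minimal closed_cbox)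
        finally show ?thesis using abU by (intro box0) blast
      qed simp
      finally show "(\<integral>x. ?F x * indicator (box c d) x \<partial>lborel) = 0" .
    qed
    \<comment> \<open>The cutoff uses the open box while the covering sets are closed boxes; the
      boundary between them is negligible.\<close>
    moreover have "AE x in lborel. x \<notin> cbox a b - box a b"
    proof -
      have "negligible (cbox a b - box a b)" by (rule negligible_frontier_interval)
      then have "cbox a b - box a b \<in> null_sets lborel"
        by (simp add: negligible_iff_null_sets null_sets_completion_iff)
      then show ?thesis by (rule AE_not_in)
    qed
    ultimately show ?thesis unfolding ab by eventually_elim (auto simp: indicator_def)
  qed
  then have "AE x in lborel. \<forall>X\<in>\<D>. x \<in> X \<longrightarrow> F x = 0"
    unfolding AE_ball_countable[OF \<D>(1)] by blast
  then show ?thesis by eventually_elim (use \<D>(4) in blast)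
qed

section \<open>Energy and compliance\<close>

lemma in_Lq_mono:
  fixes \<Omega> :: "'a::euclidean_space set"
  assumes f: "in_Lq q \<Omega> f" and q: "0 < r" "r \<le> q" and \<Omega>: "bounded \<Omega>" "open \<Omega>"
  shows "in_Lq r \<Omega> f"
proof -
  have fm: "set_borel_measurable lebesgue \<Omega> f" and fi: "set_integrable lebesgue \<Omega> (\<lambda>x. \<bar>f x\<bar> powr q)"
    using f by (auto simp: in_Lq_def)
  have [measurable]: "\<Omega> \<in> sets lebesgue" using \<Omega> by (simp add: borel_open sets_completionI_sets)
  have m: "(\<lambda>x. indicator \<Omega> x *\<^sub>R f x) \<in> borel_measurable lebesgue"
    using fm by (simp add: set_borel_measurable_def)
  have "\<Omega> \<in> lmeasurable" using \<Omega> by (rule lmeasurable_open)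
  then have one: "set_integrable lebesgue \<Omega> (\<lambda>_. 1::real)"
    by (simp add: set_integrable_def fmeasurable_def integrable_indicator_iff)
  have "set_integrable lebesgue \<Omega> (\<lambda>x. 1 + \<bar>f x\<bar> powr q)"
    by (rule set_integral_add(1)[OF one fi])
  then have "set_integrable lebesgue \<Omega> (\<lambda>x. \<bar>f x\<bar> powr r)"
    unfolding set_integrable_def
  proof (rule Bochner_Integration.integrable_bound)
    have "(\<lambda>x. indicator \<Omega> x *\<^sub>R \<bar>indicator \<Omega> x *\<^sub>R f x\<bar> powr r) \<in> borel_measurable lebesgue"
      using m by measurable
    then show "(\<lambda>x. indicator \<Omega> x *\<^sub>R \<bar>f x\<bar> powr r) \<in> borel_measurable lebesgue"
      by (rule measurable_cong[THEN iffD1, rotated]) (auto simp: indicator_def)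
    have "\<bar>f x\<bar> powr r \<le> 1 + \<bar>f x\<bar> powr q" for x
    proof (cases "\<bar>f x\<bar> \<le> 1")
      case True
      then have "\<bar>f x\<bar> powr r \<le> 1" using q powr_mono2[of r "\<bar>f x\<bar>" 1] by simp
      then show ?thesis using powr_ge_zero[of "\<bar>f x\<bar>" q] by linarith
    next
      case False
      then have "\<bar>f x\<bar> powr r \<le> \<bar>f x\<bar> powr q" using q by (intro powr_mono) auto
      then show ?thesis by simp
    qed
    then show "AE x in lebesgue. norm (indicator \<Omega> x *\<^sub>R \<bar>f x\<bar> powr r) \<le> norm (indicator \<Omega> x *\<^sub>R (1 + \<bar>f x\<bar> powr q))"
      by (intro AE_I2) (auto simp: indicator_def)
  qed
  then show ?thesis using fm by (simp add: in_Lq_def)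
qed

lemma q0_hyp_dual_exponent:
  fixes \<Omega> :: "'a::euclidean_space set"
  assumes N: "N \<ge> 2" and p: "p > real N - 1" and q0: "q0_hyp N p \<Omega> f" and \<Omega>: "bounded \<Omega>" "open \<Omega>"
  obtains q where "dual_exponent N p q" "in_Lq q \<Omega> f"
proof -
  consider "p < real N" | "p = real N" | "p > real N" by linarith
  then show ?thesis
  proof cases
    case 1
    have "dual_exponent N p ((real N * p / (real N - p)) / (real N * p / (real N - p) - 1))"
      unfolding dual_exponent_def using 1 p N by (intro disjI2 exI[of _ p]) auto
    then show ?thesis using q0 1 that by (simp add: q0_hyp_def Let_def)
  next
    case 2
    then obtain q1 where q1: "q1 > 1" "in_Lq q1 \<Omega> f" using q0 by (auto simp: q0_hyp_def)
    define n where "n = real N"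
    have n: "n \<ge> 2" using N by (simp add: n_def)
    \<comment> \<open>The target Sobolev exponent: s \<ge> q1 / (q1 - 1) makes its conjugate at most
      q1, and the added n ensures s > n, which puts r above 1.\<close>
    define s where "s = q1 / (q1 - 1) + n"
    have s: "s > n" "s \<ge> q1 / (q1 - 1)" using q1 n by (auto simp: s_def)
    \<comment> \<open>Inverts the map from r to n r / (n - r), so that the Sobolev exponent of r is
      s.\<close>
    define r where "r = n * s / (n + s)"
    have r1: "r > 1"
    proof -
      have "n * s \<ge> 2 * s" using n s by (intro mult_right_mono) auto
      then have "n + s < n * s" using s by linarith
      then show ?thesis using n s by (simp add: r_def less_divide_eq)
    qed
    have nr: "n - r = n * n / (n + s)" using n s by (simp add: r_def field_simps)
    then have rn: "r < n" using n s by (smt (verit) divide_pos_pos mult_pos_pos)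
    have ns: "n * r / (n - r) = s" unfolding nr using n s by (simp add: r_def)
    define q where "q = s / (s - 1)"
    have "q1 * (s - 1) \<ge> s"
    proof -
      have "q1 \<le> s * (q1 - 1)" using s(2) q1 by (simp add: pos_divide_le_eq)
      then show ?thesis by (simp add: algebra_simps)
    qed
    then have qq: "q \<le> q1" "q > 0" using s n by (auto simp: q_def pos_divide_le_eq)
    have "dual_exponent N p q"
      unfolding dual_exponent_def n_def[symmetric] using r1 rn 2 ns
      by (intro disjI2 exI[of _ r]) (auto simp: q_def n_def)
    moreover have "in_Lq q \<Omega> f" by (rule in_Lq_mono[OF q1(2) qq(2,1) \<Omega>])
    ultimately show ?thesis by (rule that)
  next
    case 3
    then have "dual_exponent N p 1" "in_Lq 1 \<Omega> f" using q0 by (auto simp: dual_exponent_def q0_hyp_def)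
    then show ?thesis by (rule that)
  qed
qed

text \<open>Holds without integrability, since the Bochner integral is then 0 by convention.\<close>

lemma abs_integral_le_enn2real:
  fixes h :: "'a \<Rightarrow> real"
  assumes [measurable]: "h \<in> borel_measurable M"
  shows "\<bar>\<integral>x. h x \<partial>M\<bar> \<le> enn2real (\<integral>\<^sup>+x. ennreal \<bar>h x\<bar> \<partial>M)"
proof (cases "integrable M h")
  case True
  have "\<bar>\<integral>x. h x \<partial>M\<bar> \<le> (\<integral>x. \<bar>h x\<bar> \<partial>M)" by (rule integral_abs_bound)
  also have "\<dots> = enn2real (\<integral>\<^sup>+x. ennreal \<bar>h x\<bar> \<partial>M)" by (rule integral_eq_nn_integral) auto
  finally show ?thesis .
qed (simp add: not_integrable_integral_eq)

text \<open>The coefficient 1 / p is that of the gradient term of the energy, so the two cancel and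
  only B is left. Finiteness of the gradient integral matters because \<open>enn2real\<close> sends
  infinity to 0.\<close>

lemma energy_ge:
  fixes f u :: "'a::euclidean_space \<Rightarrow> real" and g :: "'a \<Rightarrow> 'a"
  assumes [measurable]: "\<Omega> \<in> sets lebesgue" "u \<in> borel_measurable lebesgue" "g \<in> borel_measurable lebesgue"
    and f: "(\<lambda>x. indicator \<Omega> x *\<^sub>R f x) \<in> borel_measurable lebesgue" and p: "p > 0" and B: "B \<ge> 0"
    and fin: "(\<integral>\<^sup>+x. ennreal (norm (g x) powr p) * indicator \<Omega> x \<partial>lebesgue) < top"
    and le: "(\<integral>\<^sup>+x. ennreal (\<bar>indicator \<Omega> x *\<^sub>R f x\<bar> * \<bar>u x\<bar>) \<partial>lebesgue) \<le>
      ennreal (1 / p) * (\<integral>\<^sup>+x. ennreal (norm (g x) powr p) * indicator \<Omega> x \<partial>lebesgue) + ennreal B"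
  shows "- B \<le> energy p f \<Omega> u g"
proof -
  note [measurable] = f
  let ?Y = "\<integral>\<^sup>+x. ennreal (norm (g x) powr p) * indicator \<Omega> x \<partial>lebesgue"
  obtain Y where Y: "?Y = ennreal Y" "Y \<ge> 0" using fin by (cases ?Y) auto
  have "(LINT x:\<Omega>|lebesgue. norm (g x) powr p) = enn2real (\<integral>\<^sup>+x. ennreal (indicator \<Omega> x *\<^sub>R norm (g x) powr p) \<partial>lebesgue)"
    unfolding set_lebesgue_integral_def by (rule integral_eq_nn_integral) auto
  also have "(\<integral>\<^sup>+x. ennreal (indicator \<Omega> x *\<^sub>R norm (g x) powr p) \<partial>lebesgue) = ?Y"
    by (intro nn_integral_cong) (auto simp: indicator_def)
  finally have 1: "(LINT x:\<Omega>|lebesgue. norm (g x) powr p) = Y" using Y by simp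
  have eq: "(\<lambda>x. indicator \<Omega> x *\<^sub>R (f x * u x)) = (\<lambda>x. (indicator \<Omega> x *\<^sub>R f x) * u x)"
    by (simp add: fun_eq_iff)
  have "\<bar>LINT x:\<Omega>|lebesgue. f x * u x\<bar> \<le> enn2real (\<integral>\<^sup>+x. ennreal \<bar>(indicator \<Omega> x *\<^sub>R f x) * u x\<bar> \<partial>lebesgue)"
    unfolding set_lebesgue_integral_def eq by (rule abs_integral_le_enn2real) measurable
  also have "\<dots> \<le> enn2real (ennreal (Y / p + B))"
  proof (rule enn2real_mono)
    have "(\<integral>\<^sup>+x. ennreal \<bar>(indicator \<Omega> x *\<^sub>R f x) * u x\<bar> \<partial>lebesgue) \<le> ennreal (1 / p) * ennreal Y + ennreal B"
      using le unfolding Y by (simp add: abs_mult)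
    also have "\<dots> = ennreal (Y / p + B)"
      using Y p B by (simp add: ennreal_plus flip: ennreal_mult)
    finally show "(\<integral>\<^sup>+x. ennreal \<bar>(indicator \<Omega> x *\<^sub>R f x) * u x\<bar> \<partial>lebesgue) \<le> ennreal (Y / p + B)" .
  qed simp
  also have "\<dots> = Y / p + B" using Y p B by (simp del: ennreal_plus)
  finally show ?thesis unfolding energy_def 1 by simp
qed

lemma zero_test_function: "(\<lambda>_. 0) \<in> test_functions U"
  unfolding test_functions_def smooth_fun_def by (auto intro!: exI[of _ "\<lambda>_ _ _. 0"])

lemma sobolev0_test_function:
  assumes \<phi>: "\<phi> \<in> test_functions U" and der: "\<And>x. (\<phi> has_derivative (\<lambda>h. G x \<bullet> h)) (at x)"
  shows "sobolev0 p U \<phi> G"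
proof -
  have "continuous_on UNIV \<phi>"
    using der has_derivative_continuous by (intro continuous_at_imp_continuous_on) blast
  then have "\<phi> \<in> borel_measurable lebesgue" "G \<in> borel_measurable lebesgue"
    using test_function_gradient(1)[OF \<phi> der] by (auto intro!: measurable_completion borel_measurable_continuous_onI)
  then show ?thesis
    unfolding sobolev0_def using \<phi> der by (auto intro!: exI[of _ "\<lambda>_. \<phi>"] exI[of _ "\<lambda>_. G"])
qed

text \<open>Coordinates of the gradient are the derivatives along the basis. Linearity of
  \<open>D (Suc 0) x [h]\<close> in h is not written into \<open>smooth_fun\<close>; it comes from
  being a derivative.\<close>

lemma test_function_has_gradient:
  assumes "\<phi> \<in> test_functions U"
  obtains G where "\<And>x. (\<phi> has_derivative (\<lambda>h. G x \<bullet> h)) (at x)"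
proof -
  obtain D where D0: "\<And>x. D 0 x [] = \<phi> x" and
    D: "\<And>k x vs. length vs = k \<Longrightarrow> ((\<lambda>y. D k y vs) has_derivative (\<lambda>h. D (Suc k) x (h # vs))) (at x)"
    using assms unfolding test_functions_def smooth_fun_def by blast
  have d: "(\<phi> has_derivative (\<lambda>h. D (Suc 0) x [h])) (at x)" for x
    using D[of "[]" 0 x] by (simp add: D0)
  show ?thesis
  proof (rule that)
    fix x
    interpret linear "\<lambda>h. D (Suc 0) x [h]" by (rule has_derivative_linear[OF d])
    have "(\<Sum>b\<in>Basis. D (Suc 0) x [b] *\<^sub>R b) \<bullet> h = D (Suc 0) x [h]" for h
    proof -
      have "D (Suc 0) x [h] = D (Suc 0) x [\<Sum>b\<in>Basis. (h \<bullet> b) *\<^sub>R b]" by (simp add: euclidean_representation)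
      also have "\<dots> = (\<Sum>b\<in>Basis. (h \<bullet> b) * D (Suc 0) x [b])" by (simp add: sum scale)
      finally show ?thesis by (simp add: inner_sum_right inner_commute[of _ h] mult.commute)
    qed
    then show "(\<phi> has_derivative (\<lambda>h. (\<Sum>b\<in>Basis. D (Suc 0) x [b] *\<^sub>R b) \<bullet> h)) (at x)"
      using d[of x] by simp
  qed
qed

lemma test_function_scale:
  assumes \<phi>: "\<phi> \<in> test_functions U" and t: "t \<noteq> 0"
  shows "(\<lambda>x. t * \<phi> x) \<in> test_functions U"
proof -
  obtain D where "\<And>x. D 0 x [] = \<phi> x" and
    "\<And>k x vs. length vs = k \<Longrightarrow> ((\<lambda>y. D k y vs) has_derivative (\<lambda>h. D (Suc k) x (h # vs))) (at x)"
    using assms unfolding test_functions_def smooth_fun_def by blast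
  then have "smooth_fun (\<lambda>x. t * \<phi> x)"
    unfolding smooth_fun_def
    by (intro exI[of _ "\<lambda>k x vs. t * D k x vs"]) (auto intro: has_derivative_mult_right)
  then show ?thesis using \<phi> t by (simp add: test_functions_def)
qed

text \<open>If the energy is nonnegative along the ray t \<mapsto> t \<phi>, the linear term vanishes, since
  the gradient term is of order t^p with p > 1.\<close>

lemma linear_term_zero:
  fixes f :: "'a::euclidean_space \<Rightarrow> real"
  assumes \<phi>: "\<phi> \<in> test_functions U" and p: "p > 1"
    and pos: "\<And>\<psi> H. \<psi> \<in> test_functions U \<Longrightarrow> (\<And>x. (\<psi> has_derivative (\<lambda>h. H x \<bullet> h)) (at x)) \<Longrightarrow> 0 \<le> energy p f \<Omega> \<psi> H"
  shows "(LINT x:\<Omega>|lebesgue. f x * \<phi> x) = 0"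
proof -
  obtain G where G: "\<And>x. (\<phi> has_derivative (\<lambda>h. G x \<bullet> h)) (at x)"
    using test_function_has_gradient[OF \<phi>] by blast
  let ?I = "LINT x:\<Omega>|lebesgue. f x * \<phi> x"
  let ?Y = "LINT x:\<Omega>|lebesgue. norm (G x) powr p"
  have le: "t * ?I \<le> \<bar>t\<bar> powr p * (?Y / p)" if t: "t \<noteq> 0" for t
  proof -
    have "((\<lambda>x. t * \<phi> x) has_derivative (\<lambda>h. (t *\<^sub>R G x) \<bullet> h)) (at x)" for x
      using has_derivative_mult_right[OF G, of t x] by simp
    from pos[OF test_function_scale[OF \<phi> t] this]
    have "0 \<le> (1 / p) * (LINT x:\<Omega>|lebesgue. \<bar>t\<bar> powr p * norm (G x) powr p) - (LINT x:\<Omega>|lebesgue. t * (f x * \<phi> x))"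
      by (simp add: energy_def powr_mult mult_ac)
    then show ?thesis by simp
  qed
  have lim: "((\<lambda>t. t powr (p - 1) * (?Y / p)) \<longlongrightarrow> 0 powr (p - 1) * (?Y / p)) (at_right 0)"
    using p by (intro tendsto_mult tendsto_const tendsto_powr' tendsto_ident_at)
      (auto intro: eventually_mono[OF eventually_at_right_less])
  \<comment> \<open>s is a sign: the two choices bound the linear term by 0 from above and from
    below.\<close>
  have "s * ?I \<le> 0" if s: "\<bar>s\<bar> = 1" for s
  proof -
    have "\<forall>\<^sub>F t in at_right 0. s * ?I \<le> t powr (p - 1) * (?Y / p)"
      using eventually_at_right_less[of "0::real"]
    proof eventually_elim
      case (elim t)
      have "t * (s * ?I) \<le> \<bar>s * t\<bar> powr p * (?Y / p)"
        using le[of "s * t"] elim s by (auto simp: mult_ac)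
      also have "\<bar>s * t\<bar> = t" using elim s by (simp add: abs_mult)
      also have "t powr p * (?Y / p) = t * (t powr (p - 1) * (?Y / p))" using elim by (simp add: powr_diff)
      finally show ?case by (rule mult_left_le_imp_le[OF _ elim])
    qed
    from tendsto_lowerbound[OF lim this] show ?thesis using p by simp
  qed
  from this[of 1] this[of "-1"] show ?thesis by simp
qed

text \<open>The pair \<open>u0\<close>, \<open>g0\<close> makes the set of energies nonempty, as an
  infimum of reals demands.\<close>

lemma compliance_le:
  assumes "sobolev0 p (\<Omega> - S) u0 g0"
    and "\<And>u g. sobolev0 p (\<Omega> - S) u g \<Longrightarrow> - B \<le> energy p f \<Omega> u g"
  shows "compliance p f \<Omega> S \<le> B"
proof -
  have "- B \<le> (INF ug \<in> {(u, g). sobolev0 p (\<Omega> - S) u g}. energy p f \<Omega> (fst ug) (snd ug))"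
    using assms by (intro cINF_greatest) auto
  then show ?thesis by (simp add: compliance_def)
qed

text \<open>Here the uniform bound -B is needed for the infimum of reals to be a lower bound at
  all.\<close>

lemma compliance_ge:
  assumes "sobolev0 p (\<Omega> - S) u g"
    and "\<And>u g. sobolev0 p (\<Omega> - S) u g \<Longrightarrow> - B \<le> energy p f \<Omega> u g"
  shows "- energy p f \<Omega> u g \<le> compliance p f \<Omega> S"
proof -
  have "(INF ug \<in> {(u, g). sobolev0 p (\<Omega> - S) u g}. energy p f \<Omega> (fst ug) (snd ug)) \<le> energy p f \<Omega> (fst (u, g)) (snd (u, g))"
    using assms by (intro cINF_lower bdd_belowI2[where m="- B"]) auto
  then show ?thesis by (simp add: compliance_def)
qed

section \<open>Competitors built from the grid, and their length\<close>

definition grid_set :: "real \<Rightarrow> real \<Rightarrow> 'a::euclidean_space \<Rightarrow> nat \<Rightarrow> 'a set" where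
  "grid_set R l i m = (\<Union>k\<in>grid_index m. grid_segment (R / m) (min l R / (3 * real m) ^ DIM('a)) i k)"

lemma compact_grid_set: "compact (grid_set R l i m)"
  unfolding grid_set_def grid_segment_def
  by (intro compact_UN finite_grid_index compact_continuous_image compact_Icc) (auto intro!: continuous_intros)

lemma hausdorff1_grid_le:
  fixes i :: "'a::euclidean_space"
  assumes i: "i \<in> Basis" and m: "m \<ge> 1" and lR: "l > 0" "R > 0" and S: "S \<subseteq> grid_set R l i m"
  shows "hausdorff1 S \<le> ennreal l"
proof -
  let ?K = "grid_index m :: ('a \<Rightarrow> int) set"
  let ?d = "min l R / (3 * real m) ^ DIM('a)"
  have d: "?d > 0" using m lR by simp
  have le: "hausdorff1 S \<le> ennreal (real (card ?K) * ?d)"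
    by (rule hausdorff1_segments_le[where c="grid_corner (R / real m)" and i=i])
       (use S i d in \<open>auto simp: grid_set_def grid_segment_def\<close>)
  have "real (card ?K) * ?d \<le> (3 * real m) ^ DIM('a) * ?d"
    using d card_grid_index_le[OF m, where 'a='a] by (intro mult_right_mono) auto
  also have "\<dots> = min l R" using m by simp
  also have "\<dots> \<le> l" by simp
  finally show ?thesis by (intro order_trans[OF le] ennreal_leI)
qed

text \<open>The part of the grid inside \<Omega> has to be shown nontrivial. Cells shrink with m, so
  the cell of a fixed point of \<Omega>, together with its segment, ends up in a ball contained in
  \<Omega>.\<close>

lemma hausdorff1_grid_pos:
  fixes i :: "'a::euclidean_space"
  assumes i: "i \<in> Basis" and lR: "l > 0" "R > 0"
    and \<Omega>: "open \<Omega>" "\<Omega> \<noteq> {}" and box: "\<And>x. x \<in> \<Omega> \<Longrightarrow> \<forall>b\<in>Basis. \<bar>x \<bullet> b\<bar> < R"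
  shows "\<forall>\<^sub>F m in sequentially. hausdorff1 (\<Omega> \<inter> grid_set R l i m) > 0"
proof -
  obtain x0 \<rho> where x0: "x0 \<in> \<Omega>" "\<rho> > 0" "cball x0 \<rho> \<subseteq> \<Omega>"
    using \<Omega> open_contains_cball by blast
  have "(\<lambda>m. real DIM('a) * (R / real m)) \<longlonglongrightarrow> real DIM('a) * 0"
    by (intro tendsto_mult tendsto_const lim_const_over_n)
  then have "\<forall>\<^sub>F m in sequentially. real DIM('a) * (R / real m) < \<rho>"
    using x0 by (intro order_tendstoD(2)) auto
  then show ?thesis using eventually_ge_at_top[of 1]
  proof eventually_elim
    case (elim m)
    let ?\<epsilon> = "R / real m"
    let ?d = "min l R / (3 * real m) ^ DIM('a)"
    have m: "m \<ge> 1" using elim by simp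
    have d: "?d > 0" using m lR by simp
    have "real m < 3 * real m" using m by simp
    also have "\<dots> \<le> (3 * real m) ^ DIM('a)" using m by (intro self_le_power) auto
    finally have "R / (3 * real m) ^ DIM('a) < ?\<epsilon>" using lR m by (intro divide_strict_left_mono) auto
    moreover have "?d \<le> R / (3 * real m) ^ DIM('a)" by (intro divide_right_mono) auto
    ultimately have d\<epsilon>: "?d < ?\<epsilon>" by linarith
    obtain k where k: "k \<in> grid_index m" "x0 \<in> grid_cell (grid_corner ?\<epsilon> k) ?\<epsilon>"
      using grid_cell_containing[OF m, of x0 R] box[OF x0(1)] by auto
    have seg: "grid_segment ?\<epsilon> ?d i k \<subseteq> \<Omega>"
    proof
      fix y assume "y \<in> grid_segment ?\<epsilon> ?d i k"
      then have "y \<in> (\<lambda>\<sigma>. grid_corner ?\<epsilon> k + \<sigma> *\<^sub>R i) ` {0..?d}" by (simp only: grid_segment_def)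
      then obtain \<sigma> where y: "y = grid_corner ?\<epsilon> k + \<sigma> *\<^sub>R i" and "\<sigma> \<in> {0..?d}" by (rule imageE)
      then have \<sigma>: "0 \<le> \<sigma>" "\<sigma> < ?\<epsilon>" using d\<epsilon> by auto
      have "y \<in> grid_cell (grid_corner ?\<epsilon> k) ?\<epsilon>" unfolding y by (rule segment_in_grid_cell[OF \<sigma> i])
      then have "y \<in> cball x0 (real DIM('a) * ?\<epsilon>)" using grid_cell_subset_cball[OF k(2)] by blast
      then have "y \<in> cball x0 \<rho>" using elim(1) by (auto intro: order_trans)
      then show "y \<in> \<Omega>" using x0(3) by blast
    qed
    have "grid_segment ?\<epsilon> ?d i k \<subseteq> grid_set R l i m" using k(1) unfolding grid_set_def by blast
    with seg have "(\<lambda>\<sigma>. grid_corner ?\<epsilon> k + \<sigma> *\<^sub>R i) ` {0..?d} \<subseteq> \<Omega> \<inter> grid_set R l i m"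
      unfolding grid_segment_def by blast
    then show ?case by (rule hausdorff1_segment_pos[OF i d])
  qed
qed

lemma hausdorff1_mono: "S \<subseteq> T \<Longrightarrow> hausdorff1 S \<le> hausdorff1 T"
  unfolding hausdorff1_def hausdorff_pre1_def
  by (intro SUP_mono' INF_superset_mono) auto

lemma no_minimizer:
  fixes \<Omega> :: "'a::euclidean_space set" and f :: "'a \<Rightarrow> real" and L p :: real
  assumes N: "DIM('a) \<ge> 2"
    and \<Omega>: "open \<Omega>" "bounded \<Omega>" "\<Omega> \<noteq> {}"
    and L: "L > 0" and p: "p > real DIM('a) - 1"
    and q0: "q0_hyp DIM('a) p \<Omega> f"
    and nz: "\<not> (AE x in lebesgue. x \<in> \<Omega> \<longrightarrow> f x = 0)"
    and \<Sigma>: "closed \<Sigma>" "hausdorff1 \<Sigma> \<le> ennreal L"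
    and min: "\<And>\<Sigma>'. closed \<Sigma>' \<Longrightarrow> \<Sigma>' \<subseteq> closure \<Omega> \<Longrightarrow> 0 < hausdorff1 \<Sigma>' \<Longrightarrow> hausdorff1 \<Sigma>' \<le> ennreal L
      \<Longrightarrow> compliance p f \<Omega> \<Sigma> \<le> compliance p f \<Omega> \<Sigma>'"
  shows False
proof -
  have p1: "p > 1" using N p by simp
  have \<Omega>m[measurable]: "\<Omega> \<in> sets lebesgue" using \<Omega>(1) by (simp add: borel_open sets_completionI_sets)
  obtain r where r: "\<forall>x\<in>\<Omega>. norm x \<le> r" using \<Omega>(2) bounded_iff by blast
  \<comment> \<open>One more than a bound for the norm, so that all coordinates stay strictly below
    R in absolute value.\<close>
  define R where "R = \<bar>r\<bar> + 1"
  have R: "R > 0" by (simp add: R_def)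
  have box: "\<forall>b\<in>Basis. \<bar>x \<bullet> b\<bar> < R" if "x \<in> \<Omega>" for x
    using r that Basis_le_norm[of _ x] by (auto simp: R_def) (smt (verit))
  obtain i :: 'a where i: "i \<in> Basis" using nonempty_Basis by blast
  obtain q where q: "dual_exponent DIM('a) p q" "in_Lq q \<Omega> f"
    using q0_hyp_dual_exponent[OF N p q0 \<Omega>(2,1)] by blast
  have q1: "q \<ge> 1" by (rule dual_exponent_ge_1[OF q(1)])
  define F0 where "F0 x = indicator \<Omega> x *\<^sub>R f x" for x
  have F0[measurable]: "F0 \<in> borel_measurable lebesgue"
    using q(2) by (simp add: in_Lq_def set_borel_measurable_def F0_def[abs_def])
  \<comment> \<open>f is only Lebesgue measurable on \<Omega>, whereas the estimates are stated for
    Borel functions; its extension by 0 is replaced by a Borel function equal to it almost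
    everywhere.\<close>
  obtain F where F[measurable]: "F \<in> borel_measurable lborel" and FF0: "AE x in lborel. F0 x = F x"
    using completion_ex_borel_measurable_real[OF F0] by blast
  have Fb[measurable]: "F \<in> borel_measurable borel" using F by simp
  define g where "g x = \<bar>F x\<bar>" for x
  have g: "g \<in> borel_measurable borel" "\<And>x. g x \<ge> 0" unfolding g_def by simp_all
  have fin: "(\<integral>\<^sup>+x. ennreal (g x powr t) \<partial>lborel) < top" if t: "t > 0" "in_Lq t \<Omega> f" for t
  proof -
    have "(\<integral>\<^sup>+x. ennreal (g x powr t) \<partial>lborel) = (\<integral>\<^sup>+x. ennreal (norm (indicator \<Omega> x *\<^sub>R \<bar>f x\<bar> powr t)) \<partial>lborel)"
      by (intro nn_integral_cong_AE eventually_mono[OF FF0]) (use t in \<open>auto simp: g_def F0_def indicator_def\<close>)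
    also have "\<dots> < top"
      using t(2) by (simp add: in_Lq_def set_integrable_def integrable_iff_bounded nn_integral_completion)
    finally show ?thesis .
  qed
  have Fint: "integrable lborel F"
  proof -
    have "(\<integral>\<^sup>+x. ennreal (g x powr 1) \<partial>lborel) < top"
      by (rule fin) (use in_Lq_mono[OF q(2) _ q1 \<Omega>(2,1)] in auto)
    then show ?thesis using g by (simp add: integrable_iff_bounded g_def)
  qed
  \<comment> \<open>Compensates the factor 2^p lost in \<open>sobolev0_bound\<close>, so that the
    coefficient arriving in \<open>energy_ge\<close> is exactly 1 / p.\<close>
  define a where "a = 1 / (p * 2 powr p)"
  have a: "a > 0" "a * 2 powr p = 1 / p" using p1 by (auto simp: a_def)
  \<comment> \<open>A bound for test functions off S becomes a lower bound for the energy on the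
    whole space. It is used with an arbitrary S, to make the infimum meaningful, and with the grid,
    to make the compliance small.\<close>
  have energy: "- B \<le> energy p f \<Omega> u v"
    if B: "B \<ge> 0" and c: "c \<ge> 0" "c \<le> a" and sob: "sobolev0 p (\<Omega> - S) u v"
      and bd: "\<And>\<phi> G. \<phi> \<in> test_functions (\<Omega> - S) \<Longrightarrow> c1_in_box R \<phi> G \<Longrightarrow>
        (\<integral>\<^sup>+x. ennreal (g x * \<bar>\<phi> x\<bar>) \<partial>lborel) \<le> ennreal c * (\<integral>\<^sup>+z. ennreal (norm (G z) powr p) \<partial>lborel) + ennreal B"
    for B c S u v
  proof -
    let ?Y = "\<integral>\<^sup>+x. ennreal (norm (v x) powr p) * indicator \<Omega> x \<partial>lebesgue"
    have bd': "(\<integral>\<^sup>+x. ennreal (\<bar>F0 x\<bar> * \<bar>\<phi> x\<bar>) \<partial>lebesgue) \<le> ennreal a * (\<integral>\<^sup>+z. ennreal (norm (G z) powr p) \<partial>lborel) + ennreal B"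
      if \<phi>: "\<phi> \<in> test_functions (\<Omega> - S)" "\<And>x. (\<phi> has_derivative (\<lambda>h. G x \<bullet> h)) (at x)" for \<phi> G
    proof -
      have c1: "c1_in_box R \<phi> G" using box by (intro test_function_c1_in_box[OF \<phi>]) auto
      have "(\<integral>\<^sup>+x. ennreal (\<bar>F0 x\<bar> * \<bar>\<phi> x\<bar>) \<partial>lebesgue) = (\<integral>\<^sup>+x. ennreal (g x * \<bar>\<phi> x\<bar>) \<partial>lborel)"
        unfolding nn_integral_completion
        by (intro nn_integral_cong_AE eventually_mono[OF FF0]) (auto simp: g_def)
      also have "\<dots> \<le> ennreal c * (\<integral>\<^sup>+z. ennreal (norm (G z) powr p) \<partial>lborel) + ennreal B"
        by (rule bd[OF \<phi>(1) c1])
      also have "\<dots> \<le> ennreal a * (\<integral>\<^sup>+z. ennreal (norm (G z) powr p) \<partial>lborel) + ennreal B"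
        using c by (intro add_right_mono mult_right_mono ennreal_leI) auto
      finally show ?thesis .
    qed
    have box': "\<And>x. x \<in> \<Omega> - S \<Longrightarrow> \<forall>b\<in>Basis. \<bar>x \<bullet> b\<bar> < R" using box by blast
    have m: "(\<lambda>x. \<bar>F0 x\<bar>) \<in> borel_measurable lebesgue" by measurable
    have sb1: "?Y < top"
      by (rule sobolev0_bound(1)[where a=a and B="ennreal B", OF sob p1 box' Diff_subset \<Omega>m m _ _ bd'])
        (use a(1) in simp_all)
    have sb2: "(\<integral>\<^sup>+x. ennreal (\<bar>F0 x\<bar> * \<bar>u x\<bar>) \<partial>lebesgue) \<le> ennreal (a * 2 powr p) * ?Y + ennreal B"
      by (rule sobolev0_bound(2)[where a=a and B="ennreal B", OF sob p1 box' Diff_subset \<Omega>m m _ _ bd'])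
        (use a(1) in simp_all)
    have uv: "u \<in> borel_measurable lebesgue" "v \<in> borel_measurable lebesgue"
      using sob by (auto simp: sobolev0_def)
    show ?thesis
    proof (rule energy_ge[OF \<Omega>m uv _ _ B])
      show "(\<lambda>x. indicator \<Omega> x *\<^sub>R f x) \<in> borel_measurable lebesgue" using F0 by (simp add: F0_def[abs_def])
      show "?Y < top" by (rule sb1)
      show "(\<integral>\<^sup>+x. ennreal (\<bar>indicator \<Omega> x *\<^sub>R f x\<bar> * \<bar>u x\<bar>) \<partial>lebesgue) \<le> ennreal (1 / p) * ?Y + ennreal B"
        using sb2 unfolding a(2) F0_def .
    qed (use p1 in simp)
  qed
  have finq: "(\<integral>\<^sup>+x. ennreal (g x powr q) \<partial>lborel) < top" using fin[OF _ q(2)] q1 by simp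
  obtain B where B: "B \<ge> 0" and gb: "\<And>\<phi> (G :: 'a \<Rightarrow> 'a). c1_in_box R \<phi> G \<Longrightarrow>
    (\<integral>\<^sup>+x. ennreal (g x * \<bar>\<phi> x\<bar>) \<partial>lborel) \<le> ennreal a * (\<integral>\<^sup>+z. ennreal (norm (G z) powr p) \<partial>lborel) + ennreal B"
    using linear_term_le_gradient[OF N R q(1) p1 g finq a(1)] by blast
  have below: "- B \<le> energy p f \<Omega> u v" if "sobolev0 p (\<Omega> - S) u v" for S u v
    by (rule energy[OF B _ _ that gb]) (use a in auto)
  have zero: "sobolev0 p U (\<lambda>_. 0) (\<lambda>_. 0)" for U
    by (rule sobolev0_test_function[OF zero_test_function]) simp
  have small: "compliance p f \<Omega> \<Sigma> \<le> \<eta>" if \<eta>: "\<eta> > 0" for \<eta>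
  proof -
    \<comment> \<open>The minimum with a keeps the gradient coefficient admissible, while the
      remainder stays at most \<eta>.\<close>
    define \<eta>' where "\<eta>' = min \<eta> a"
    have \<eta>': "\<eta>' > 0" using \<eta> a by (simp add: \<eta>'_def)
    have "\<forall>\<^sub>F m in sequentially. hausdorff1 (\<Omega> \<inter> grid_set R L i m) > 0 \<and> m \<ge> 1 \<and>
      (\<forall>\<phi> (G :: 'a \<Rightarrow> 'a). c1_in_box R \<phi> G \<longrightarrow>
       (\<forall>k\<in>grid_index m. \<forall>x\<in>grid_segment (R / m) (min L R / (3 * real m) ^ DIM('a)) i k. \<phi> x = 0) \<longrightarrow>
       (\<integral>\<^sup>+x. ennreal (g x * \<bar>\<phi> x\<bar>) \<partial>lborel) \<le>
         ennreal \<eta>' * (\<integral>\<^sup>+z. ennreal (norm (G z) powr p) \<partial>lborel) + ennreal \<eta>')"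
      by (intro eventually_conj hausdorff1_grid_pos[OF i L R \<Omega>(1,3) box] eventually_ge_at_top
        linear_term_small_on_grid[OF N R q(1) p g finq \<eta>' L i])
    from eventually_happens'[OF sequentially_bot this]
    obtain m where m: "hausdorff1 (\<Omega> \<inter> grid_set R L i m) > 0" "m \<ge> 1" and
      bound: "\<forall>\<phi> (G :: 'a \<Rightarrow> 'a). c1_in_box R \<phi> G \<longrightarrow>
       (\<forall>k\<in>grid_index m. \<forall>x\<in>grid_segment (R / m) (min L R / (3 * real m) ^ DIM('a)) i k. \<phi> x = 0) \<longrightarrow>
       (\<integral>\<^sup>+x. ennreal (g x * \<bar>\<phi> x\<bar>) \<partial>lborel) \<le>
         ennreal \<eta>' * (\<integral>\<^sup>+z. ennreal (norm (G z) powr p) \<partial>lborel) + ennreal \<eta>'"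
      by (elim exE conjE)
    have gm: "(\<integral>\<^sup>+x. ennreal (g x * \<bar>\<phi> x\<bar>) \<partial>lborel) \<le>
         ennreal \<eta>' * (\<integral>\<^sup>+z. ennreal (norm (G z) powr p) \<partial>lborel) + ennreal \<eta>'"
      if "c1_in_box R \<phi> G" "\<And>x. x \<in> grid_set R L i m \<Longrightarrow> \<phi> x = 0" for \<phi> and G :: "'a \<Rightarrow> 'a"
      by (rule bound[rule_format, OF that(1)]) (rule that(2), auto simp: grid_set_def)
    \<comment> \<open>Competitors must lie in the closure of \<Omega>. Cutting the grid down to it
      loses nothing, since the test functions vanish outside \<Omega> anyway.\<close>
    let ?S = "closure \<Omega> \<inter> grid_set R L i m"
    have "compliance p f \<Omega> \<Sigma> \<le> compliance p f \<Omega> ?S"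
    proof (rule min)
      show "closed ?S" by (intro closed_Int closed_closure compact_imp_closed compact_grid_set)
      show "hausdorff1 ?S > 0"
        using m(1) hausdorff1_mono[of "\<Omega> \<inter> grid_set R L i m" ?S] closure_subset[of \<Omega>]
        by (meson Int_mono less_le_trans order_refl)
      show "hausdorff1 ?S \<le> ennreal L" by (rule hausdorff1_grid_le[OF i m(2) L R]) blast
    qed blast
    also have "\<dots> \<le> \<eta>'"
    proof (rule compliance_le[OF zero])
      fix u v assume sob: "sobolev0 p (\<Omega> - ?S) u v"
      show "- \<eta>' \<le> energy p f \<Omega> u v"
      proof (rule energy[OF _ _ _ sob])
        fix \<phi> and G :: "'a \<Rightarrow> 'a" assume \<phi>: "\<phi> \<in> test_functions (\<Omega> - ?S)" and c1: "c1_in_box R \<phi> G"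
        have "\<phi> x = 0" if "x \<in> grid_set R L i m" for x
        proof (rule test_function_gradient(2)[OF \<phi> c1_in_boxD(1)[OF c1]])
          show "x \<notin> \<Omega> - ?S" using that closure_subset[of \<Omega>] by blast
        qed
        then show "(\<integral>\<^sup>+x. ennreal (g x * \<bar>\<phi> x\<bar>) \<partial>lborel) \<le>
         ennreal \<eta>' * (\<integral>\<^sup>+z. ennreal (norm (G z) powr p) \<partial>lborel) + ennreal \<eta>'"
          by (rule gm[OF c1])
      qed (use \<eta>' in \<open>auto simp: \<eta>'_def\<close>)
    qed
    finally show ?thesis by (simp add: \<eta>'_def)
  qed
  have nonpos: "compliance p f \<Omega> \<Sigma> \<le> 0"
    by (rule field_le_epsilon) (use small in simp)
  have pos: "0 \<le> energy p f \<Omega> \<psi> H"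
    if "\<psi> \<in> test_functions (\<Omega> - \<Sigma>)" "\<And>x. (\<psi> has_derivative (\<lambda>h. H x \<bullet> h)) (at x)" for \<psi> H
  proof -
    have "- energy p f \<Omega> \<psi> H \<le> compliance p f \<Omega> \<Sigma>"
      by (rule compliance_ge[where B=B, OF sobolev0_test_function[OF that] below])
    then show ?thesis using nonpos by linarith
  qed
  have "AE x in lborel. x \<in> \<Omega> - \<Sigma> \<longrightarrow> F x = 0"
  proof (rule fundamental_lemma_of_variations[OF Fint])
    show "open (\<Omega> - \<Sigma>)" using \<Omega>(1) \<Sigma>(1) by (rule open_Diff)
    fix \<phi> assume \<phi>: "\<phi> \<in> test_functions (\<Omega> - \<Sigma>)"
    obtain G where G: "\<And>x. (\<phi> has_derivative (\<lambda>h. G x \<bullet> h)) (at x)"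
      using test_function_has_gradient[OF \<phi>] by blast
    have c1: "c1_in_box R \<phi> G"
      by (rule test_function_c1_in_box[OF \<phi> G]) (rule box, simp)
    note [measurable] = c1_in_boxD(6)[OF c1]
    have "(\<integral>x. F x * \<phi> x \<partial>lborel) = (\<integral>x. F x * \<phi> x \<partial>lebesgue)"
      by (rule integral_completion[symmetric]) measurable
    also have "\<dots> = (LINT x:\<Omega>|lebesgue. f x * \<phi> x)"
      unfolding set_lebesgue_integral_def
    proof (rule integral_cong_AE)
      show "(\<lambda>x. F x * \<phi> x) \<in> borel_measurable lebesgue"
        by (rule measurable_completion) measurable
      have "(\<lambda>x. F0 x * \<phi> x) \<in> borel_measurable lebesgue"
        by (intro borel_measurable_times F0 measurable_completion) measurable
      then show "(\<lambda>x. indicator \<Omega> x *\<^sub>R (f x * \<phi> x)) \<in> borel_measurable lebesgue"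
        by (simp add: F0_def mult.assoc)
      show "AE x in lebesgue. F x * \<phi> x = indicator \<Omega> x *\<^sub>R (f x * \<phi> x)"
        using AE_completion[OF FF0] by eventually_elim (simp add: F0_def)
    qed
    also have "\<dots> = 0" by (rule linear_term_zero[OF \<phi> p1 pos])
    finally show "(\<integral>x. F x * \<phi> x \<partial>lborel) = 0" .
  qed
  moreover have "AE x in lborel. x \<notin> \<Sigma>"
    by (rule AE_not_in[OF hausdorff1_finite_null[OF N \<Sigma> L]])
  ultimately have "AE x in lborel. x \<in> \<Omega> \<longrightarrow> f x = 0"
    using FF0 by eventually_elim (auto simp: F0_def)
  then show False using nz AE_completion by blast
qed

theorem theorem1p4:
  fixes \<Omega> :: "(real ^ 'n) set" and f :: "real ^ 'n \<Rightarrow> real" and L p :: real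
  assumes "CARD('n) \<ge> 2"
    and "open \<Omega>" and "bounded \<Omega>" and "\<Omega> \<noteq> {}"
    and "L > 0"
    and "p > real CARD('n) - 1"
    and "q0_hyp CARD('n) p \<Omega> f"
    and "\<not> (AE x in lebesgue. x \<in> \<Omega> \<longrightarrow> f x = 0)"
  shows "\<not> (\<exists>\<Sigma>. closed \<Sigma> \<and> \<Sigma> \<subseteq> closure \<Omega> \<and> 0 < hausdorff1 \<Sigma> \<and> hausdorff1 \<Sigma> \<le> ennreal L \<and>
              (\<forall>\<Sigma>'. closed \<Sigma>' \<and> \<Sigma>' \<subseteq> closure \<Omega> \<and> 0 < hausdorff1 \<Sigma>' \<and> hausdorff1 \<Sigma>' \<le> ennreal L
                     \<longrightarrow> compliance p f \<Omega> \<Sigma> \<le> compliance p f \<Omega> \<Sigma>'))"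
proof (intro notI, elim exE conjE)
  fix \<Sigma> :: "(real ^ 'n) set"
  assume \<Sigma>: "closed \<Sigma>" "hausdorff1 \<Sigma> \<le> ennreal L" and min: "\<forall>\<Sigma>'. closed \<Sigma>' \<and> \<Sigma>' \<subseteq> closure \<Omega> \<and> 0 < hausdorff1 \<Sigma>' \<and>
    hausdorff1 \<Sigma>' \<le> ennreal L \<longrightarrow> compliance p f \<Omega> \<Sigma> \<le> compliance p f \<Omega> \<Sigma>'"
  have D: "DIM(real ^ 'n) = CARD('n)" by simp
  show False
    by (rule no_minimizer[of \<Omega> L p f \<Sigma>, unfolded D, OF assms \<Sigma> min[rule_format]]) (intro conjI)
qed

end
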